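(* There exists a convex domain $\Omega\subset\mathbb{R}^2$ such that, for every $p\in[0,1)$, taking $f(t)=t^p$, the viscosity solution $m_0=(\nabla\varphi_0)^\perp$, where $\varphi_0(x)=\operatorname{dist}(x,\partial\Omega)$, is not a minimizer of $\mathcal{I}_f$ over $A_0(\Omega)$.
   Context: Domains $\Omega\subset\mathbb{R}^2$ are Lipschitz. Define $$A(\Omega)=\{m\in BV(\Omega,\mathbb{R}^2): |m|=1\text{ a.e. and }\nabla\cdot m=0\text{ on }\Omega\},\qquad A_0(\Omega)=\{m\in A(\Omega): m\cdot n=0\text{ a.e. on }\partial\Omega\},$$ where the divergence is distributional and $n$ is the exterior unit normal to $\partial\Omega$. For $v\in\mathbb{R}^2$, $v^\perp$ is the image of $v$ under the rotation of angle $\pi/2$ about the origin. For $m\in A(\Omega)$, $J(m)$ denotes the $\mathcal{H}^1$-rectifiable jump set of $m$ and $m_\pm$ its traces on the two sides of $J(m)$. The line energy with jump cost $f\colon[0,2]\to[0,+\infty]$ is $$\mathcal{I}_f(m)=\int_{J(m)}f(|m_+-m_-|)\,d\mathcal{H}^1,$$ where $\mathcal{H}^1$ is the one-dimensional Hausdorff measure. *)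

theory Defs
  imports "HOL-Analysis.Analysis"
begin

section \<open>Planar calculus and test functions\<close>

definition perp :: "real^2 \<Rightarrow> real^2" where
  "perp v = vector [- (v $ 2), v $ 1]"

definition partial_deriv :: "2 \<Rightarrow> (real^2 \<Rightarrow> 'b::real_normed_vector) \<Rightarrow> real^2 \<Rightarrow> 'b" where
  "partial_deriv j f x = frechet_derivative f (at x) (axis j 1)"

text \<open>At points where the function is not differentiable the gradient has an unspecified value.\<close>

definition gradient :: "(real^2 \<Rightarrow> real) \<Rightarrow> real^2 \<Rightarrow> real^2" where
  "gradient f x = (\<chi> j. partial_deriv j f x)"

primrec C_k :: "nat \<Rightarrow> (real^2 \<Rightarrow> 'b::real_normed_vector) \<Rightarrow> bool" where
  "C_k 0 f \<longleftrightarrow> continuous_on UNIV f"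
| "C_k (Suc k) f \<longleftrightarrow> (\<forall>x. f differentiable (at x)) \<and> (\<forall>j. C_k k (partial_deriv j f))"

definition compactly_supported_in :: "(real^2) set \<Rightarrow> (real^2 \<Rightarrow> 'b::real_normed_vector) \<Rightarrow> bool" where
  "compactly_supported_in \<Omega> f \<longleftrightarrow>
     compact (closure {x. f x \<noteq> 0}) \<and> closure {x. f x \<noteq> 0} \<subseteq> \<Omega>"


section \<open>Lipschitz domains\<close>

text \<open>Near each boundary point, in the orthonormal frame \<open>(perp e, e)\<close>, the domain is the
  region below the graph of a Lipschitz function.\<close>

definition lipschitz_domain :: "(real^2) set \<Rightarrow> bool" where
  "lipschitz_domain \<Omega> \<longleftrightarrow>
     open \<Omega> \<and> connected \<Omega> \<and> bounded \<Omega> \<and> \<Omega> \<noteq> {} \<and>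
     (\<forall>p\<in>frontier \<Omega>. \<exists>e r L. \<exists>g :: real \<Rightarrow> real.
        norm e = 1 \<and> r > 0 \<and> L-lipschitz_on UNIV g \<and>
        \<Omega> \<inter> ball p r = {y \<in> ball p r. y \<bullet> e < g (y \<bullet> perp e)})"

text \<open>For a Lipschitz domain this holds exactly when the local graph is differentiable at \<open>x\<close>
  and \<open>\<nu>\<close> is the classical exterior unit normal there.\<close>

definition exterior_unit_normal :: "(real^2) set \<Rightarrow> real^2 \<Rightarrow> real^2 \<Rightarrow> bool" where
  "exterior_unit_normal \<Omega> x \<nu> \<longleftrightarrow>
     x \<in> frontier \<Omega> \<and> norm \<nu> = 1 \<and>
     (\<forall>\<epsilon>>0. \<exists>r>0. \<forall>y\<in>ball x r.
        ((y - x) \<bullet> \<nu> < - \<epsilon> * norm (y - x) \<longrightarrow> y \<in> \<Omega>) \<and>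
        ((y - x) \<bullet> \<nu> > \<epsilon> * norm (y - x) \<longrightarrow> y \<notin> \<Omega>))"


section \<open>One-dimensional Hausdorff measure\<close>

definition hausdorff1_pre :: "real \<Rightarrow> (real^2) set \<Rightarrow> ennreal" where
  "hausdorff1_pre \<delta> E =
     (INF C \<in> {C :: nat \<Rightarrow> (real^2) set.
                 (\<forall>n. bounded (C n) \<and> diameter (C n) \<le> \<delta>) \<and> E \<subseteq> (\<Union>n. C n)}.
        \<Sum>n. ennreal (diameter (C n)))"

definition hausdorff1_outer :: "(real^2) set \<Rightarrow> ennreal" where
  "hausdorff1_outer E = (SUP \<delta>\<in>{0<..}. hausdorff1_pre \<delta> E)"

text \<open>The outer measure is a metric outer measure, hence (Caratheodory's criterion) countably
  additive on Borel sets, so \<open>measure_of\<close> does not fall back to the null measure here.\<close>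

definition hausdorff1 :: "(real^2) measure" where
  "hausdorff1 = measure_of UNIV (sets borel) hausdorff1_outer"


section \<open>Functions of bounded variation, traces and jump set\<close>

text \<open>Vector fields are functions on the whole plane of which only the values on the domain,
  up to Lebesgue null sets, matter.  The second conjunct says that the total variation on the
  domain, i.e. the supremum of the integrals over fields with pointwise Frobenius norm at most
  one, is finite.\<close>

definition BV :: "(real^2) set \<Rightarrow> (real^2 \<Rightarrow> real^2) set" where
  "BV \<Omega> = {m. set_integrable lebesgue \<Omega> m \<and>
     bdd_above {(LINT x:\<Omega>|lebesgue. (\<Sum>i\<in>UNIV. m x $ i * (\<Sum>j\<in>UNIV. partial_deriv j \<Phi> x $ i $ j)))
       | \<Phi> :: real^2 \<Rightarrow> real^2^2.
         C_k 1 \<Phi> \<and> compactly_supported_in \<Omega> \<Phi> \<and> (\<forall>x. norm (\<Phi> x) \<le> 1)}}"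

definition divergence_free :: "(real^2) set \<Rightarrow> (real^2 \<Rightarrow> real^2) \<Rightarrow> bool" where
  "divergence_free \<Omega> m \<longleftrightarrow>
     (\<forall>\<psi> :: real^2 \<Rightarrow> real. (\<forall>k. C_k k \<psi>) \<and> compactly_supported_in \<Omega> \<psi> \<longrightarrow>
        (LINT x:\<Omega>|lebesgue. m x \<bullet> gradient \<psi> x) = 0)"

text \<open>\<open>a\<close> is the \<open>L\<^sup>1\<close>-approximate limit of \<open>m\<close> at \<open>x\<close> along \<open>S\<close>.  It is used only when \<open>m\<close> is
  integrable on \<open>S\<close> near \<open>x\<close> (otherwise the Bochner integral is zero by convention).\<close>

definition approx_limit_along ::
  "(real^2) set \<Rightarrow> (real^2 \<Rightarrow> real^2) \<Rightarrow> real^2 \<Rightarrow> real^2 \<Rightarrow> bool" where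
  "approx_limit_along S m x a \<longleftrightarrow>
     ((\<lambda>r. (LINT y:(S \<inter> ball x r)|lebesgue. norm (m y - a)) / measure lebesgue (S \<inter> ball x r))
        \<longlongrightarrow> 0) (at_right 0)"

definition jump_triple ::
  "(real^2 \<Rightarrow> real^2) \<Rightarrow> real^2 \<Rightarrow> real^2 \<Rightarrow> real^2 \<Rightarrow> real^2 \<Rightarrow> bool" where
  "jump_triple m x a b \<nu> \<longleftrightarrow>
     norm \<nu> = 1 \<and> a \<noteq> b \<and>
     approx_limit_along {y. (y - x) \<bullet> \<nu> > 0} m x a \<and>
     approx_limit_along {y. (y - x) \<bullet> \<nu> < 0} m x b"

definition jump_set :: "(real^2) set \<Rightarrow> (real^2 \<Rightarrow> real^2) \<Rightarrow> (real^2) set" where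
  "jump_set \<Omega> m = {x \<in> \<Omega>. \<exists>a b \<nu>. jump_triple m x a b \<nu>}"

text \<open>The triple at a jump point is unique up to exchanging \<open>(a, b, \<nu>)\<close> and \<open>(b, a, - \<nu>)\<close>, so the
  distance between the two traces is well defined there.\<close>

definition jump_size :: "(real^2 \<Rightarrow> real^2) \<Rightarrow> real^2 \<Rightarrow> real" where
  "jump_size m x = (THE t. \<exists>a b \<nu>. jump_triple m x a b \<nu> \<and> t = norm (a - b))"


section \<open>Admissible fields, line energies, viscosity solution\<close>

definition admissible :: "(real^2) set \<Rightarrow> (real^2 \<Rightarrow> real^2) set" where
  "admissible \<Omega> = {m \<in> BV \<Omega>.
     (AE x in lebesgue. x \<in> \<Omega> \<longrightarrow> norm (m x) = 1) \<and> divergence_free \<Omega> m}"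

text \<open>On the boundary, \<open>m\<close> stands for its BV trace \<open>a\<close>.  Trace and normal exist almost everywhere
  on the boundary of a Lipschitz domain, and are unique.\<close>

definition admissible0 :: "(real^2) set \<Rightarrow> (real^2 \<Rightarrow> real^2) set" where
  "admissible0 \<Omega> = {m \<in> admissible \<Omega>.
     AE x in hausdorff1. x \<in> frontier \<Omega> \<longrightarrow>
       (\<exists>\<nu> a. exterior_unit_normal \<Omega> x \<nu> \<and> approx_limit_along \<Omega> m x a \<and> a \<bullet> \<nu> = 0)}"

definition line_energy :: "(real \<Rightarrow> ennreal) \<Rightarrow> (real^2) set \<Rightarrow> (real^2 \<Rightarrow> real^2) \<Rightarrow> ennreal" where
  "line_energy f \<Omega> m = (\<integral>\<^sup>+x\<in>jump_set \<Omega> m. f (jump_size m x) \<partial>hausdorff1)"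

definition viscosity_solution :: "(real^2) set \<Rightarrow> real^2 \<Rightarrow> real^2" where
  "viscosity_solution \<Omega> x = perp (gradient (\<lambda>y. infdist y (frontier \<Omega>)) x)"

end

theory Submission
  imports Defs "HOL-Real_Asymp.Real_Asymp"
begin

text \<open>A domain circumscribed about the unit disc, with outer normals \<open>n\<close> in a compact set, is
  \<open>{x. h x < 1}\<close> for \<open>h x = max (x \<bullet> n)\<close>, and the distance to its boundary is \<open>1 - h\<close>.  Each pair of
  adjacent normals at angle \<open>\<alpha>\<close> yields a wall of the viscosity solution on their bisector, with a
  length bounded below and with jump about \<open>\<alpha>\<close>.  For infinitely many normals whose angles behave like
  \<open>\<alpha>\<^sub>k \<sim> 1 / (k (ln k)\<^sup>2)\<close> the sum of \<open>\<alpha>\<^sub>k powr p\<close> diverges for every \<open>p < 1\<close>, so that the viscosity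
  solution has infinite energy for all \<open>p\<close> simultaneously.

  The competitor is the rotated gradient of \<open>min (1 - h) (norm - 1)\<close>.  It is a reversed vortex except
  close to the corners, where each wall is cut down to length of order \<open>\<alpha>\<^sub>k\<^sup>2\<close>, at the price of one
  closed curve of finite length on which the jump is at most \<open>2\<close>.  So its energy is finite.  Since the
  potential is a difference of two convex functions, membership in \<open>BV\<close> and vanishing divergence follow
  from general facts on subgradients.\<close>

section \<open>The one-dimensional Hausdorff measure\<close>

text \<open>The sign in \<open>norm - 1\<close> is forced by the boundary condition. Since
  \<open>h \<le> norm\<close>, the minimum of \<open>1 - h\<close> and \<open>1 - norm\<close> is
  just \<open>1 - norm\<close>, whose vortex is not tangential to the polygon. With
  \<open>norm - 1\<close> the two potentials agree where \<open>norm + h = 2\<close>, and a boundary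
  point has \<open>h = 1 \<le> norm\<close>, so it lies beyond that curve unless it is a point of
  tangency. The boundary condition is therefore inherited from \<open>1 - h\<close> off a countable
  set. The logarithmic scale of the angles is what treats all \<open>p < 1\<close> at once: the gaps
  telescope to a finite sum, yet eventually dominate \<open>k powr (- q)\<close> for every
  \<open>q > 1\<close>. The obstacle is that jumps are defined by approximate limits and that the
  gradient of the distance is unspecified at ties. Hence each energy is estimated from one side
  only: the competitor is continuous off an explicit Borel set of finite length, which encloses its
  jump set, while for the viscosity solution one radial piece of each wall is exhibited inside the
  jump set, all pieces having the same extent.\<close>

text \<open>Caratheodory's criterion. The shells \<open>D n\<close> around \<open>F\<close> shrink
  towards it, and two shells of equal parity have positive distance, so their measures have a finite
  sum when \<open>\<mu> A\<close> is finite. Hence the part of \<open>A - F\<close> close to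
  \<open>F\<close> has measure tending to zero.\<close>

lemma metric_outer_measure_closed:
  fixes \<mu> :: "'a::metric_space set \<Rightarrow> ennreal"
  assumes oms: "outer_measure_space UNIV \<mu>"
    and sep: "\<And>A B d. d > 0 \<Longrightarrow> (\<And>x y. x \<in> A \<Longrightarrow> y \<in> B \<Longrightarrow> d \<le> dist x y) \<Longrightarrow> \<mu> A + \<mu> B \<le> \<mu> (A \<union> B)"
    and F: "closed F"
  shows "F \<in> lambda_system UNIV UNIV \<mu>"
proof -
  have mono: "\<mu> A \<le> \<mu> B" if "A \<subseteq> B" for A B
    using oms that by (auto simp: outer_measure_space_def increasing_def)
  have empty: "\<mu> {} = 0"
    using oms by (auto simp: outer_measure_space_def positive_def)
  have csub: "\<mu> (\<Union>i. A i) \<le> (\<Sum>i. \<mu> (A i))" for A :: "nat \<Rightarrow> 'a set" 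
  proof -
    have "\<mu> (\<Union>i. A i) = \<mu> (\<Union>i. disjointed A i)" by (simp add: UN_disjointed_eq)
    also have "\<dots> \<le> (\<Sum>i. \<mu> (disjointed A i))"
      using oms disjoint_family_disjointed[of A] by (auto simp: outer_measure_space_def countably_subadditive_def)
    also have "\<dots> \<le> (\<Sum>i. \<mu> (A i))"
      by (intro suminf_le mono disjointed_subset) auto
    finally show ?thesis .
  qed
  have sub2: "\<mu> (A \<union> B) \<le> \<mu> A + \<mu> B" for A B
  proof -
    have "\<mu> (A \<union> B) = \<mu> (\<Union>i. if i = 0 then A else if i = Suc 0 then B else {})"
      by (rule arg_cong[of _ _ \<mu>]) (fastforce split: if_splits)
    also have "\<dots> \<le> (\<Sum>i. \<mu> (if i = 0 then A else if i = Suc 0 then B else {}))" by (rule csub)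
    also have "\<dots> = (\<Sum>i\<in>{0, Suc 0}. \<mu> (if i = 0 then A else if i = Suc 0 then B else {}))"
      by (rule suminf_finite) (auto simp: empty)
    finally show ?thesis by simp
  qed
  \<comment> \<open>An empty \<open>F\<close> would make \<open>infdist\<close> vanish identically,
    and an infinite \<open>\<mu> A\<close> makes the inequality trivial; both cases are settled at
    the end.\<close>
  have key: "\<mu> (A \<inter> F) + \<mu> (A - F) \<le> \<mu> A" if ne: "F \<noteq> {}" and fin: "\<mu> A < \<infinity>" for A
  proof -
    define R where "R n = {x\<in>A. inverse (real (Suc n)) \<le> infdist x F}" for n
    define D where "D n = {x\<in>A. inverse (real (Suc (Suc n))) \<le> infdist x F \<and> infdist x F < inverse (real (Suc n))}" for n
    have RF: "\<mu> (A \<inter> F) + \<mu> (R n) \<le> \<mu> A" for n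
    proof -
      have "\<mu> (A \<inter> F) + \<mu> (R n) \<le> \<mu> (A \<inter> F \<union> R n)"
      proof (rule sep[of "inverse (real (Suc n))"])
        fix x y assume "x \<in> A \<inter> F" "y \<in> R n"
        then show "inverse (real (Suc n)) \<le> dist x y"
          using infdist_le[of x F y] by (auto simp: R_def dist_commute)
      qed simp
      also have "\<dots> \<le> \<mu> A" by (rule mono) (auto simp: R_def)
      finally show ?thesis .
    qed
    have step: "(\<Sum>k<N. \<mu> (D (2*k+c))) \<le> \<mu> {x\<in>A. inverse (real (2*N+c)) \<le> infdist x F}" if "c < 2" for N c
    proof (induction N)
      case 0 show ?case by simp
    next
      case (Suc N)
      let ?U = "{x\<in>A. inverse (real (2*N+c)) \<le> infdist x F}"
      show ?case
      \<comment> \<open>\<open>inverse 0 = 0\<close> turns \<open>?U\<close> into all of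
        \<open>A\<close>, so there is no gap to the next shell; the sum then has the single term for
        \<open>D 0\<close>, which lies in the target set.\<close>
      proof (cases "2*N+c = 0")
        case True
        then show ?thesis by (auto intro!: mono simp: D_def numeral_2_eq_2)
      next
        case False
        have "(\<Sum>k<Suc N. \<mu> (D (2*k+c))) \<le> \<mu> ?U + \<mu> (D (2*N+c))"
          using Suc.IH by (simp add: add_mono)
        also have "\<dots> \<le> \<mu> (?U \<union> D (2*N+c))"
        proof (rule sep[of "inverse (real (2*N+c)) - inverse (real (Suc (2*N+c)))"])
          show "0 < inverse (real (2*N+c)) - inverse (real (Suc (2*N+c)))"
            using False by (intro diff_gt_0_iff_gt[THEN iffD2] less_imp_inverse_less) auto
          fix x y assume "x \<in> ?U" "y \<in> D (2*N+c)"
          then show "inverse (real (2*N+c)) - inverse (real (Suc (2*N+c))) \<le> dist x y"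
            using infdist_triangle[of x F y] by (auto simp: D_def)
        qed
        also have "\<dots> \<le> \<mu> {x\<in>A. inverse (real (2*(Suc N)+c)) \<le> infdist x F}"
        proof (rule mono, safe)
          fix x assume "inverse (real (2*N+c)) \<le> infdist x F"
          moreover have "inverse (real (2*(Suc N)+c)) \<le> inverse (real (2*N+c))"
            using False by (intro le_imp_inverse_le) auto
          ultimately show "inverse (real (2*(Suc N)+c)) \<le> infdist x F" by linarith
        qed (auto simp: D_def)
        finally show ?thesis .
      qed
    qed
    have half: "(\<Sum>k<N. \<mu> (D (2*k+c))) \<le> \<mu> A" if "c < 2" for N c
      by (rule order_trans[OF step[OF that]]) (auto intro!: mono)
    have part: "(\<Sum>k<N. \<mu> (D k)) \<le> \<mu> A + \<mu> A" for N
    proof -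
      have "(\<Sum>k<N. \<mu> (D k)) \<le> (\<Sum>k<2*N. \<mu> (D k))"
        by (rule sum_mono2) auto
      also have "\<dots> = (\<Sum>k<N. \<mu> (D (2*k+0))) + (\<Sum>k<N. \<mu> (D (2*k+1)))"
        by (induction N) (auto simp: algebra_simps)
      also have "\<dots> \<le> \<mu> A + \<mu> A" by (intro add_mono half) auto
      finally show ?thesis .
    qed
    define S where "S = (\<Sum>k. \<mu> (D k))"
    have Sfin: "S < \<infinity>"
    proof -
      have "S \<le> \<mu> A + \<mu> A" unfolding S_def by (rule suminf_le_const) (auto intro: part)
      also have "\<dots> < \<infinity>" using fin by simp
      finally show ?thesis .
    qed
    \<comment> \<open>Adding the first \<open>n\<close> shells completes the tail to the whole sum
      \<open>S\<close>, so nothing is subtracted in \<open>ennreal\<close>; the finite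
      \<open>S\<close> cancels in the limit.\<close>
    have "\<mu> (A \<inter> F) + \<mu> (A - F) + (\<Sum>k<n. \<mu> (D k)) \<le> \<mu> A + S" for n
    proof -
      have "A - F \<subseteq> R n \<union> (\<Union>k. D (k + n))"
      proof
        fix x assume x: "x \<in> A - F"
        then have pos: "infdist x F > 0"
          using F ne by (metis DiffD2 in_closed_iff_infdist_zero infdist_nonneg less_eq_real_def)
        show "x \<in> R n \<union> (\<Union>k. D (k + n))"
        proof (cases "x \<in> R n")
          case False
          obtain m where m: "inverse (real (Suc m)) < infdist x F" using reals_Archimedean[OF pos] by blast
          define j where "j = (LEAST j. inverse (real (Suc j)) \<le> infdist x F)"
          have j1: "inverse (real (Suc j)) \<le> infdist x F" unfolding j_def
            by (rule LeastI[of _ m]) (use m in simp)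
          have j2: "infdist x F < inverse (real (Suc i))" if "i < j" for i
            using not_less_Least[OF that[unfolded j_def]] by simp
          have "j > n"
          proof (rule ccontr)
            assume "\<not> j > n"
            then have "inverse (real (Suc n)) \<le> inverse (real (Suc j))" by (intro le_imp_inverse_le) auto
            with j1 have "inverse (real (Suc n)) \<le> infdist x F" by linarith
            with False x show False by (simp add: R_def)
          qed
          then obtain k where k: "j = Suc (k + n)" by (metis add.commute less_iff_Suc_add)
          have "x \<in> D (k + n)" using j1 j2[of "k+n"] x k by (auto simp: D_def)
          then show ?thesis by blast
        qed auto
      qed
      then have "\<mu> (A - F) \<le> \<mu> (R n \<union> (\<Union>k. D (k + n)))" by (rule mono)
      also have "\<dots> \<le> \<mu> (R n) + (\<Sum>k. \<mu> (D (k + n)))"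
        by (rule order_trans[OF sub2]) (intro add_mono csub order_refl)
      finally have "\<mu> (A \<inter> F) + \<mu> (A - F) + (\<Sum>k<n. \<mu> (D k))
          \<le> \<mu> (A \<inter> F) + (\<mu> (R n) + (\<Sum>k. \<mu> (D (k + n)))) + (\<Sum>k<n. \<mu> (D k))"
        by (intro add_mono order_refl)
      also have "\<dots> = (\<mu> (A \<inter> F) + \<mu> (R n)) + ((\<Sum>k. \<mu> (D (k + n))) + (\<Sum>k<n. \<mu> (D k)))"
        by (simp add: ac_simps)
      also have "(\<Sum>k. \<mu> (D (k + n))) + (\<Sum>k<n. \<mu> (D k)) = S"
        unfolding S_def by (rule suminf_offset[symmetric]) auto
      also have "\<mu> (A \<inter> F) + \<mu> (R n) + S \<le> \<mu> A + S" by (intro add_mono RF order_refl)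
      finally show ?thesis .
    qed
    moreover have "(\<lambda>n. \<mu> (A \<inter> F) + \<mu> (A - F) + (\<Sum>k<n. \<mu> (D k))) \<longlonglongrightarrow> \<mu> (A \<inter> F) + \<mu> (A - F) + S"
      unfolding S_def by (intro tendsto_add tendsto_const summable_LIMSEQ) auto
    ultimately have "\<mu> (A \<inter> F) + \<mu> (A - F) + S \<le> \<mu> A + S"
      by (intro LIMSEQ_le_const2) auto
    then show ?thesis using Sfin by (auto simp: ennreal_add_left_cancel_le add.commute)
  qed
  interpret algebra UNIV "UNIV :: 'a set set" by (simp add: algebra_iff_Un)
  have "\<mu> (A \<inter> F) + \<mu> (A - F) = \<mu> A" for A
  proof (rule antisym)
    show "\<mu> (A \<inter> F) + \<mu> (A - F) \<le> \<mu> A"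
    proof (cases "F = {} \<or> \<mu> A = \<infinity>")
      case True then show ?thesis by (auto simp: empty)
    next
      case False then show ?thesis using key[of A] by (simp add: top.not_eq_extremum)
    qed
    show "\<mu> A \<le> \<mu> (A \<inter> F) + \<mu> (A - F)"
      using sub2[of "A \<inter> F" "A - F"] by (simp add: Int_Diff_Un)
  qed
  then show ?thesis by (simp add: lambda_system_eq)
qed


section \<open>Hausdorff premeasures and additivity on Borel sets\<close>

lemma hausdorff1_pre_mono: "E \<subseteq> F \<Longrightarrow> hausdorff1_pre \<delta> E \<le> hausdorff1_pre \<delta> F"
  unfolding hausdorff1_pre_def by (rule INF_superset_mono) auto

lemma hausdorff1_pre_antimono: "\<delta> \<le> \<delta>' \<Longrightarrow> hausdorff1_pre \<delta>' E \<le> hausdorff1_pre \<delta> E"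
  unfolding hausdorff1_pre_def by (rule INF_superset_mono) (auto intro: order_trans)

lemma hausdorff1_pre_le_outer: "0 < \<delta> \<Longrightarrow> hausdorff1_pre \<delta> E \<le> hausdorff1_outer E"
  unfolding hausdorff1_outer_def by (rule SUP_upper) auto

lemma hausdorff1_pre_upper:
  assumes "\<And>n. bounded (C n)" "\<And>n. diameter (C n) \<le> \<delta>" "E \<subseteq> (\<Union>n. C n)"
  shows "hausdorff1_pre \<delta> E \<le> (\<Sum>n. ennreal (diameter (C n)))"
  unfolding hausdorff1_pre_def by (rule INF_lower) (use assms in auto)

lemma hausdorff1_pre_UN_le:
  assumes \<delta>: "0 < \<delta>"
  shows "hausdorff1_pre \<delta> (\<Union>i. A i) \<le> (\<Sum>i. hausdorff1_pre \<delta> (A i))"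
proof (rule ennreal_le_epsilon)
  fix e :: real assume fin: "(\<Sum>i. hausdorff1_pre \<delta> (A i)) < top" and e: "0 < e"
  define r where "r i = hausdorff1_pre \<delta> (A i) + ennreal (e * (1/2)^Suc i)" for i
  have "hausdorff1_pre \<delta> (A i) \<noteq> top" for i
    using fin ennreal_suminf_lessD[of "\<lambda>i. hausdorff1_pre \<delta> (A i)" top i] by auto
  then have less: "hausdorff1_pre \<delta> (A i) < r i" for i
    using e unfolding r_def by (simp add: ennreal_add_left_cancel_less less_top)
  have "\<exists>C::nat \<Rightarrow> (real^2) set. (\<forall>n. bounded (C n) \<and> diameter (C n) \<le> \<delta>) \<and> A i \<subseteq> (\<Union>n. C n) \<and>
       (\<Sum>n. ennreal (diameter (C n))) < r i" for i
    using less[of i] unfolding hausdorff1_pre_def INF_less_iff by auto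
  then obtain C :: "nat \<Rightarrow> nat \<Rightarrow> (real^2) set" where C: "\<And>i n. bounded (C i n)" "\<And>i n. diameter (C i n) \<le> \<delta>"
      "\<And>i. A i \<subseteq> (\<Union>n. C i n)" "\<And>i. (\<Sum>n. ennreal (diameter (C i n))) < r i"
    by metis
  have "hausdorff1_pre \<delta> (\<Union>i. A i) \<le> (\<Sum>k. ennreal (diameter (case prod_decode k of (i, n) \<Rightarrow> C i n)))"
  proof (rule hausdorff1_pre_upper)
    show "(\<Union>i. A i) \<subseteq> (\<Union>k. case prod_decode k of (i, n) \<Rightarrow> C i n)"
    proof
      fix x assume "x \<in> (\<Union>i. A i)"
      then obtain i n where "x \<in> C i n" using C(3) by blast
      then have "x \<in> (case prod_decode (prod_encode (i, n)) of (i, n) \<Rightarrow> C i n)" by simp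
      then show "x \<in> (\<Union>k. case prod_decode k of (i, n) \<Rightarrow> C i n)" by (rule UN_I[OF UNIV_I])
    qed
  qed (auto split: prod.split simp: C)
  also have "\<dots> = (\<Sum>k. (\<lambda>(i, n). ennreal (diameter (C i n))) (prod_decode k))"
    by (intro suminf_cong) (auto split: prod.split)
  also have "\<dots> = (\<Sum>i. \<Sum>n. ennreal (diameter (C i n)))"
    by (rule suminf_ennreal_2dimen) simp
  also have "\<dots> \<le> (\<Sum>i. hausdorff1_pre \<delta> (A i) + ennreal (e * (1/2)^Suc i))"
    unfolding r_def[symmetric] by (intro suminf_le less_imp_le C) auto
  also have "\<dots> = (\<Sum>i. hausdorff1_pre \<delta> (A i)) + (\<Sum>i. ennreal (e * (1/2)^Suc i))"
    by (rule suminf_add[symmetric]) auto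
  also have "(\<Sum>i. ennreal (e * (1/2)^Suc i)) = ennreal (\<Sum>i. e * (1/2)^Suc i)"
    using e by (intro suminf_ennreal2 summable_mult sums_summable[OF power_half_series]) auto
  also have "(\<Sum>i. e * (1/2)^Suc i) = e"
    using sums_unique[OF sums_mult[OF power_half_series, of e]] by simp
  finally show "hausdorff1_pre \<delta> (\<Union>i. A i) \<le> (\<Sum>i. hausdorff1_pre \<delta> (A i)) + ennreal e" .
qed

lemma hausdorff1_pre_empty: "0 < \<delta> \<Longrightarrow> hausdorff1_pre \<delta> {} = 0"
  using hausdorff1_pre_upper[of "\<lambda>_. {}" \<delta> "{}"] by simp

lemma hausdorff1_outer_mono: "E \<subseteq> F \<Longrightarrow> hausdorff1_outer E \<le> hausdorff1_outer F"
  unfolding hausdorff1_outer_def by (intro SUP_mono) (auto intro: hausdorff1_pre_mono)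

lemma hausdorff1_outer_empty: "hausdorff1_outer {} = 0"
  proof (rule antisym)
  show "hausdorff1_outer {} \<le> 0"
    unfolding hausdorff1_outer_def by (rule SUP_least) (simp add: hausdorff1_pre_empty)
qed simp

lemma hausdorff1_outer_UN_le: "hausdorff1_outer (\<Union>i. A i) \<le> (\<Sum>i. hausdorff1_outer (A i))"
  unfolding hausdorff1_outer_def[of "\<Union>i. A i"]
proof (rule SUP_least)
  fix \<delta> :: real assume "\<delta> \<in> {0<..}"
  then show "hausdorff1_pre \<delta> (\<Union>i. A i) \<le> (\<Sum>i. hausdorff1_outer (A i))"
    by (intro order_trans[OF hausdorff1_pre_UN_le] suminf_le hausdorff1_pre_le_outer) auto
qed

text \<open>A set of diameter below \<open>d\<close> cannot meet both \<open>A\<close> and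
  \<open>B\<close>, so a fine cover of the union splits into a cover of each. This is the separation
  property in Caratheodory's criterion.\<close>

lemma hausdorff1_outer_separated:
  assumes d: "d > 0" and sep: "\<And>x y. x \<in> A \<Longrightarrow> y \<in> B \<Longrightarrow> d \<le> dist x y"
  shows "hausdorff1_outer A + hausdorff1_outer B \<le> hausdorff1_outer (A \<union> B)"
proof -
  have small: "hausdorff1_pre \<delta> A + hausdorff1_pre \<delta> B \<le> hausdorff1_pre \<delta> (A \<union> B)" if \<delta>: "0 < \<delta>" "\<delta> < d" for \<delta>
    unfolding hausdorff1_pre_def[of \<delta> "A \<union> B"]
  proof (rule INF_greatest, clarsimp)
    fix C :: "nat \<Rightarrow> (real^2) set"
    assume C: "\<forall>n. bounded (C n) \<and> diameter (C n) \<le> \<delta>" "A \<subseteq> (\<Union>n. C n)" "B \<subseteq> (\<Union>n. C n)"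
    define D where "D X n = (if C n \<inter> X = {} then {} else C n)" for X n
    have D: "hausdorff1_pre \<delta> X \<le> (\<Sum>n. ennreal (diameter (D X n)))" if "X \<subseteq> (\<Union>n. C n)" for X
      by (rule hausdorff1_pre_upper) (use that C \<delta> in \<open>auto simp: D_def\<close>, blast)
    have "hausdorff1_pre \<delta> A + hausdorff1_pre \<delta> B \<le> (\<Sum>n. ennreal (diameter (D A n))) + (\<Sum>n. ennreal (diameter (D B n)))"
      by (intro add_mono D C)
    also have "\<dots> = (\<Sum>n. ennreal (diameter (D A n)) + ennreal (diameter (D B n)))"
      by (rule suminf_add) auto
    also have "\<dots> \<le> (\<Sum>n. ennreal (diameter (C n)))"
    proof (intro suminf_le)
      fix n
      have "C n \<inter> A = {} \<or> C n \<inter> B = {}"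
      proof (rule ccontr)
        assume "\<not> ?thesis"
        then obtain x y where xy: "x \<in> C n" "x \<in> A" "y \<in> C n" "y \<in> B" by blast
        have "dist x y \<le> diameter (C n)" using C xy by (intro diameter_bounded_bound) auto
        then show False using C(1)[rule_format, of n] sep[OF xy(2,4)] \<delta> by linarith
      qed
      then show "ennreal (diameter (D A n)) + ennreal (diameter (D B n)) \<le> ennreal (diameter (C n))"
        by (auto simp: D_def)
    qed auto
    finally show "hausdorff1_pre \<delta> A + hausdorff1_pre \<delta> B \<le> (\<Sum>n. ennreal (diameter (C n)))" .
  qed
  \<comment> \<open>Independent scales for the two sets allow the two suprema to be taken one after
    the other.\<close>
  have "hausdorff1_pre \<delta> A + hausdorff1_pre \<delta>' B \<le> hausdorff1_outer (A \<union> B)" if "0 < \<delta>" "0 < \<delta>'" for \<delta> \<delta>'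
  proof -
    let ?m = "min (min \<delta> \<delta>') (d/2)"
    have "hausdorff1_pre \<delta> A + hausdorff1_pre \<delta>' B \<le> hausdorff1_pre ?m A + hausdorff1_pre ?m B"
      by (intro add_mono hausdorff1_pre_antimono) auto
    also have "\<dots> \<le> hausdorff1_pre ?m (A \<union> B)" using that d by (intro small) auto
    also have "\<dots> \<le> hausdorff1_outer (A \<union> B)" using that d by (intro hausdorff1_pre_le_outer) auto
    finally show ?thesis .
  qed
  then have "hausdorff1_outer A + hausdorff1_pre \<delta>' B \<le> hausdorff1_outer (A \<union> B)" if "0 < \<delta>'" for \<delta>'
    unfolding hausdorff1_outer_def[of A] using that
    by (subst ennreal_SUP_add_left[symmetric]) (auto intro!: SUP_least)
  then have "hausdorff1_outer B + hausdorff1_outer A \<le> hausdorff1_outer (A \<union> B)"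
    unfolding hausdorff1_outer_def[of B]
    by (subst ennreal_SUP_add_left[symmetric]) (auto intro!: SUP_least simp: add.commute)
  then show ?thesis by (simp add: add.commute)
qed

lemma hausdorff1_outer_measure_space: "outer_measure_space UNIV hausdorff1_outer"
  unfolding outer_measure_space_def positive_def increasing_def countably_subadditive_def
  by (auto intro: hausdorff1_outer_mono hausdorff1_outer_UN_le simp: hausdorff1_outer_empty)

text \<open>All closed sets satisfy Caratheodory's condition, hence so do the Borel sets that they
  generate; \<open>measure_of\<close> then returns the outer measure itself.\<close>

lemma emeasure_hausdorff1:
  assumes "A \<in> sets borel"
  shows "emeasure hausdorff1 A = hausdorff1_outer A"
proof -
  interpret sigma_algebra UNIV "UNIV :: (real^2) set set" by (metis Pow_UNIV sigma_algebra_Pow)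
  let ?L = "lambda_system UNIV UNIV hausdorff1_outer"
  have ms: "measure_space UNIV ?L hausdorff1_outer"
    using caratheodory_lemma[of hausdorff1_outer] hausdorff1_outer_measure_space by simp
  then have sL: "sigma_algebra UNIV ?L" by (simp add: measure_space_def)
  have "Collect closed \<subseteq> ?L"
  proof safe
    fix F :: "(real^2) set" assume "closed F"
    then show "F \<in> ?L"
      by (intro metric_outer_measure_closed hausdorff1_outer_measure_space) (rule hausdorff1_outer_separated)
  qed
  then have "sigma_sets UNIV (Collect closed) \<subseteq> ?L"
    by (intro sigma_algebra.sigma_sets_subset[OF sL])
  then have sub: "sets (borel :: (real^2) measure) \<subseteq> ?L"
    by (simp add: borel_eq_closed)
  have "measure_space UNIV (sets borel) hausdorff1_outer"
    by (rule measure_down[OF ms _ sub]) (metis sets.sigma_algebra_axioms space_borel)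
  then show ?thesis
    unfolding hausdorff1_def using assms
    by (intro emeasure_measure_of_sigma) (auto simp: measure_space_def)
qed

lemma sets_hausdorff1 [simp, measurable_cong]: "sets hausdorff1 = sets borel"
  unfolding hausdorff1_def by (metis sets.sets_measure_of_eq space_borel)

lemma space_hausdorff1 [simp]: "space hausdorff1 = UNIV"
  unfolding hausdorff1_def by (simp add: space_measure_of_conv)

section \<open>Length bounds from above and from below\<close>

text \<open>Cutting the interval into \<open>M\<close> equal pieces gives images of diameter at most
  \<open>L * (b - a) / M\<close>. Their sum does not depend on \<open>M\<close>, so one bound serves
  every scale \<open>\<delta>\<close>.\<close>

lemma hausdorff1_outer_lipschitz_image_le:
  fixes f :: "real \<Rightarrow> real^2"
  assumes ab: "a \<le> b" and L: "0 \<le> L"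
    and lip: "\<And>s t. a \<le> s \<Longrightarrow> s \<le> b \<Longrightarrow> a \<le> t \<Longrightarrow> t \<le> b \<Longrightarrow> dist (f s) (f t) \<le> L * \<bar>s - t\<bar>"
  shows "hausdorff1_outer (f ` {a..b}) \<le> ennreal (L * (b - a))"
  unfolding hausdorff1_outer_def
proof (rule SUP_least)
  fix \<delta> :: real assume "\<delta> \<in> {0<..}"
  then have \<delta>: "\<delta> > 0" by simp
  obtain N where N: "L * (b - a) / \<delta> < real N" using reals_Archimedean2 by blast
  define M where "M = Suc N"
  have M: "L * (b - a) / real M \<le> \<delta>" "M > 0"
  proof -
    have "L * (b - a) / \<delta> \<le> real M" using N by (simp add: M_def)
    then show "L * (b - a) / real M \<le> \<delta>" using \<delta> by (simp add: M_def field_simps)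
  qed (simp add: M_def)
  define c where "c i = a + real i * (b - a) / real M" for i
  define C where "C i = (if i < M then f ` {c i..c (Suc i)} else {})" for i
  have c1: "c (Suc i) - c i = (b - a) / real M" for i
    by (simp add: c_def add_divide_distrib diff_divide_distrib algebra_simps)
  have ci: "a \<le> c i" for i using ab M by (simp add: c_def)
  have cM: "c i \<le> b" if "i \<le> M" for i
  proof -
    have "real i * (b - a) / real M \<le> real M * (b - a) / real M"
      using that ab by (intro divide_right_mono mult_right_mono) auto
    then show ?thesis using M by (simp add: c_def)
  qed
  have dd: "dist x y \<le> L * (b - a) / real M" if "x \<in> C i" "y \<in> C i" for x y i
  proof -
    have i: "i < M" using that by (auto simp: C_def split: if_splits)
    then have "x \<in> f ` {c i..c (Suc i)}" "y \<in> f ` {c i..c (Suc i)}"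
      using that by (simp_all add: C_def)
    then obtain s t where st: "x = f s" "y = f t" "s \<in> {c i..c (Suc i)}" "t \<in> {c i..c (Suc i)}"
      by (elim imageE) metis
    have "dist x y \<le> L * \<bar>s - t\<bar>"
      unfolding st(1,2) using st(3,4) ci[of i] cM[of "Suc i"] i by (intro lip) auto
    also have "\<dots> \<le> L * ((b - a) / real M)"
      using st(3,4) L c1[of i] by (intro mult_left_mono) auto
    finally show ?thesis by simp
  qed
  have diam: "diameter (C i) \<le> (if i < M then L * (b - a) / real M else 0)" for i
  proof (cases "i < M")
    case True
    then show ?thesis using dd[of _ i] ab L by (auto intro!: diameter_le simp: dist_norm)
  qed (simp add: C_def)
  have bd: "bounded (C i)" for i
    using dd unfolding bounded_two_points by blast
  have cover: "f ` {a..b} \<subseteq> (\<Union>i. C i)"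
  proof safe
    fix t assume t: "t \<in> {a..b}"
    show "f t \<in> (\<Union>i. C i)"
    \<comment> \<open>No half-open piece contains the endpoint \<open>b\<close>; it is assigned to
      the last closed piece by hand.\<close>
    proof (cases "t = b")
      case True
      have "b = c (Suc N)" using M by (simp add: c_def M_def)
      moreover have "c N \<le> c (Suc N)" using c1[of N] ab M divide_nonneg_nonneg[of "b - a" "real M"] by linarith
      ultimately have "f t \<in> C N" using True by (auto simp: C_def M_def)
      then show ?thesis by blast
    next
      case False
      define j where "j = (LEAST j. t < c (Suc j))"
      have ex: "t < c (Suc N)" using t False M by (simp add: c_def M_def)
      then have j1: "t < c (Suc j)" and jN: "j \<le> N" unfolding j_def by (rule LeastI, rule Least_le)
      have j2: "c j \<le> t"
      proof (cases j)
        case 0 then show ?thesis using t by (simp add: c_def)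
      next
        case (Suc i)
        then show ?thesis using not_less_Least[of i "\<lambda>j. t < c (Suc j)"] by (simp add: j_def)
      qed
      have "f t \<in> C j" using j1 j2 jN by (auto simp: C_def M_def)
      then show ?thesis by blast
    qed
  qed
  have "hausdorff1_pre \<delta> (f ` {a..b}) \<le> (\<Sum>i. ennreal (diameter (C i)))"
  proof (rule hausdorff1_pre_upper[OF bd _ cover])
    show "diameter (C i) \<le> \<delta>" for i
      using diam[of i] M \<delta> by (auto split: if_splits)
  qed
  also have "\<dots> \<le> (\<Sum>i. ennreal (if i < M then L * (b - a) / real M else 0))"
    by (intro suminf_le ennreal_leI diam) auto
  also have "\<dots> = (\<Sum>i<M. ennreal (if i < M then L * (b - a) / real M else 0))"
    by (rule suminf_finite) auto
  also have "\<dots> = ennreal (L * (b - a))"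
    using ab L M by (subst sum_ennreal) auto
  finally show "hausdorff1_pre \<delta> (f ` {a..b}) \<le> ennreal (L * (b - a))" .
qed

lemma hausdorff1_outer_countable:
  assumes "countable A"
  shows "hausdorff1_outer A = 0"
proof (cases "A = {}")
  case False
  have s: "hausdorff1_outer {x} = 0" for x
    using hausdorff1_outer_lipschitz_image_le[of 0 0 0 "\<lambda>_. x"] by simp
  have "A = (\<Union>i. {from_nat_into A i})" using range_from_nat_into[OF False assms] by auto
  then have "hausdorff1_outer A = hausdorff1_outer (\<Union>i. {from_nat_into A i})" by (rule arg_cong)
  also have "\<dots> \<le> (\<Sum>i. hausdorff1_outer {from_nat_into A i})"
    by (rule hausdorff1_outer_UN_le)
  finally show ?thesis by (simp add: s)
qed (simp add: hausdorff1_outer_empty)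

text \<open>Covering the image of each covering set by an interval of twice its diameter is wasteful,
  but it avoids the best constant, which is not needed.\<close>

lemma hausdorff1_outer_ge_interval:
  fixes p :: "real^2 \<Rightarrow> real"
  assumes ab: "a \<le> b" and lip: "\<And>x y. \<bar>p x - p y\<bar> \<le> dist x y" and im: "{a..b} \<subseteq> p ` E"
  shows "ennreal ((b - a) / 2) \<le> hausdorff1_outer E"
proof -
  \<comment> \<open>Any single scale bounds the supremum from below; 1 is arbitrary.\<close>
  have "ennreal ((b - a) / 2) \<le> hausdorff1_pre 1 E"
  proof (unfold hausdorff1_pre_def, rule INF_greatest)
    fix C :: "nat \<Rightarrow> (real^2) set"
    assume "C \<in> {C. (\<forall>n. bounded (C n) \<and> diameter (C n) \<le> 1) \<and> E \<subseteq> (\<Union>n. C n)}"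
    then have C: "\<forall>n. bounded (C n) \<and> diameter (C n) \<le> 1" "E \<subseteq> (\<Union>n. C n)" by auto
    define z where "z n = p (SOME y. y \<in> C n)" for n
    define I where "I n = (if C n = {} then {} else {z n - diameter (C n)..z n + diameter (C n)})" for n
    have "{a..b} \<subseteq> (\<Union>n. I n)"
    proof
      fix t assume "t \<in> {a..b}"
      then obtain x where x: "x \<in> E" "t = p x" using im by blast
      then obtain n where n: "x \<in> C n" using C by blast
      have so: "(SOME y. y \<in> C n) \<in> C n" using n by (rule someI)
      have "dist x (SOME y. y \<in> C n) \<le> diameter (C n)"
        using C n so by (intro diameter_bounded_bound) auto
      then have "\<bar>t - z n\<bar> \<le> diameter (C n)"
        using lip[of x "SOME y. y \<in> C n"] by (simp add: x z_def)
      then have "t \<in> I n" using n by (auto simp: I_def)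
      then show "t \<in> (\<Union>n. I n)" by blast
    qed
    then have "emeasure lborel {a..b} \<le> emeasure lborel (\<Union>n. I n)"
      by (rule emeasure_mono) (auto simp: I_def)
    also have "\<dots> \<le> (\<Sum>n. emeasure lborel (I n))"
      by (rule emeasure_subadditive_countably) (auto simp: I_def)
    also have "\<dots> \<le> (\<Sum>n. ennreal 2 * ennreal (diameter (C n)))"
    proof (rule suminf_le)
      fix n
      have d: "0 \<le> diameter (C n)" using C by (auto intro: diameter_ge_0)
      show "emeasure lborel (I n) \<le> ennreal 2 * ennreal (diameter (C n))"
        using d by (subst ennreal_mult[symmetric]) (simp_all add: I_def)
    qed auto
    also have "\<dots> = ennreal 2 * (\<Sum>n. ennreal (diameter (C n)))"
      by (rule ennreal_suminf_cmult)
    finally have *: "ennreal (b - a) \<le> ennreal 2 * (\<Sum>n. ennreal (diameter (C n)))" using ab by simp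
    show "ennreal ((b - a) / 2) \<le> (\<Sum>n. ennreal (diameter (C n)))"
    proof (cases "\<Sum>n. ennreal (diameter (C n))" rule: ennreal_cases)
      case (real s)
      have "ennreal (b - a) \<le> ennreal (2 * s)" using * real by (simp only: ennreal_mult)
      then have "b - a \<le> 2 * s" using real by (subst (asm) ennreal_le_iff) auto
      then show ?thesis unfolding real(2) by (intro ennreal_leI) simp
    qed simp
  qed
  also have "\<dots> \<le> hausdorff1_outer E" by (rule hausdorff1_pre_le_outer) simp
  finally show ?thesis .
qed

section \<open>Gradients of convex functions\<close>

lemma lborel_integral_translate:
  fixes f :: "'a::euclidean_space \<Rightarrow> real"
  assumes "f \<in> borel_measurable borel"
  shows "(\<integral>x. f (x + v) \<partial>lborel) = (\<integral>x. f x \<partial>lborel)"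
  using integral_distr[of "(+) v" lborel borel f] assms
  by (simp add: lborel_distr_plus add.commute)

lemma integrable_const_indicator_cball:
  "integrable lborel (\<lambda>x::'a::euclidean_space. a * indicator (cball c r) x :: real)"
  by (intro integrable_mult_right integrable_real_indicator) (simp_all add: emeasure_lborel_cball_finite[unfolded infinity_ennreal_def])

lemma integrable_bounded_support:
  fixes f :: "'a::euclidean_space \<Rightarrow> real"
  assumes "f \<in> borel_measurable borel" "\<And>x. \<bar>f x\<bar> \<le> B" "\<And>x. x \<notin> cball 0 R \<Longrightarrow> f x = 0"
  shows "integrable lborel f"
proof (rule Bochner_Integration.integrable_bound)
  show "integrable lborel (\<lambda>x. B * indicator (cball (0::'a) R) x)"
    by (rule integrable_const_indicator_cball)
  have "\<bar>f x\<bar> \<le> \<bar>B * indicator (cball 0 R) x\<bar>" for x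
    using assms(2,3)[of x] by (auto simp: indicator_def abs_if split: if_splits)
  then show "AE x in lborel. norm (f x) \<le> norm (B * indicator (cball 0 R) x)" by simp
qed (use assms in simp)

section \<open>Subgradient fields and their translations in L1\<close>

text \<open>\<open>g\<close> selects a subgradient at every point, which already forces
  \<open>u\<close> to be convex.\<close>

definition subgradient_field :: "('a::euclidean_space \<Rightarrow> real) \<Rightarrow> ('a \<Rightarrow> 'a) \<Rightarrow> bool" where
  "subgradient_field u g \<longleftrightarrow> (\<forall>x y. u x + g x \<bullet> (y - x) \<le> u y)"

lemma subgradient_fieldD: "subgradient_field u g \<Longrightarrow> u x + g x \<bullet> (y - x) \<le> u y"
  by (auto simp: subgradient_field_def)

text \<open>The increment of the gradient in an arbitrary direction \<open>w\<close> is controlled by increments along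
  the displacement itself, which telescope after integration.  This replaces the bound of the mixed
  second derivative by pure ones.  Both inequalities come from the nonnegativity of
  \<open>u y - u x - g x \<bullet> (y - x)\<close> at suitable pairs.\<close>

lemma subgradient_increment:
  assumes "subgradient_field u g"
  shows "\<bar>(g (x + z) - g x) \<bullet> w\<bar> \<le> (g (x + (z + w)) - g x) \<bullet> (z + w) + (g (x + (z - w)) - g x) \<bullet> (z - w)"
proof -
  note D = subgradient_fieldD[OF assms]
  have a: "0 \<le> (g (x + v) - g x) \<bullet> v" for v
    using D[of x "x + v"] D[of "x + v" x] by (simp add: inner_diff_left)
  \<comment> \<open>Cyclic monotonicity round \<open>x\<close>, \<open>x + z\<close>,
    \<open>x + (z + v)\<close>: in the sum of the three inequalities the values of \<open>u\<close>
    cancel.\<close>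
  have b: "(g (x + z) - g x) \<bullet> v \<le> (g (x + (z + v)) - g x) \<bullet> (z + v)" for v
    using D[of x "x + z"] D[of "x + z" "x + (z + v)"] D[of "x + (z + v)" x]
    by (simp add: inner_diff_left inner_add_right inner_minus_right inner_diff_right)
  show ?thesis using a[of "z + w"] a[of "z - w"] b[of w] b[of "- w"]
    by (simp add: abs_le_iff inner_diff_left)
qed

lemma subgradient_lipschitz:
  assumes "subgradient_field u g" "\<And>x. norm (g x) \<le> L"
  shows "\<bar>u x - u y\<bar> \<le> L * norm (x - y)"
proof -
  have "u y - u x \<le> L * norm (x - y)" for x y
  proof -
    have "- (g y \<bullet> (x - y)) \<le> norm (g y) * norm (x - y)"
      using Cauchy_Schwarz_ineq2[of "g y" "x - y"] by linarith
    also have "\<dots> \<le> L * norm (x - y)" by (intro mult_right_mono assms) auto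
    finally show ?thesis using subgradient_fieldD[OF assms(1), of y x] by simp
  qed
  from this[of y x] this[of x y] show ?thesis by (simp add: abs_le_iff norm_minus_commute)
qed

text \<open>Local bounded variation expressed by translations: on every ball the L1 modulus of
  continuity is linear. In this form it passes to differences and, by summation by parts, to
  integrals against derivatives of test functions.\<close>

definition L1_lipschitz :: "('a::euclidean_space \<Rightarrow> real) \<Rightarrow> bool" where
  "L1_lipschitz G \<longleftrightarrow> (\<forall>R. \<exists>C. \<forall>c\<in>Basis. \<forall>t. \<bar>t\<bar> \<le> 1 \<longrightarrow>
     (\<integral>x. indicator (cball 0 R) x * \<bar>G (x + t *\<^sub>R c) - G x\<bar> \<partial>lborel) \<le> C * \<bar>t\<bar>)"

lemma L1_lipschitz_diff:
  assumes "L1_lipschitz G" "L1_lipschitz H"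
    and [measurable]: "G \<in> borel_measurable borel" "H \<in> borel_measurable borel"
    and L: "\<And>x. \<bar>G x\<bar> \<le> L" "\<And>x. \<bar>H x\<bar> \<le> L"
  shows "L1_lipschitz (\<lambda>x. G x - H x)"
  unfolding L1_lipschitz_def
proof
  fix R
  let ?i = "indicator (cball (0::'a) R) :: 'a \<Rightarrow> real"
  obtain C where C: "\<And>c t. c \<in> Basis \<Longrightarrow> \<bar>t\<bar> \<le> 1 \<Longrightarrow> (\<integral>x. ?i x * \<bar>G (x + t *\<^sub>R c) - G x\<bar> \<partial>lborel) \<le> C * \<bar>t\<bar>"
    using assms(1) unfolding L1_lipschitz_def by meson
  obtain D where D: "\<And>c t. c \<in> Basis \<Longrightarrow> \<bar>t\<bar> \<le> 1 \<Longrightarrow> (\<integral>x. ?i x * \<bar>H (x + t *\<^sub>R c) - H x\<bar> \<partial>lborel) \<le> D * \<bar>t\<bar>"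
    using assms(2) unfolding L1_lipschitz_def by meson
  have L0: "0 \<le> L" using L(1)[of 0] by linarith
  \<comment> \<open>The doubled bound lets \<open>int\<close> be applied to \<open>G - H\<close> as
    well.\<close>
  have L2: "\<bar>G x\<bar> \<le> 2 * L" "\<bar>H x\<bar> \<le> 2 * L" for x
    using L(1)[of x] L(2)[of x] L0 by linarith+
  have int: "integrable lborel (\<lambda>x. ?i x * \<bar>K (x + v) - K x\<bar>)"
    if [measurable]: "K \<in> borel_measurable borel" and K: "\<And>x. \<bar>K x\<bar> \<le> 2 * L" for K v
  proof (rule integrable_bounded_support[of _ "4 * L" R])
    show "\<bar>?i x * \<bar>K (x + v) - K x\<bar>\<bar> \<le> 4 * L" for x
      using K[of "x + v"] K[of x] L0 by (auto simp: indicator_def)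
  qed (intro borel_measurable_times borel_measurable_indicator, auto)
  have "(\<integral>x. ?i x * \<bar>(G (x + t *\<^sub>R c) - H (x + t *\<^sub>R c)) - (G x - H x)\<bar> \<partial>lborel) \<le> (C + D) * \<bar>t\<bar>"
    if "c \<in> Basis" "\<bar>t\<bar> \<le> 1" for c t
  proof -
    have i1: "integrable lborel (\<lambda>x. ?i x * \<bar>G (x + t *\<^sub>R c) - G x\<bar>)"
      and i2: "integrable lborel (\<lambda>x. ?i x * \<bar>H (x + t *\<^sub>R c) - H x\<bar>)"
      using L2 by (auto intro!: int)
    have i3: "integrable lborel (\<lambda>x. ?i x * \<bar>(G (x + t *\<^sub>R c) - H (x + t *\<^sub>R c)) - (G x - H x)\<bar>)"
    proof (rule int[of "\<lambda>x. G x - H x"])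
      show "\<bar>G x - H x\<bar> \<le> 2 * L" for x using L(1)[of x] L(2)[of x] by linarith
    qed simp
    have "(\<integral>x. ?i x * \<bar>(G (x + t *\<^sub>R c) - H (x + t *\<^sub>R c)) - (G x - H x)\<bar> \<partial>lborel)
        \<le> (\<integral>x. ?i x * \<bar>G (x + t *\<^sub>R c) - G x\<bar> + ?i x * \<bar>H (x + t *\<^sub>R c) - H x\<bar> \<partial>lborel)"
      by (intro integral_mono i3 Bochner_Integration.integrable_add i1 i2) (auto simp: indicator_def)
    also have "\<dots> = (\<integral>x. ?i x * \<bar>G (x + t *\<^sub>R c) - G x\<bar> \<partial>lborel) + (\<integral>x. ?i x * \<bar>H (x + t *\<^sub>R c) - H x\<bar> \<partial>lborel)"
      by (rule Bochner_Integration.integral_add[OF i1 i2])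
    also have "\<dots> \<le> C * \<bar>t\<bar> + D * \<bar>t\<bar>" by (intro add_mono C D that)
    finally show ?thesis by (simp add: algebra_simps)
  qed
  then show "\<exists>C. \<forall>c\<in>Basis. \<forall>t. \<bar>t\<bar> \<le> 1 \<longrightarrow>
      (\<integral>x. ?i x * \<bar>(G (x + t *\<^sub>R c) - H (x + t *\<^sub>R c)) - (G x - H x)\<bar> \<partial>lborel) \<le> C * \<bar>t\<bar>"
    by blast
qed

text \<open>\<open>subgradient_increment\<close> bounds the increment by two terms of the form
  \<open>(g (x + v) - g x) \<bullet> v\<close>. Under integration against a Lipschitz cutoff the
  translation passes from \<open>g\<close> to the cutoff and yields a second factor
  \<open>norm v\<close>; dividing the quadratic bound by \<open>\<bar>t\<bar>\<close> leaves a
  linear one.\<close>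

lemma subgradient_L1_lipschitz:
  fixes g :: "'a::euclidean_space \<Rightarrow> 'a"
  assumes sub: "subgradient_field u g" and gm [measurable]: "g \<in> borel_measurable borel"
    and gL: "\<And>x. norm (g x) \<le> L" and b: "b \<in> Basis"
  shows "L1_lipschitz (\<lambda>x. g x \<bullet> b)"
  unfolding L1_lipschitz_def
proof
  fix R :: real
  \<comment> \<open>A 1-Lipschitz majorant of the indicator of the ball of radius \<open>R\<close>.
    The ball in \<open>V\<close> enlarges its support by 2, the largest shift that occurs.\<close>
  define cut where "cut x = max 0 (\<bar>R\<bar> + 1 - norm (x::'a))" for x
  define V where "V = measure lborel (cball (0::'a) (\<bar>R\<bar> + 3))"
  have [measurable]: "cut \<in> borel_measurable borel" unfolding cut_def by measurable
  have L0: "0 \<le> L" using gL[of 0] norm_ge_zero order_trans by blast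
  have cut1: "indicator (cball 0 R) x \<le> cut x" "0 \<le> cut x" "cut x \<le> \<bar>R\<bar> + 1" for x
    by (auto simp: cut_def indicator_def)
  have cut0: "cut x = 0" if "x \<notin> cball 0 (\<bar>R\<bar> + 1)" for x
    using that by (auto simp: cut_def)
  have cutlip: "\<bar>cut (x - v) - cut x\<bar> \<le> norm v" for x v
    using norm_triangle_ineq2[of x v] norm_triangle_ineq2[of "x - v" "- v"] norm_triangle_ineq4[of x v]
      norm_triangle_ineq[of "x - v" v] by (auto simp: cut_def max_def)
  have gv: "\<bar>g x \<bullet> v\<bar> \<le> L * norm v" for x v
    using Cauchy_Schwarz_ineq2[of "g x" v] mult_right_mono[OF gL[of x], of "norm v"] by simp
  have Ga: "integrable lborel (\<lambda>x. cut (x + a) * (g (x + d) \<bullet> v))" for v a d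
  proof (rule integrable_bounded_support[of _ "(\<bar>R\<bar> + 1) * (L * norm v)" "\<bar>R\<bar> + 1 + norm a"])
    show "\<bar>cut (x + a) * (g (x + d) \<bullet> v)\<bar> \<le> (\<bar>R\<bar> + 1) * (L * norm v)" for x
      unfolding abs_mult using cut1[of "x + a"] gv by (intro mult_mono) auto
    show "cut (x + a) * (g (x + d) \<bullet> v) = 0" if "x \<notin> cball 0 (\<bar>R\<bar> + 1 + norm a)" for x
      using that norm_triangle_ineq4[of "x + a" a] cut0[of "x + a"] by auto
  qed measurable
  have inc: "(\<integral>x. cut x * ((g (x + v) - g x) \<bullet> v) \<partial>lborel) \<le> L * V * (norm v)\<^sup>2" if v: "norm v \<le> 2" for v
  proof -
    have "(\<integral>x. cut x * ((g (x + v) - g x) \<bullet> v) \<partial>lborel)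
        = (\<integral>x. cut x * (g (x + v) \<bullet> v) - cut x * (g x \<bullet> v) \<partial>lborel)"
      by (simp add: inner_diff_left right_diff_distrib)
    also have "\<dots> = (\<integral>x. cut x * (g (x + v) \<bullet> v) \<partial>lborel) - (\<integral>x. cut x * (g x \<bullet> v) \<partial>lborel)"
      using Ga[of 0 v v] Ga[of 0 0 v] by (intro Bochner_Integration.integral_diff) auto
    also have "(\<integral>x. cut x * (g (x + v) \<bullet> v) \<partial>lborel) = (\<integral>x. cut (x - v) * (g x \<bullet> v) \<partial>lborel)"
      using lborel_integral_translate[of "\<lambda>x. cut (x - v) * (g x \<bullet> v)" v] by simp
    also have "\<dots> - (\<integral>x. cut x * (g x \<bullet> v) \<partial>lborel) = (\<integral>x. cut (x - v) * (g x \<bullet> v) - cut x * (g x \<bullet> v) \<partial>lborel)"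
      using Ga[of "-v" 0 v] Ga[of 0 0 v] by (intro Bochner_Integration.integral_diff[symmetric]) auto
    also have "\<dots> \<le> (\<integral>x. (L * (norm v)\<^sup>2) * indicator (cball (0::'a) (\<bar>R\<bar> + 3)) x \<partial>lborel)"
    proof (rule integral_mono)
      show "integrable lborel (\<lambda>x. cut (x - v) * (g x \<bullet> v) - cut x * (g x \<bullet> v))"
        using Ga[of "-v" 0 v] Ga[of 0 0 v] by (intro Bochner_Integration.integrable_diff) auto
      show "integrable lborel (\<lambda>x. (L * (norm v)\<^sup>2) * indicator (cball (0::'a) (\<bar>R\<bar> + 3)) x)"
        by (rule integrable_const_indicator_cball)
      fix x :: 'a
      show "cut (x - v) * (g x \<bullet> v) - cut x * (g x \<bullet> v) \<le> (L * (norm v)\<^sup>2) * indicator (cball 0 (\<bar>R\<bar> + 3)) x"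
      proof (cases "x \<in> cball 0 (\<bar>R\<bar> + 3)")
        case True
        have "cut (x - v) * (g x \<bullet> v) - cut x * (g x \<bullet> v) \<le> \<bar>cut (x - v) - cut x\<bar> * \<bar>g x \<bullet> v\<bar>"
          by (simp add: left_diff_distrib[symmetric] abs_mult[symmetric] abs_le_iff)
        also have "\<dots> \<le> norm v * (L * norm v)" by (intro mult_mono cutlip gv) auto
        finally show ?thesis using True by (simp add: power2_eq_square mult_ac)
      next
        case False
        then have "x \<notin> cball 0 (\<bar>R\<bar> + 1)" "x - v \<notin> cball 0 (\<bar>R\<bar> + 1)"
          using v norm_triangle_ineq[of "x - v" v] by auto
        then show ?thesis using False cut0 by simp
      qed
    qed
    also have "\<dots> = L * V * (norm v)\<^sup>2" by (simp add: V_def)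
    finally show ?thesis .
  qed
  have "(\<integral>x. indicator (cball 0 R) x * \<bar>g (x + t *\<^sub>R c) \<bullet> b - g x \<bullet> b\<bar> \<partial>lborel) \<le> 8 * L * V * \<bar>t\<bar>"
    if c: "c \<in> Basis" and t: "\<bar>t\<bar> \<le> 1" for c t
  proof (cases "t = 0")
    case False
    \<comment> \<open>Both \<open>z + w\<close> and \<open>z - w\<close> have norm at most
      \<open>2 * \<bar>t\<bar>\<close>; two squares of this give the factor 8.\<close>
    define z w where "z = t *\<^sub>R c" and "w = t *\<^sub>R b"
    have nz: "norm z = \<bar>t\<bar>" "norm w = \<bar>t\<bar>" using b c by (auto simp: z_def w_def)
    have nv: "norm (z + w) \<le> 2 * \<bar>t\<bar>" "norm (z - w) \<le> 2 * \<bar>t\<bar>"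
      using norm_triangle_ineq[of z w] norm_triangle_ineq4[of z w] nz by auto
    have rew: "(\<lambda>x. cut x * ((g (x + v) - g x) \<bullet> v)) = (\<lambda>x. cut x * (g (x + v) \<bullet> v) - cut x * (g x \<bullet> v))" for v
      by (simp add: inner_diff_left right_diff_distrib)
    have int: "integrable lborel (\<lambda>x. cut x * ((g (x + v) - g x) \<bullet> v))" for v
      unfolding rew using Ga[of 0 v v] Ga[of 0 0 v] by (intro Bochner_Integration.integrable_diff) auto
    have "\<bar>t\<bar> * (\<integral>x. indicator (cball 0 R) x * \<bar>g (x + t *\<^sub>R c) \<bullet> b - g x \<bullet> b\<bar> \<partial>lborel)
        = (\<integral>x. indicator (cball 0 R) x * \<bar>(g (x + z) - g x) \<bullet> w\<bar> \<partial>lborel)"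
      unfolding integral_mult_right_zero[symmetric]
      by (rule arg_cong[of _ _ "integral\<^sup>L lborel"]) (auto simp: fun_eq_iff z_def w_def inner_diff_left abs_mult[symmetric] algebra_simps indicator_def)
    also have "\<dots> \<le> (\<integral>x. cut x * ((g (x + (z + w)) - g x) \<bullet> (z + w)) + cut x * ((g (x + (z - w)) - g x) \<bullet> (z - w)) \<partial>lborel)"
    proof (rule integral_mono)
      show "integrable lborel (\<lambda>x. indicator (cball 0 R) x * \<bar>(g (x + z) - g x) \<bullet> w\<bar>)"
      proof (rule integrable_bounded_support[of _ "2 * (L * norm w)" R])
        show "\<bar>indicator (cball 0 R) x * \<bar>(g (x + z) - g x) \<bullet> w\<bar>\<bar> \<le> 2 * (L * norm w)" for x
          using gv[of "x + z" w] gv[of x w] L0 by (auto simp: indicator_def inner_diff_left)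
      qed (intro borel_measurable_times borel_measurable_indicator, auto)
      show "integrable lborel (\<lambda>x. cut x * ((g (x + (z + w)) - g x) \<bullet> (z + w)) + cut x * ((g (x + (z - w)) - g x) \<bullet> (z - w)))"
        by (intro Bochner_Integration.integrable_add int)
      fix x :: 'a
      have "indicator (cball 0 R) x * \<bar>(g (x + z) - g x) \<bullet> w\<bar>
          \<le> cut x * ((g (x + (z + w)) - g x) \<bullet> (z + w) + (g (x + (z - w)) - g x) \<bullet> (z - w))"
        using cut1[of x] by (intro mult_mono subgradient_increment[OF sub]) auto
      then show "indicator (cball 0 R) x * \<bar>(g (x + z) - g x) \<bullet> w\<bar>
          \<le> cut x * ((g (x + (z + w)) - g x) \<bullet> (z + w)) + cut x * ((g (x + (z - w)) - g x) \<bullet> (z - w))"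
        by (simp add: distrib_left)
    qed
    also have "\<dots> = (\<integral>x. cut x * ((g (x + (z + w)) - g x) \<bullet> (z + w)) \<partial>lborel) + (\<integral>x. cut x * ((g (x + (z - w)) - g x) \<bullet> (z - w)) \<partial>lborel)"
      by (intro Bochner_Integration.integral_add int)
    also have "\<dots> \<le> L * V * (norm (z + w))\<^sup>2 + L * V * (norm (z - w))\<^sup>2"
      using nv t by (intro add_mono inc) auto
    also have "\<dots> \<le> L * V * (2 * \<bar>t\<bar>)\<^sup>2 + L * V * (2 * \<bar>t\<bar>)\<^sup>2"
      using nv L0 by (intro add_mono mult_left_mono power_mono) (auto simp: V_def)
    also have "\<dots> = \<bar>t\<bar> * (8 * L * V * \<bar>t\<bar>)" by (simp add: power2_eq_square)
    finally show ?thesis using False by simp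
  qed simp
  then show "\<exists>C. \<forall>c\<in>Basis. \<forall>t. \<bar>t\<bar> \<le> 1 \<longrightarrow>
      (\<integral>x. indicator (cball 0 R) x * \<bar>g (x + t *\<^sub>R c) \<bullet> b - g x \<bullet> b\<bar> \<partial>lborel) \<le> C * \<bar>t\<bar>"
    by blast
qed

section \<open>Integration by parts against test functions\<close>

text \<open>First-order data only: a bounded measurable derivative and a bounded support are what
  dominated convergence of difference quotients uses.\<close>

locale test_function =
  fixes \<phi> :: "'a::euclidean_space \<Rightarrow> real" and \<phi>' :: "'a \<Rightarrow> 'a \<Rightarrow> real" and R B :: real
  assumes deriv: "(\<phi> has_derivative \<phi>' x) (at x)"
    and deriv_measurable: "c \<in> Basis \<Longrightarrow> (\<lambda>x. \<phi>' x c) \<in> borel_measurable borel"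
    and support: "x \<notin> cball 0 R \<Longrightarrow> \<phi> x = 0"
    and bound: "c \<in> Basis \<Longrightarrow> \<bar>\<phi>' x c\<bar> \<le> B"
begin

lemma continuous: "continuous_on UNIV \<phi>"
  by (rule has_derivative_continuous_on) (use deriv in blast)

lemma measurable [measurable]: "\<phi> \<in> borel_measurable borel"
  by (rule borel_measurable_continuous_onI[OF continuous])

lemma quotient_bound:
  assumes c: "c \<in> Basis"
  shows "\<bar>\<phi> (x + t *\<^sub>R c) - \<phi> x\<bar> \<le> B * \<bar>t\<bar>"
proof -
  have d: "((\<lambda>s. \<phi> (x + s *\<^sub>R c)) has_derivative (\<lambda>h. \<phi>' (x + s *\<^sub>R c) (h *\<^sub>R c))) (at s within UNIV)" for s
    by (rule has_derivative_compose[OF _ deriv]) (auto intro!: derivative_eq_intros)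
  have "norm (\<phi> (x + t *\<^sub>R c) - \<phi> (x + 0 *\<^sub>R c)) \<le> B * norm (t - 0)"
  proof (rule differentiable_bound[OF convex_UNIV d])
    fix s
    have lin: "linear (\<phi>' (x + s *\<^sub>R c))" using deriv has_derivative_linear by blast
    show "onorm (\<lambda>h. \<phi>' (x + s *\<^sub>R c) (h *\<^sub>R c)) \<le> B"
    proof (rule onorm_le)
      fix h :: real
      show "norm (\<phi>' (x + s *\<^sub>R c) (h *\<^sub>R c)) \<le> B * norm h"
        using bound[OF c, of "x + s *\<^sub>R c"] mult_right_mono[of "\<bar>\<phi>' (x + s *\<^sub>R c) c\<bar>" B "\<bar>h\<bar>"]
        by (simp add: linear_scale[OF lin] abs_mult mult.commute)
    qed
  qed auto
  then show ?thesis by simp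
qed

lemma bound_nonneg: "(c::'a) \<in> Basis \<Longrightarrow> 0 \<le> B"
  using bound[of c 0] by linarith

lemma quotient_support:
  assumes "c \<in> Basis" "\<bar>t\<bar> \<le> 1" "x \<notin> cball 0 (R + 1)"
  shows "\<phi> (x + t *\<^sub>R c) - \<phi> x = 0"
proof -
  have "norm x \<le> norm (x + t *\<^sub>R c) + \<bar>t\<bar>"
    using norm_triangle_ineq4[of "x + t *\<^sub>R c" "t *\<^sub>R c"] assms by simp
  then show ?thesis using assms support[of x] support[of "x + t *\<^sub>R c"] by auto
qed

lemma quotient_tendsto:
  assumes c: "c \<in> Basis" and s: "s \<longlonglongrightarrow> 0" "\<And>n. s n \<noteq> 0"
  shows "(\<lambda>n. (\<phi> (x + s n *\<^sub>R c) - \<phi> x) / s n) \<longlonglongrightarrow> \<phi>' x c"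
proof -
  have lin: "linear (\<phi>' x)" using deriv has_derivative_linear by blast
  have "((\<lambda>h. \<phi> (x + h *\<^sub>R c)) has_derivative (\<lambda>h. \<phi>' (x + 0 *\<^sub>R c) (h *\<^sub>R c))) (at 0)"
    by (rule has_derivative_compose[OF _ deriv]) (auto intro!: derivative_eq_intros)
  then have "((\<lambda>h. \<phi> (x + h *\<^sub>R c)) has_real_derivative (\<phi>' x c)) (at 0)"
    by (simp add: has_field_derivative_def linear_scale[OF lin] mult.commute[of _ "\<phi>' x c"] mult_commute_abs)
  then have "((\<lambda>h. (\<phi> (x + h *\<^sub>R c) - \<phi> x) / h) \<longlongrightarrow> \<phi>' x c) (at 0)"
    by (simp add: DERIV_def)
  moreover have "filterlim s (at 0) sequentially" using s by (simp add: filterlim_at)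
  ultimately show ?thesis by (rule filterlim_compose)
qed

lemma quotient_integral_tendsto:
  assumes c: "c \<in> Basis" and s: "s \<longlonglongrightarrow> 0" "\<And>n. s n \<noteq> 0" "\<And>n. \<bar>s n\<bar> \<le> 1"
    and [measurable]: "G \<in> borel_measurable borel" and G: "\<And>x. \<bar>G x\<bar> \<le> L"
  shows "(\<lambda>n. \<integral>x. G x * ((\<phi> (x + s n *\<^sub>R c) - \<phi> x) / s n) \<partial>lborel) \<longlonglongrightarrow> (\<integral>x. G x * \<phi>' x c \<partial>lborel)"
proof (rule integral_dominated_convergence[where w = "\<lambda>x. L * B * indicator (cball 0 (R + 1)) x"])
  have [measurable]: "(\<lambda>x. \<phi>' x c) \<in> borel_measurable borel" by (rule deriv_measurable[OF c])
  show "(\<lambda>x. G x * \<phi>' x c) \<in> borel_measurable lborel" by measurable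
  show "(\<lambda>x. G x * ((\<phi> (x + s n *\<^sub>R c) - \<phi> x) / s n)) \<in> borel_measurable lborel" for n by measurable
  show "integrable lborel (\<lambda>x. L * B * indicator (cball (0::'a) (R + 1)) x)"
    by (rule integrable_const_indicator_cball)
  show "AE x in lborel. (\<lambda>n. G x * ((\<phi> (x + s n *\<^sub>R c) - \<phi> x) / s n)) \<longlonglongrightarrow> G x * \<phi>' x c"
    by (intro AE_I2 tendsto_mult tendsto_const quotient_tendsto c s)
  show "AE x in lborel. norm (G x * ((\<phi> (x + s n *\<^sub>R c) - \<phi> x) / s n)) \<le> L * B * indicator (cball 0 (R + 1)) x" for n
  proof (rule AE_I2)
    fix x
    show "norm (G x * ((\<phi> (x + s n *\<^sub>R c) - \<phi> x) / s n)) \<le> L * B * indicator (cball 0 (R + 1)) x"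
    proof (cases "x \<in> cball 0 (R + 1)")
      case True
      have "\<bar>(\<phi> (x + s n *\<^sub>R c) - \<phi> x) / s n\<bar> \<le> B"
        using quotient_bound[OF c, of x "s n"] s(2)[of n] by (simp add: abs_divide divide_le_eq)
      then have "\<bar>G x\<bar> * \<bar>(\<phi> (x + s n *\<^sub>R c) - \<phi> x) / s n\<bar> \<le> L * B"
        using G[of x] by (intro mult_mono) auto
      then show ?thesis using True by (simp add: abs_mult)
    qed (use quotient_support[OF c s(3)[of n]] in simp)
  qed
qed

text \<open>Summation by parts: a translation moves the difference quotient from
  \<open>\<phi>\<close> to \<open>G\<close>, where the L1 modulus bounds it by \<open>C\<close> for
  every step size; then the step size tends to zero.\<close>

lemma integral_deriv_bound:
  assumes c: "c \<in> Basis" and [measurable]: "G \<in> borel_measurable borel" and G: "\<And>x. \<bar>G x\<bar> \<le> L"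
    and \<phi>1: "\<And>x. \<bar>\<phi> x\<bar> \<le> 1"
    and C: "\<And>c t. c \<in> Basis \<Longrightarrow> \<bar>t\<bar> \<le> 1 \<Longrightarrow>
      (\<integral>x. indicator (cball 0 R) x * \<bar>G (x + t *\<^sub>R c) - G x\<bar> \<partial>lborel) \<le> C * \<bar>t\<bar>"
  shows "\<bar>\<integral>x. G x * \<phi>' x c \<partial>lborel\<bar> \<le> C"
proof -
  define s where "s = (\<lambda>n. inverse (real (Suc n)))"
  have s: "s \<longlonglongrightarrow> 0" "s n \<noteq> 0" "\<bar>s n\<bar> \<le> 1" "0 < s n" for n
    using LIMSEQ_inverse_real_of_nat by (auto simp: s_def inverse_le_1_iff)
  have L0: "0 \<le> L" using G[of 0] by linarith
  have "\<bar>\<integral>x. G x * ((\<phi> (x + s n *\<^sub>R c) - \<phi> x) / s n) \<partial>lborel\<bar> \<le> C" for n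
  proof -
    define v where "v = s n *\<^sub>R c"
    have int: "integrable lborel (\<lambda>x. G (x + a) * \<phi> (x + b))" for a b
    proof (rule integrable_bounded_support[of _ "L" "R + norm b"])
      show "\<bar>G (x + a) * \<phi> (x + b)\<bar> \<le> L" for x
        using mult_mono[OF G[of "x + a"] \<phi>1[of "x + b"]] L0 by (simp add: abs_mult)
      show "G (x + a) * \<phi> (x + b) = 0" if "x \<notin> cball 0 (R + norm b)" for x
        using that support[of "x + b"] norm_triangle_ineq4[of "x + b" b] by auto
    qed measurable
    have "(\<integral>x. G x * ((\<phi> (x + v) - \<phi> x) / s n) \<partial>lborel) = (\<integral>x. (G x * \<phi> (x + v) - G x * \<phi> x) / s n \<partial>lborel)"
      by (simp add: right_diff_distrib)
    also have "\<dots> = ((\<integral>x. G x * \<phi> (x + v) \<partial>lborel) - (\<integral>x. G x * \<phi> x \<partial>lborel)) / s n"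
      using int[of 0 v] int[of 0 0] by simp
    also have "(\<integral>x. G x * \<phi> (x + v) \<partial>lborel) = (\<integral>x. G (x - v) * \<phi> x \<partial>lborel)"
      using lborel_integral_translate[of "\<lambda>x. G (x - v) * \<phi> x" v] by simp
    also have "((\<integral>x. G (x - v) * \<phi> x \<partial>lborel) - (\<integral>x. G x * \<phi> x \<partial>lborel)) = (\<integral>x. G (x - v) * \<phi> x - G x * \<phi> x \<partial>lborel)"
      using int[of "-v" 0] int[of 0 0] by simp
    finally have "\<bar>\<integral>x. G x * ((\<phi> (x + v) - \<phi> x) / s n) \<partial>lborel\<bar> = \<bar>\<integral>x. G (x - v) * \<phi> x - G x * \<phi> x \<partial>lborel\<bar> / s n"
      using s(4)[of n] by (simp add: abs_divide)
    also have "\<bar>\<integral>x. G (x - v) * \<phi> x - G x * \<phi> x \<partial>lborel\<bar> \<le> (\<integral>x. \<bar>G (x - v) * \<phi> x - G x * \<phi> x\<bar> \<partial>lborel)"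
      by (rule integral_abs_bound)
    also have "\<dots> \<le> (\<integral>x. indicator (cball 0 R) x * \<bar>G (x + (- s n) *\<^sub>R c) - G x\<bar> \<partial>lborel)"
    proof (rule integral_mono)
      show "integrable lborel (\<lambda>x. \<bar>G (x - v) * \<phi> x - G x * \<phi> x\<bar>)"
        using int[of "-v" 0] int[of 0 0] by auto
      show "integrable lborel (\<lambda>x. indicator (cball 0 R) x * \<bar>G (x + (- s n) *\<^sub>R c) - G x\<bar>)"
      proof (rule integrable_bounded_support[of _ "2 * L" R])
        show "\<bar>indicator (cball 0 R) x * \<bar>G (x + (- s n) *\<^sub>R c) - G x\<bar>\<bar> \<le> 2 * L" for x
          using G[of "x + (- s n) *\<^sub>R c"] G[of x] L0 by (auto simp: indicator_def)
      qed (intro borel_measurable_times borel_measurable_indicator, auto)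
      fix x :: 'a
      have "\<bar>G (x - v) * \<phi> x - G x * \<phi> x\<bar> = \<bar>\<phi> x\<bar> * \<bar>G (x + (- s n) *\<^sub>R c) - G x\<bar>"
        by (simp add: v_def abs_mult[symmetric] algebra_simps)
      also have "\<dots> \<le> indicator (cball 0 R) x * \<bar>G (x + (- s n) *\<^sub>R c) - G x\<bar>"
        using \<phi>1[of x] support[of x] by (intro mult_right_mono) (auto simp: indicator_def)
      finally show "\<bar>G (x - v) * \<phi> x - G x * \<phi> x\<bar> \<le> indicator (cball 0 R) x * \<bar>G (x + (- s n) *\<^sub>R c) - G x\<bar>" .
    qed
    also have "\<dots> \<le> C * \<bar>- s n\<bar>" using s(3)[of n] by (intro C c) auto
    finally show ?thesis using s(4)[of n] by (simp add: v_def divide_right_mono mult.commute)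
  qed
  then show ?thesis
    by (intro LIMSEQ_le_const2[OF tendsto_rabs[OF quotient_integral_tendsto[OF c s(1,2,3) _ G]]]) auto
qed

text \<open>The double difference quotients \<open>\<integral> \<delta>\<^sub>b u \<cdot> \<delta>\<^sub>c \<phi>\<close> are symmetric in \<open>b\<close> and \<open>c\<close> by translation
  invariance alone, so no second derivative of \<open>\<phi>\<close> is involved.\<close>

lemma subgradient_curl_free:
  assumes sub: "subgradient_field u g" and gm [measurable]: "g \<in> borel_measurable borel"
    and gL: "\<And>x. norm (g x) \<le> L" and b: "b \<in> Basis" and c: "c \<in> Basis"
  shows "(\<integral>x. (g x \<bullet> b) * \<phi>' x c \<partial>lborel) = (\<integral>x. (g x \<bullet> c) * \<phi>' x b \<partial>lborel)"
proof -
  define s where "s = (\<lambda>n. inverse (real (Suc n)))"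
  have s: "s \<longlonglongrightarrow> 0" "s n \<noteq> 0" "\<bar>s n\<bar> \<le> 1" "0 < s n" for n
    using LIMSEQ_inverse_real_of_nat by (auto simp: s_def inverse_le_1_iff)
  have ms: "(\<lambda>n. - s n) \<longlonglongrightarrow> 0" "- s n \<noteq> 0" "\<bar>- s n\<bar> \<le> 1" for n
    using tendsto_minus[OF s(1)] s by auto
  have L0: "0 \<le> L" using gL[of 0] norm_ge_zero order_trans by blast
  have gb: "\<bar>g x \<bullet> b\<bar> \<le> L" if "b \<in> Basis" for x b
    using Basis_le_norm[OF that, of "g x"] gL[of x] by linarith
  have "continuous_on UNIV u"
  proof (rule lipschitz_on_continuous_on)
    show "L-lipschitz_on UNIV u"
      using subgradient_lipschitz[OF sub gL] L0 by (auto intro!: lipschitz_onI simp: dist_norm)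
  qed
  then have [measurable]: "u \<in> borel_measurable borel" by (rule borel_measurable_continuous_onI)
  \<comment> \<open>A forward difference of \<open>u\<close> against a backward difference of
    \<open>\<phi>\<close>: after a translation the mixed term depends on \<open>b + c\<close> only,
    which is symmetric.\<close>
  define Q where "Q n b c = (\<integral>x. (u (x + s n *\<^sub>R b) - u x) / s n * ((\<phi> (x + (- s n) *\<^sub>R c) - \<phi> x) / (- s n)) \<partial>lborel)" for n b c
  have lim: "(\<lambda>n. Q n b c) \<longlonglongrightarrow> (\<integral>x. (g x \<bullet> b) * \<phi>' x c \<partial>lborel)" if b: "b \<in> Basis" and c: "c \<in> Basis" for b c
  proof -
    have [measurable]: "(\<lambda>x. g x \<bullet> b) \<in> borel_measurable borel" by simp
    note B0 = bound_nonneg[OF c]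
    obtain C where C: "\<And>c t. c \<in> Basis \<Longrightarrow> \<bar>t\<bar> \<le> 1 \<Longrightarrow>
        (\<integral>x. indicator (cball 0 (R + 1)) x * \<bar>g (x + t *\<^sub>R c) \<bullet> b - g x \<bullet> b\<bar> \<partial>lborel) \<le> C * \<bar>t\<bar>"
      using subgradient_L1_lipschitz[OF sub gm gL b] unfolding L1_lipschitz_def by meson
    have lim1: "(\<lambda>n. \<integral>x. (g x \<bullet> b) * ((\<phi> (x + (- s n) *\<^sub>R c) - \<phi> x) / (- s n)) \<partial>lborel) \<longlonglongrightarrow> (\<integral>x. (g x \<bullet> b) * \<phi>' x c \<partial>lborel)"
      by (rule quotient_integral_tendsto[OF c ms _ gb[OF b]]) simp
    define P where "P n = (\<integral>x. (g x \<bullet> b) * ((\<phi> (x + (- s n) *\<^sub>R c) - \<phi> x) / (- s n)) \<partial>lborel)" for n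
    have QP: "\<bar>Q n b c - P n\<bar> \<le> B * C * s n" for n
    proof -
      define q where "q x = (\<phi> (x + (- s n) *\<^sub>R c) - \<phi> x) / (- s n)" for x
      define p where "p x = (u (x + s n *\<^sub>R b) - u x) / s n" for x
      have [measurable]: "q \<in> borel_measurable borel" "p \<in> borel_measurable borel" unfolding q_def p_def by measurable
      have qB: "\<bar>q x\<bar> \<le> B * indicator (cball 0 (R + 1)) x" for x
        using quotient_bound[OF c, of x "- s n"] quotient_support[OF c ms(3)[of n], of x] s(4)[of n]
        by (auto simp: q_def indicator_def abs_divide divide_le_eq)
      \<comment> \<open>Convexity traps the difference quotient between the slopes at its two ends.
        Its distance from \<open>g x \<bullet> b\<close> is thus at most an increment of
        \<open>g\<close>, which is of order \<open>s n\<close> in L1 on the ball.\<close>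
      have gp: "g x \<bullet> b \<le> p x" "p x \<le> g (x + s n *\<^sub>R b) \<bullet> b" for x
        using subgradient_fieldD[OF sub, of x "x + s n *\<^sub>R b"] subgradient_fieldD[OF sub, of "x + s n *\<^sub>R b" x] s(4)[of n]
        by (simp_all add: p_def field_simps)
      have pL: "\<bar>p x\<bar> \<le> L" for x using gp[of x] gb[OF b, of x] gb[OF b, of "x + s n *\<^sub>R b"] by linarith
      have i1: "integrable lborel (\<lambda>x. f x * q x)" if [measurable]: "f \<in> borel_measurable borel" and f: "\<And>x. \<bar>f x\<bar> \<le> L" for f
      proof (rule integrable_bounded_support[of _ "L * B" "R + 1"])
        show "\<bar>f x * q x\<bar> \<le> L * B" for x
        proof -
          have "\<bar>q x\<bar> \<le> B" by (rule order_trans[OF qB]) (use B0 in \<open>auto simp: indicator_def\<close>)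
          then show ?thesis unfolding abs_mult using f[of x] by (intro mult_mono) auto
        qed
        show "f x * q x = 0" if "x \<notin> cball 0 (R + 1)" for x using qB[of x] that by auto
      qed measurable
      have "\<bar>(\<integral>x. p x * q x \<partial>lborel) - (\<integral>x. (g x \<bullet> b) * q x \<partial>lborel)\<bar> = \<bar>\<integral>x. p x * q x - (g x \<bullet> b) * q x \<partial>lborel\<bar>"
        using i1[of p] i1[of "\<lambda>x. g x \<bullet> b"] pL gb[OF b] by simp
      also have "\<dots> \<le> (\<integral>x. \<bar>p x * q x - (g x \<bullet> b) * q x\<bar> \<partial>lborel)" by (rule integral_abs_bound)
      also have "\<dots> \<le> (\<integral>x. B * (indicator (cball 0 (R + 1)) x * \<bar>g (x + s n *\<^sub>R b) \<bullet> b - g x \<bullet> b\<bar>) \<partial>lborel)"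
      proof (rule integral_mono)
        show "integrable lborel (\<lambda>x. \<bar>p x * q x - (g x \<bullet> b) * q x\<bar>)"
          using i1[of p] i1[of "\<lambda>x. g x \<bullet> b"] pL gb[OF b] by simp
        show "integrable lborel (\<lambda>x. B * (indicator (cball 0 (R + 1)) x * \<bar>g (x + s n *\<^sub>R b) \<bullet> b - g x \<bullet> b\<bar>))"
        proof (rule integrable_mult_right, rule integrable_bounded_support[of _ "2 * L" "R + 1"])
          show "\<bar>indicator (cball 0 (R + 1)) x * \<bar>g (x + s n *\<^sub>R b) \<bullet> b - g x \<bullet> b\<bar>\<bar> \<le> 2 * L" for x
            using gb[OF b, of "x + s n *\<^sub>R b"] gb[OF b, of x] L0 by (auto simp: indicator_def)
        qed (intro borel_measurable_times borel_measurable_indicator, auto)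
        fix x :: 'a
        have "\<bar>p x * q x - (g x \<bullet> b) * q x\<bar> = \<bar>q x\<bar> * \<bar>p x - g x \<bullet> b\<bar>"
          by (simp add: abs_mult[symmetric] algebra_simps)
        also have "\<dots> \<le> (B * indicator (cball 0 (R + 1)) x) * \<bar>g (x + s n *\<^sub>R b) \<bullet> b - g x \<bullet> b\<bar>"
          using qB[of x] gp[of x] B0 by (intro mult_mono) auto
        finally show "\<bar>p x * q x - (g x \<bullet> b) * q x\<bar> \<le> B * (indicator (cball 0 (R + 1)) x * \<bar>g (x + s n *\<^sub>R b) \<bullet> b - g x \<bullet> b\<bar>)"
          by (simp add: mult.assoc)
      qed
      also have "\<dots> = B * (\<integral>x. indicator (cball 0 (R + 1)) x * \<bar>g (x + s n *\<^sub>R b) \<bullet> b - g x \<bullet> b\<bar> \<partial>lborel)"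
        by simp
      also have "\<dots> \<le> B * (C * \<bar>s n\<bar>)" by (intro mult_left_mono C b s B0)
      finally show ?thesis using s(4)[of n] by (simp add: Q_def P_def p_def q_def mult.assoc)
    qed
    have "(\<lambda>n. B * C * s n) \<longlonglongrightarrow> 0" using tendsto_mult_left[OF s(1), of "B * C"] by simp
    then have "(\<lambda>n. Q n b c - P n) \<longlonglongrightarrow> 0"
      by (rule Lim_null_comparison[rotated]) (rule always_eventually, rule allI, unfold real_norm_def, rule QP)
    from tendsto_add[OF this lim1[folded P_def]] show ?thesis by simp
  qed
  have "Q n b c = Q n c b" for n
  proof -
    have int: "integrable lborel (\<lambda>x. u (x + d) * \<phi> (x + e))" for d e
    proof -
      have "compact ((\<lambda>x. u (x + d) * \<phi> (x + e)) ` cball 0 (\<bar>R\<bar> + norm e))"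
        by (intro compact_continuous_image continuous_intros continuous_on_compose2[OF \<open>continuous_on UNIV u\<close>]
             continuous_on_compose2[OF continuous]) auto
      then obtain M where M': "\<forall>y\<in>(\<lambda>x. u (x + d) * \<phi> (x + e)) ` cball 0 (\<bar>R\<bar> + norm e). norm y \<le> M"
        using bounded_iff[THEN iffD1, OF compact_imp_bounded] by (auto simp only:)
      have M: "\<bar>u (x + d) * \<phi> (x + e)\<bar> \<le> M" if "x \<in> cball 0 (\<bar>R\<bar> + norm e)" for x
        using M'[rule_format, OF imageI[OF that]] by simp
      have z: "u (x + d) * \<phi> (x + e) = 0" if "x \<notin> cball 0 (\<bar>R\<bar> + norm e)" for x
        using that support[of "x + e"] norm_triangle_ineq4[of "x + e" e] by auto
      have M0: "0 \<le> M" using M[of 0] by simp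
      show ?thesis
      proof (rule integrable_bounded_support[OF _ _ z])
        show "\<bar>u (x + d) * \<phi> (x + e)\<bar> \<le> M" for x
          using M[of x] z[of x] M0 by (cases "x \<in> cball 0 (\<bar>R\<bar> + norm e)") auto
      qed measurable
    qed
    define f where "f d e x = u (x + d) * \<phi> (x + e)" for d e x
    define I where "I d e = (\<integral>x. f d e x \<partial>lborel)" for d e
    have shift: "I (d + v) (e + v) = I d e" for d e v
      unfolding I_def f_def using lborel_integral_translate[of "\<lambda>x. u (x + d) * \<phi> (x + e)" v] by (simp add: add_ac)
    have Q: "Q n b c = - (I (s n *\<^sub>R b) (- s n *\<^sub>R c) - I (s n *\<^sub>R b) 0 - I 0 (- s n *\<^sub>R c) + I 0 0) / (s n)\<^sup>2" for b c
    proof -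
      have "Q n b c = (\<integral>x. - (f (s n *\<^sub>R b) (- s n *\<^sub>R c) x - f (s n *\<^sub>R b) 0 x - f 0 (- s n *\<^sub>R c) x + f 0 0 x) / (s n)\<^sup>2 \<partial>lborel)"
        unfolding Q_def f_def using s(2)[of n]
        by (intro Bochner_Integration.integral_cong) (auto simp: field_simps power2_eq_square)
      then show ?thesis
        unfolding I_def using int[folded f_def] by simp
    qed
    have "I (s n *\<^sub>R b) (- s n *\<^sub>R c) = I (s n *\<^sub>R c) (- s n *\<^sub>R b)"
      using shift[of "s n *\<^sub>R b" "s n *\<^sub>R c" "- s n *\<^sub>R c"] shift[of "s n *\<^sub>R c" "s n *\<^sub>R b" "- s n *\<^sub>R b"]
      by (simp add: add.commute)
    moreover have "I 0 (- s n *\<^sub>R c) = I (s n *\<^sub>R c) 0" "I 0 (- s n *\<^sub>R b) = I (s n *\<^sub>R b) 0"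
      using shift[of 0 "s n *\<^sub>R c" "- s n *\<^sub>R c"] shift[of 0 "s n *\<^sub>R b" "- s n *\<^sub>R b"] by simp_all
    ultimately show ?thesis unfolding Q by simp
  qed
  then have "(\<lambda>n. Q n b c) = (\<lambda>n. Q n c b)" by (rule ext)
  then show ?thesis using LIMSEQ_unique[OF lim[OF b c]] lim[OF c b] by metis
qed

end

section \<open>Rotated gradients in the plane: bounded variation and zero divergence\<close>

lemma perp_nth [simp]: "perp v $ 1 = - (v $ 2)" "perp v $ 2 = v $ 1"
  by (simp_all add: perp_def)

lemma norm_perp [simp]: "norm (perp v) = norm v"
  by (simp add: norm_vec_def L2_set_def sum_2)

lemma linear_perp: "linear perp"
  by (rule linearI) (simp_all add: vec_eq_iff forall_2)

lemma perp_measurable [measurable]: "perp \<in> borel_measurable borel"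
  by (intro borel_measurable_continuous_onI linear_continuous_on linear_conv_bounded_linear[THEN iffD1] linear_perp)

lemma inner_axis_real2: "(v::real^2) \<bullet> axis i 1 = v $ i"
  by (simp add: inner_axis)

lemma set_lebesgue_integral_eq_lborel:
  fixes f :: "real^2 \<Rightarrow> real"
  assumes [measurable]: "f \<in> borel_measurable borel" and "\<And>x. x \<notin> S \<Longrightarrow> f x = 0"
  shows "(LINT x:S|lebesgue. f x) = (\<integral>x. f x \<partial>lborel)"
proof -
  have "(\<lambda>x. indicator S x *\<^sub>R f x) = f" using assms(2) by (auto simp: fun_eq_iff indicator_def)
  then show ?thesis by (simp add: set_lebesgue_integral_def integral_completion)
qed

lemma vec_nth_measurable [measurable (raw)]:
  fixes h :: "'a \<Rightarrow> real^'n"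
  shows "h \<in> borel_measurable M \<Longrightarrow> (\<lambda>x. h x $ i) \<in> borel_measurable M"
  by (rule measurable_compose[OF _ borel_measurable_nth])

lemma frechet_derivative_outside_support:
  fixes f :: "'a::real_normed_vector \<Rightarrow> 'b::real_normed_vector"
  assumes "x \<notin> closure {x. f x \<noteq> 0}"
  shows "frechet_derivative f (at x) = (\<lambda>_. 0)"
proof -
  have "(f has_derivative (\<lambda>_. 0)) (at x)"
  proof (rule has_derivative_transform_within_open[OF has_derivative_const])
    show "open (- closure {x. f x \<noteq> 0})" by (intro open_Compl closed_closure)
    fix y assume "y \<in> - closure {x. f x \<noteq> 0}"
    then have "y \<notin> {x. f x \<noteq> 0}" using closure_subset[of "{x. f x \<noteq> 0}"] by auto
    then show "0 = f y" by simp
  qed (use assms in simp)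
  then show ?thesis by (simp add: frechet_derivative_at[symmetric])
qed

text \<open>Composition with a bounded linear \<open>l\<close> extracts one scalar entry, so that
  matrix-valued and scalar test functions are treated together.\<close>

lemma C1_test_function:
  fixes f :: "real^2 \<Rightarrow> 'b::real_normed_vector"
  assumes f: "C_k 1 f" "compactly_supported_in \<Omega> f" and \<Omega>: "\<Omega> \<subseteq> cball 0 R" and l: "bounded_linear l"
  shows "\<exists>B. test_function (\<lambda>x. l (f x)) (\<lambda>x v. l (frechet_derivative f (at x) v)) R B"
proof -
  let ?S = "closure {x. f x \<noteq> 0}"
  have S: "compact ?S" "?S \<subseteq> \<Omega>" using f(2) by (auto simp: compactly_supported_in_def)
  have d: "f differentiable (at x)" and c: "continuous_on UNIV (partial_deriv j f)" for x j
    using f(1) by auto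
  have cl: "continuous_on UNIV (\<lambda>x. l (frechet_derivative f (at x) (axis j 1)))" for j
    using continuous_on_compose2[OF linear_continuous_on[OF l, of UNIV] c[of j]]
    by (simp add: partial_deriv_def[abs_def])
  have "\<exists>B. \<forall>x. \<bar>l (frechet_derivative f (at x) (axis j 1))\<bar> \<le> B" for j
  proof -
    have "compact ((\<lambda>x. l (frechet_derivative f (at x) (axis j 1))) ` ?S)"
      by (intro compact_continuous_image continuous_on_subset[OF cl] S) auto
    then obtain B where B: "\<forall>y\<in>(\<lambda>x. l (frechet_derivative f (at x) (axis j 1))) ` ?S. norm y \<le> B"
      using bounded_iff[THEN iffD1, OF compact_imp_bounded] by (auto simp only:)
    have "\<bar>l (frechet_derivative f (at x) (axis j 1))\<bar> \<le> max B 0" for x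
    proof (cases "x \<in> ?S")
      case True
      then show ?thesis using B by fastforce
    next
      case False
      then show ?thesis
        by (simp add: frechet_derivative_outside_support bounded_linear.linear[OF l] linear_0)
    qed
    then show ?thesis by blast
  qed
  then obtain B where B: "\<And>x j. \<bar>l (frechet_derivative f (at x) (axis j 1))\<bar> \<le> B j" by metis
  have "test_function (\<lambda>x. l (f x)) (\<lambda>x v. l (frechet_derivative f (at x) v)) R (B 1 + B 2)"
  proof
    show "((\<lambda>x. l (f x)) has_derivative (\<lambda>v. l (frechet_derivative f (at x) v))) (at x)" for x
      using d[of x] frechet_derivative_works by (intro bounded_linear.has_derivative[OF l]) blast
    fix c :: "real^2" assume "c \<in> Basis"
    then obtain j where j: "c = axis j 1" by (auto simp: Basis_vec_def)
    show "(\<lambda>x. l (frechet_derivative f (at x) c)) \<in> borel_measurable borel"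
      unfolding j by (rule borel_measurable_continuous_onI[OF cl])
    show "\<bar>l (frechet_derivative f (at x) c)\<bar> \<le> B 1 + B 2" for x
      using B[of x 1] B[of x 2] exhaust_2[of j] by (auto simp: j)
  next
    fix x :: "real^2" assume "x \<notin> cball 0 R"
    then have "x \<notin> ?S" using S \<Omega> by blast
    then have "f x = 0" using closure_subset[of "{x. f x \<noteq> 0}"] by auto
    then show "l (f x) = 0" by (simp add: bounded_linear.linear[OF l] linear_0)
  qed
  then show ?thesis by blast
qed

lemma bounded_borel_set_integrable:
  fixes m :: "real^2 \<Rightarrow> real^2"
  assumes [measurable]: "m \<in> borel_measurable borel" and m: "\<And>x. norm (m x) \<le> B"
    and S [measurable]: "S \<in> sets lebesgue" and b: "bounded S"
  shows "set_integrable lebesgue S m"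
proof -
  have fin: "emeasure lebesgue S < \<infinity>"
    using fmeasurableD2[OF bounded_set_imp_lmeasurable[OF b S]] by (simp add: less_top)
  have [measurable]: "m \<in> borel_measurable lebesgue" by (rule measurable_completion) simp
  show ?thesis unfolding set_integrable_def
  proof (rule Bochner_Integration.integrable_bound[of _ "\<lambda>x. B * indicator S x"])
    show "integrable lebesgue (\<lambda>x. B * indicator S x :: real)" using fin by (intro integrable_mult_right integrable_real_indicator) auto
    have "norm (indicator S x *\<^sub>R m x) \<le> norm (B * indicator S x)" for x
      using m[of x] norm_ge_zero[of "m x"] by (auto simp: indicator_def abs_if)
    then show "AE x in lebesgue. norm (indicator S x *\<^sub>R m x) \<le> norm (B * indicator S x)" by simp
  qed measurable
qed

text \<open>Each entry of a test field is a scalar test function, so the translation bounds give a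
  uniform bound on the variation. The divergence of a rotated gradient is a curl up to sign, and
  that vanishes for \<open>a\<close> and for \<open>b\<close> separately.\<close>

lemma perp_gradient_difference:
  fixes a b :: "real^2 \<Rightarrow> real^2"
  assumes ua: "subgradient_field u a" and vb: "subgradient_field v b"
    and [measurable]: "a \<in> borel_measurable borel" "b \<in> borel_measurable borel"
    and L: "\<And>x. norm (a x) \<le> L" "\<And>x. norm (b x) \<le> L"
    and \<Omega>: "open \<Omega>" "bounded \<Omega>"
  shows "(\<lambda>x. perp (a x - b x)) \<in> BV \<Omega>" "divergence_free \<Omega> (\<lambda>x. perp (a x - b x))"
proof -
  obtain R where R: "\<Omega> \<subseteq> cball 0 R" using bounded_subset_ballD[OF \<Omega>(2), of 0] ball_subset_cball by (meson subset_trans)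
  define m where "m x = perp (a x - b x)" for x
  have [measurable]: "m \<in> borel_measurable borel" unfolding m_def by measurable
  have mi [measurable]: "(\<lambda>x. m x $ i) \<in> borel_measurable borel" for i by measurable
  have mn: "norm (m x) \<le> 2 * L" for x
    using norm_triangle_ineq4[of "a x" "b x"] L(1)[of x] L(2)[of x] by (simp add: m_def)
  have mc: "\<bar>m x $ i\<bar> \<le> 2 * L" for x i using component_le_norm_cart[of "m x" i] mn[of x] by linarith
  have comp: "\<bar>a x $ i\<bar> \<le> L" "\<bar>b x $ i\<bar> \<le> L" for x i
    using component_le_norm_cart[of "a x" i] component_le_norm_cart[of "b x" i] L(1)[of x] L(2)[of x] by linarith+
  have ax: "axis i 1 \<in> (Basis :: (real^2) set)" for i by (simp add: axis_in_Basis_iff)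
  have La: "L1_lipschitz (\<lambda>x. a x $ i)" and Lb: "L1_lipschitz (\<lambda>x. b x $ i)" for i
    using subgradient_L1_lipschitz[OF ua _ L(1) ax[of i]] subgradient_L1_lipschitz[OF vb _ L(2) ax[of i]]
    by (simp_all add: inner_axis_real2)
  \<comment> \<open>The rotation makes the first component \<open>b x $ 2 - a x $ 2\<close>, hence
    the exchanged roles in the first instance.\<close>
  have Lm: "L1_lipschitz (\<lambda>x. m x $ i)" for i
    using L1_lipschitz_diff[OF Lb[of 2] La[of 2] _ _ comp(2,1)] L1_lipschitz_diff[OF La[of 1] Lb[of 1] _ _ comp]
      exhaust_2[of i] by (auto simp: m_def)
  then have "\<forall>i. \<exists>C. \<forall>c\<in>Basis. \<forall>t. \<bar>t\<bar> \<le> 1 \<longrightarrow>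
     (\<integral>x. indicator (cball 0 R) x * \<bar>m (x + t *\<^sub>R c) $ i - m x $ i\<bar> \<partial>lborel) \<le> C * \<bar>t\<bar>"
    unfolding L1_lipschitz_def by blast
  from choice[OF this] obtain C where C': "\<forall>i. \<forall>c\<in>Basis. \<forall>t. \<bar>t\<bar> \<le> 1 \<longrightarrow>
     (\<integral>x. indicator (cball 0 R) x * \<bar>m (x + t *\<^sub>R c) $ i - m x $ i\<bar> \<partial>lborel) \<le> C i * \<bar>t\<bar>" ..
  then have C: "\<And>i c t. c \<in> Basis \<Longrightarrow> \<bar>t\<bar> \<le> 1 \<Longrightarrow>
     (\<integral>x. indicator (cball 0 R) x * \<bar>m (x + t *\<^sub>R c) $ i - m x $ i\<bar> \<partial>lborel) \<le> C i * \<bar>t\<bar>"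
    by (rule_tac C'[rule_format])
  have m_set: "set_integrable lebesgue \<Omega> m"
    using \<Omega> mn by (intro bounded_borel_set_integrable) auto
  have int: "integrable lborel (\<lambda>x. G x * \<phi>' x c)"
    if that: "test_function \<phi> \<phi>' R B" "c \<in> Basis" "G \<in> borel_measurable borel" "\<And>x. \<bar>G x\<bar> \<le> M"
       and z: "\<And>x. x \<notin> \<Omega> \<Longrightarrow> \<phi>' x c = 0" for \<phi> :: "real^2 \<Rightarrow> real" and \<phi>' B c G M
  proof -
    interpret test_function \<phi> \<phi>' R B by fact
    have M0: "0 \<le> M" using that(4)[of 0] by linarith
    note [measurable] = that(3) deriv_measurable[OF that(2)]
    show ?thesis
    proof (rule integrable_bounded_support[of _ "M * B" R])
      show "\<bar>G x * \<phi>' x c\<bar> \<le> M * B" for x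
        unfolding abs_mult by (intro mult_mono that bound) (use M0 in auto)
      show "G x * \<phi>' x c = 0" if "x \<notin> cball 0 R" for x
        using that z[of x] R by (metis mult_zero_right subsetD)
    qed measurable
  qed
  have "(LINT x:\<Omega>|lebesgue. (\<Sum>i\<in>UNIV. m x $ i * (\<Sum>j\<in>UNIV. partial_deriv j \<Phi> x $ i $ j))) \<le> 2 * C 1 + 2 * C 2"
    if \<Phi>: "C_k 1 \<Phi>" "compactly_supported_in \<Omega> \<Phi>" "\<And>x. norm (\<Phi> x) \<le> 1" for \<Phi> :: "real^2 \<Rightarrow> real^2^2"
  proof -
    define \<phi> where "\<phi> i j x = \<Phi> x $ i $ j" for i j x
    define \<phi>' where "\<phi>' i j x v = frechet_derivative \<Phi> (at x) v $ i $ j" for i j x v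
    have "\<exists>B. test_function (\<phi> i j) (\<phi>' i j) R B" for i j
      using C1_test_function[OF \<Phi>(1,2) R bounded_linear_compose[OF bounded_linear_vec_nth[of j] bounded_linear_vec_nth[of i]]]
      by (simp add: \<phi>_def[abs_def] \<phi>'_def[abs_def])
    then obtain B where tf: "\<And>i j. test_function (\<phi> i j) (\<phi>' i j) R (B i j)" by metis
    have z: "\<phi>' i j x v = 0" if "x \<notin> \<Omega>" for i j x v
    proof -
      have "x \<notin> closure {x. \<Phi> x \<noteq> 0}" using that \<Phi>(2) by (auto simp: compactly_supported_in_def)
      then show ?thesis by (simp add: \<phi>'_def frechet_derivative_outside_support)
    qed
    have ij: "integrable lborel (\<lambda>x. m x $ i * \<phi>' i j x (axis j 1))" for i j
      by (rule int[OF tf ax mi mc]) (rule z)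
    have bd: "(\<integral>x. m x $ i * \<phi>' i j x (axis j 1) \<partial>lborel) \<le> C i" for i j
    proof -
      have "\<bar>\<phi> i j x\<bar> \<le> 1" for x
        using component_le_norm_cart[of "\<Phi> x $ i" j] Finite_Cartesian_Product.norm_nth_le[of "\<Phi> x" i] \<Phi>(3)[of x]
        by (simp add: \<phi>_def)
      from test_function.integral_deriv_bound[OF tf ax mi mc this C]
      show ?thesis by (simp add: abs_le_iff)
    qed
    have eq: "(\<Sum>i\<in>UNIV. m x $ i * (\<Sum>j\<in>UNIV. partial_deriv j \<Phi> x $ i $ j))
        = (\<Sum>i\<in>UNIV. \<Sum>j\<in>UNIV. m x $ i * \<phi>' i j x (axis j 1))" for x
      by (simp add: sum_distrib_left partial_deriv_def \<phi>'_def)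
    have meas: "(\<lambda>x. \<Sum>i\<in>UNIV. \<Sum>j\<in>UNIV. m x $ i * \<phi>' i j x (axis j 1)) \<in> borel_measurable borel"
      using ij[THEN borel_measurable_integrable] by (intro borel_measurable_sum) simp
    have "(LINT x:\<Omega>|lebesgue. (\<Sum>i\<in>UNIV. m x $ i * (\<Sum>j\<in>UNIV. partial_deriv j \<Phi> x $ i $ j)))
        = (\<integral>x. (\<Sum>i\<in>UNIV. \<Sum>j\<in>UNIV. m x $ i * \<phi>' i j x (axis j 1)) \<partial>lborel)"
      unfolding eq by (rule set_lebesgue_integral_eq_lborel[OF meas]) (simp add: z)
    also have "\<dots> = (\<Sum>i\<in>UNIV. \<Sum>j\<in>UNIV. (\<integral>x. m x $ i * \<phi>' i j x (axis j 1) \<partial>lborel))"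
      by (simp add: Bochner_Integration.integral_sum ij)
    also have "\<dots> \<le> (\<Sum>i\<in>(UNIV::2 set). \<Sum>j\<in>(UNIV::2 set). C i)"
      by (intro sum_mono bd)
    finally show ?thesis by (simp add: sum_2)
  qed
  then show "(\<lambda>x. perp (a x - b x)) \<in> BV \<Omega>"
    using m_set unfolding BV_def m_def[symmetric] by (auto intro!: bdd_aboveI[of _ "2 * C 1 + 2 * C 2"])
  show "divergence_free \<Omega> (\<lambda>x. perp (a x - b x))"
    unfolding divergence_free_def
  proof (intro allI impI, elim conjE)
    fix \<psi> :: "real^2 \<Rightarrow> real"
    assume "\<forall>k. C_k k \<psi>" and supp: "compactly_supported_in \<Omega> \<psi>"
    then have C1: "C_k 1 \<psi>" by blast
    define \<psi>' where "\<psi>' x v = frechet_derivative \<psi> (at x) v" for x v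
    obtain B where tf: "test_function \<psi> \<psi>' R B"
      using C1_test_function[OF C1 supp R bounded_linear_ident] by (auto simp: \<psi>'_def[abs_def])
    interpret test_function \<psi> \<psi>' R B by (rule tf)
    have z: "\<psi>' x v = 0" if "x \<notin> \<Omega>" for x v
    proof -
      have "x \<notin> closure {x. \<psi> x \<noteq> 0}" using that supp by (auto simp: compactly_supported_in_def)
      then show ?thesis by (simp add: \<psi>'_def frechet_derivative_outside_support)
    qed
    have i: "integrable lborel (\<lambda>x. a x $ i * \<psi>' x (axis j 1))" "integrable lborel (\<lambda>x. b x $ i * \<psi>' x (axis j 1))" for i j
      using z comp by (auto intro!: int[OF tf ax])
    have eq: "perp (a x - b x) \<bullet> gradient \<psi> x
        = (a x $ 1 * \<psi>' x (axis 2 1) - a x $ 2 * \<psi>' x (axis 1 1)) - (b x $ 1 * \<psi>' x (axis 2 1) - b x $ 2 * \<psi>' x (axis 1 1))" for x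
      by (simp add: inner_vec_def sum_2 gradient_def partial_deriv_def \<psi>'_def algebra_simps)
    have meas: "(\<lambda>x. (a x $ 1 * \<psi>' x (axis 2 1) - a x $ 2 * \<psi>' x (axis 1 1)) - (b x $ 1 * \<psi>' x (axis 2 1) - b x $ 2 * \<psi>' x (axis 1 1))) \<in> borel_measurable borel"
      using i[THEN borel_measurable_integrable] by (intro borel_measurable_diff) auto
    have "(LINT x:\<Omega>|lebesgue. perp (a x - b x) \<bullet> gradient \<psi> x)
        = (\<integral>x. (a x $ 1 * \<psi>' x (axis 2 1) - a x $ 2 * \<psi>' x (axis 1 1)) - (b x $ 1 * \<psi>' x (axis 2 1) - b x $ 2 * \<psi>' x (axis 1 1)) \<partial>lborel)"
      unfolding eq by (rule set_lebesgue_integral_eq_lborel[OF meas]) (simp add: z)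
    also have "\<dots> = ((\<integral>x. a x $ 1 * \<psi>' x (axis 2 1) \<partial>lborel) - (\<integral>x. a x $ 2 * \<psi>' x (axis 1 1) \<partial>lborel))
        - ((\<integral>x. b x $ 1 * \<psi>' x (axis 2 1) \<partial>lborel) - (\<integral>x. b x $ 2 * \<psi>' x (axis 1 1) \<partial>lborel))"
      by (simp add: i)
    also have "\<dots> = 0"
      using subgradient_curl_free[OF ua _ L(1) ax[of 1] ax[of 2]] subgradient_curl_free[OF vb _ L(2) ax[of 1] ax[of 2]]
      by (simp add: inner_axis_real2)
    finally show "(LINT x:\<Omega>|lebesgue. perp (a x - b x) \<bullet> gradient \<psi> x) = 0" .
  qed
qed

section \<open>Approximate limits and jumps\<close>

definition half_plane :: "real^2 \<Rightarrow> real^2 \<Rightarrow> (real^2) set" where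
  "half_plane x \<nu> = {y. (y - x) \<bullet> \<nu> > 0}"

lemma jump_triple_iff:
  "jump_triple m x a b \<nu> \<longleftrightarrow> norm \<nu> = 1 \<and> a \<noteq> b \<and>
     approx_limit_along (half_plane x \<nu>) m x a \<and> approx_limit_along (half_plane x (- \<nu>)) m x b"
  by (simp add: jump_triple_def half_plane_def inner_minus_right)

lemma open_half_plane: "open (half_plane x \<nu>)"
  unfolding half_plane_def by (intro open_Collect_less continuous_intros)

lemma half_plane_measurable: "half_plane x \<nu> \<in> sets lebesgue"
  using open_half_plane by (simp add: borel_open)

text \<open>A set of this kind has positive lower density at \<open>x\<close>.\<close>

definition fat_at :: "real^2 \<Rightarrow> (real^2) set \<Rightarrow> bool" where
  "fat_at x S \<longleftrightarrow> (\<exists>w e. e > 0 \<and> (\<forall>r>0. ball (x + r *\<^sub>R w) (e * r) \<subseteq> S \<inter> ball x r))"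

text \<open>The sum of two normals points into both half-planes unless they are opposite; a ball
  around that direction, of radius proportional to \<open>r\<close>, stays in the
  intersection.\<close>

lemma fat_at_half_planes:
  assumes "norm \<nu> = 1" "norm \<nu>' = 1" "\<nu>' \<noteq> - \<nu>"
  shows "fat_at x (half_plane x \<nu> \<inter> half_plane x \<nu>')"
proof -
  \<comment> \<open>\<open>d\<close> is the inner product of \<open>w\<close> with either normal,
    and \<open>8 * d\<close> is the squared norm of their sum.\<close>
  define d where "d = (1 + \<nu> \<bullet> \<nu>') / 4"
  have "0 < (norm (\<nu> + \<nu>'))\<^sup>2" using assms(3) by (auto simp: add_eq_0_iff)
  also have "(norm (\<nu> + \<nu>'))\<^sup>2 = 8 * d"
    using assms(1,2) by (simp add: power2_norm_eq_inner inner_add_left inner_add_right inner_commute d_def norm_eq_1)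
  finally have d: "d > 0" by simp
  define w where "w = (1/4) *\<^sub>R (\<nu> + \<nu>')"
  have wn: "w \<bullet> \<nu> = d" "w \<bullet> \<nu>' = d" using assms(1,2)
    by (simp_all add: w_def d_def inner_add_left inner_commute[of \<nu>' \<nu>] norm_eq_1)
  have w: "norm w \<le> 1/2" using norm_triangle_ineq[of \<nu> \<nu>'] assms by (simp add: w_def)
  define e where "e = min d (1/4)"
  have "ball (x + r *\<^sub>R w) (e * r) \<subseteq> (half_plane x \<nu> \<inter> half_plane x \<nu>') \<inter> ball x r" if r: "r > 0" for r
  proof
    fix y assume "y \<in> ball (x + r *\<^sub>R w) (e * r)"
    define z where "z = y - (x + r *\<^sub>R w)"
    have z: "norm z < e * r" using \<open>y \<in> _\<close> by (simp add: z_def dist_norm norm_minus_commute)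
    have yx: "y - x = r *\<^sub>R w + z" by (simp add: z_def)
    have er: "e * r \<le> d * r" "e * r \<le> 1/4 * r" unfolding e_def using r by (intro mult_right_mono; simp)+
    have zn: "\<bar>z \<bullet> n\<bar> < d * r" if "norm n = 1" for n
      using Cauchy_Schwarz_ineq2[of z n] that z er by simp
    have "norm (y - x) \<le> r * norm w + norm z" unfolding yx using norm_triangle_ineq[of "r *\<^sub>R w" z] r by simp
    also have "\<dots> < r * (1/2) + 1/4 * r" using z er mult_left_mono[OF w, of r] r by linarith
    finally have "y \<in> ball x r" using r by (simp add: dist_norm norm_minus_commute)
    moreover have "(y - x) \<bullet> \<nu> > 0" "(y - x) \<bullet> \<nu>' > 0"
      unfolding yx inner_add_left inner_scaleR_left wn using zn[OF assms(1)] zn[OF assms(2)]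
      by (auto simp: abs_less_iff mult.commute)
    ultimately show "y \<in> (half_plane x \<nu> \<inter> half_plane x \<nu>') \<inter> ball x r" by (simp add: half_plane_def)
  qed
  moreover have "e > 0" using d by (simp add: e_def)
  ultimately show ?thesis unfolding fat_at_def by blast
qed

lemma unit_neq_minus: "norm v = 1 \<Longrightarrow> v \<noteq> - (v :: 'a::real_normed_vector)"
proof
  assume "norm v = 1" "v = - v"
  then have "2 *\<^sub>R v = 0" by (metis add.right_inverse scaleR_2)
  then show False using \<open>norm v = 1\<close> by simp
qed

lemma fat_at_half_plane: "norm \<nu> = 1 \<Longrightarrow> fat_at x (half_plane x \<nu>)"
  using fat_at_half_planes[of \<nu> \<nu> x] unit_neq_minus[of \<nu>] by simp

lemma fat_at_measure:
  assumes "fat_at x S"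
  shows "\<exists>c>0. \<forall>r>0. S \<in> sets lebesgue \<longrightarrow> c * measure lebesgue (ball x r) \<le> measure lebesgue (S \<inter> ball x r)"
proof -
  obtain w e where e: "e > 0" "\<And>r. r > 0 \<Longrightarrow> ball (x + r *\<^sub>R w) (e * r) \<subseteq> S \<inter> ball x r"
    using assms unfolding fat_at_def by blast
  have "e\<^sup>2 * measure lebesgue (ball x r) \<le> measure lebesgue (S \<inter> ball x r)" if "r > 0" "S \<in> sets lebesgue" for r
  proof -
    have "e\<^sup>2 * measure lebesgue (ball x r) = measure lebesgue (ball (x + r *\<^sub>R w) (e * r))"
      using e that by (simp add: content_ball power_mult_distrib)
    also have "\<dots> \<le> measure lebesgue (S \<inter> ball x r)"
      using that by (intro measure_mono_fmeasurable e fmeasurable_Int_fmeasurable[of "ball x r", unfolded Int_commute[of "ball x r"]]) auto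
    finally show ?thesis .
  qed
  then show ?thesis using e(1) by (intro exI[of _ "e\<^sup>2"]) auto
qed

lemma integrable_norm_diff_const:
  assumes m: "set_integrable lebesgue (ball x R) m" and S: "S \<in> sets lebesgue" and r: "r \<le> R"
  shows "set_integrable lebesgue (S \<inter> ball x r) (\<lambda>y. norm (m y - a :: real^2))"
proof -
  have "set_integrable lebesgue (ball x R) (\<lambda>y. m y - a)"
  proof (rule set_integral_diff(1)[OF m])
    show "set_integrable lebesgue (ball x R) (\<lambda>y. a)"
      unfolding set_integrable_def
      using finite_measure_lebesgue_on[of "ball x R"] by (intro integrable_scaleR_left integrable_real_indicator)
        (use emeasure_lborel_ball_finite[of x R] in auto)
  qed
  then have "set_integrable lebesgue (ball x R) (\<lambda>y. norm (m y - a))"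
    by (rule set_integrable_norm)
  then show ?thesis by (rule set_integrable_subset) (use S r in auto)
qed

text \<open>On the overlap \<open>m\<close> is close to both limits in the mean, and the overlap
  fills a fixed proportion \<open>c\<close> of each ball. So \<open>c * norm (a - b)\<close> is
  bounded by two averages that tend to zero.\<close>

lemma approx_limit_unique:
  assumes m: "set_integrable lebesgue (ball x R) m" and R: "R > 0"
    and S: "S \<in> sets lebesgue" "S' \<in> sets lebesgue" and fat: "fat_at x (S \<inter> S')"
    and a: "approx_limit_along S m x a" and b: "approx_limit_along S' m x b"
  shows "a = b"
proof -
  obtain c where c: "c > 0" "\<And>r. r > 0 \<Longrightarrow> c * measure lebesgue (ball x r) \<le> measure lebesgue (S \<inter> S' \<inter> ball x r)"
    using fat_at_measure[OF fat] S by auto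
  define A where "A S a r = (LINT y:(S \<inter> ball x r)|lebesgue. norm (m y - a)) / measure lebesgue (S \<inter> ball x r)" for S a r
  have le: "c * norm (a - b) \<le> A S a r + A S' b r" if r: "0 < r" "r < R" for r
  proof -
    let ?B = "measure lebesgue (ball x r)" and ?T = "S \<inter> S' \<inter> ball x r"
    have B: "?B > 0" using r by (simp add: content_ball unit_ball_vol_pos)
    have fin: "U \<inter> ball x r \<in> lmeasurable" if "U \<in> sets lebesgue" for U
      using that by (subst Int_commute) (intro fmeasurable_Int_fmeasurable, auto)
    have ST: "S \<inter> S' \<in> sets lebesgue" using S by auto
    have I: "(LINT y:(U \<inter> ball x r)|lebesgue. norm (m y - d)) \<le> A U d r * ?B" and I0: "0 \<le> A U d r"
      and IT: "(LINT y:?T|lebesgue. norm (m y - d)) \<le> (LINT y:(U \<inter> ball x r)|lebesgue. norm (m y - d))"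
      if U: "U \<in> sets lebesgue" "S \<inter> S' \<subseteq> U" for U d
    proof -
      have "measure lebesgue ?T \<le> measure lebesgue (U \<inter> ball x r)"
        using U by (intro measure_mono_fmeasurable fin) (use ST in auto)
      then have pos: "0 < measure lebesgue (U \<inter> ball x r)" using c(2)[OF r(1)] mult_pos_pos[OF c(1) B] by linarith
      have n: "0 \<le> (LINT y:(U \<inter> ball x r)|lebesgue. norm (m y - d))"
        unfolding set_lebesgue_integral_def by (rule integral_nonneg_AE) simp
      show A0: "0 \<le> A U d r" unfolding A_def using n by simp
      have "measure lebesgue (U \<inter> ball x r) \<le> ?B" using U by (intro measure_mono_fmeasurable) auto
      then have "A U d r * measure lebesgue (U \<inter> ball x r) \<le> A U d r * ?B" using A0 by (rule mult_left_mono)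
      then show "(LINT y:(U \<inter> ball x r)|lebesgue. norm (m y - d)) \<le> A U d r * ?B" using pos by (simp add: A_def)
      show "(LINT y:?T|lebesgue. norm (m y - d)) \<le> (LINT y:(U \<inter> ball x r)|lebesgue. norm (m y - d))"
        unfolding set_lebesgue_integral_def
      proof (rule integral_mono)
        show "integrable lebesgue (\<lambda>y. indicat_real ?T y *\<^sub>R norm (m y - d))"
          using integrable_norm_diff_const[OF m ST, of r d] r by (simp add: set_integrable_def)
        show "integrable lebesgue (\<lambda>y. indicat_real (U \<inter> ball x r) y *\<^sub>R norm (m y - d))"
          using integrable_norm_diff_const[OF m U(1), of r d] r by (simp add: set_integrable_def)
      qed (use U in \<open>auto simp: indicator_def\<close>)
    qed
    have "c * ?B * norm (a - b) \<le> measure lebesgue ?T * norm (a - b)"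
      using c(2)[OF r(1)] by (intro mult_right_mono) auto
    also have "\<dots> = (LINT y:?T|lebesgue. norm (a - b))"
      using fin[OF ST] by (simp add: set_lebesgue_integral_def fmeasurableD)
    also have "\<dots> \<le> (LINT y:?T|lebesgue. norm (m y - a) + norm (m y - b))"
      unfolding set_lebesgue_integral_def
    proof (rule integral_mono)
      show "integrable lebesgue (\<lambda>y. indicat_real ?T y *\<^sub>R norm (a - b))"
        using fin[OF ST] by (intro integrable_scaleR_left integrable_real_indicator)
          (auto simp: fmeasurable_def)
      show "integrable lebesgue (\<lambda>y. indicat_real ?T y *\<^sub>R (norm (m y - a) + norm (m y - b)))"
        using set_integral_add(1)[OF integrable_norm_diff_const[OF m ST, of r a] integrable_norm_diff_const[OF m ST, of r b]] r
        by (simp add: set_integrable_def)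
      show "indicat_real ?T y *\<^sub>R norm (a - b) \<le> indicat_real ?T y *\<^sub>R (norm (m y - a) + norm (m y - b))" for y
        using norm_triangle_ineq4[of "m y - b" "m y - a"] by (auto simp: indicator_def)
    qed
    also have "\<dots> = (LINT y:?T|lebesgue. norm (m y - a)) + (LINT y:?T|lebesgue. norm (m y - b))"
      using r by (intro set_integral_add(2) integrable_norm_diff_const[OF m ST]) auto
    also have "\<dots> \<le> A S a r * ?B + A S' b r * ?B"
      using IT[OF S(1), of a] I[OF S(1), of a] IT[OF S(2), of b] I[OF S(2), of b] by simp
    finally have "(c * norm (a - b)) * ?B \<le> (A S a r + A S' b r) * ?B" by (simp add: algebra_simps)
    then show ?thesis using B by simp
  qed
  have "((\<lambda>r. A S a r + A S' b r) \<longlongrightarrow> 0 + 0) (at_right 0)"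
    using a b unfolding approx_limit_along_def A_def by (intro tendsto_add)
  moreover have "\<forall>\<^sub>F r in at_right 0. c * norm (a - b) \<le> A S a r + A S' b r"
    using R le by (auto simp: eventually_at_right_field intro!: exI[of _ R])
  ultimately have "c * norm (a - b) \<le> 0"
    using tendsto_lowerbound[of _ "0 + 0"] by (metis add.right_neutral trivial_limit_at_right_real)
  then show ?thesis using c(1) by (simp add: mult_le_0_iff)
qed

lemma approx_limitI:
  assumes S: "S \<in> sets lebesgue"
    and lim: "\<And>e. e > 0 \<Longrightarrow> \<exists>d>0. \<forall>y\<in>S \<inter> ball x d. norm (m y - a) \<le> e"
  shows "approx_limit_along S m x a"
  unfolding approx_limit_along_def
proof (rule tendstoI)
  fix e :: real assume "e > 0"
  then obtain d where d: "d > 0" "\<And>y. y \<in> S \<inter> ball x d \<Longrightarrow> norm (m y - a) \<le> e / 2"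
    using lim[of "e/2"] by (auto simp: Bex_def)
  have "dist ((LINT y:(S \<inter> ball x r)|lebesgue. norm (m y - a)) / measure lebesgue (S \<inter> ball x r)) 0 < e"
    if r: "0 < r" "r < d" for r
  proof -
    let ?U = "S \<inter> ball x r" and ?I = "LINT y:(S \<inter> ball x r)|lebesgue. norm (m y - a)"
    have fin: "?U \<in> lmeasurable"
      using S by (subst Int_commute) (intro fmeasurable_Int_fmeasurable, auto)
    have n: "0 \<le> ?I" unfolding set_lebesgue_integral_def by (rule integral_nonneg_AE) simp
    have "?I \<le> (\<integral>y. e / 2 * indicat_real ?U y \<partial>lebesgue)"
    proof (cases "integrable lebesgue (\<lambda>y. indicat_real ?U y *\<^sub>R norm (m y - a))")
      case True
      show ?thesis unfolding set_lebesgue_integral_def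
      proof (rule integral_mono[OF True])
        show "integrable lebesgue (\<lambda>y. e / 2 * indicat_real ?U y)"
          using fin by (intro integrable_mult_right integrable_real_indicator) (auto simp: fmeasurable_def)
        show "indicat_real ?U y *\<^sub>R norm (m y - a) \<le> e / 2 * indicat_real ?U y" for y
          using d(2)[of y] r by (auto simp: indicator_def)
      qed
    next
      \<comment> \<open>A non-integrable integrand has Bochner integral zero, so the estimate
        persists.\<close>
      case False
      have "?I = 0" unfolding set_lebesgue_integral_def by (rule not_integrable_integral_eq[OF False])
      also have "0 \<le> (\<integral>y. e / 2 * indicat_real ?U y \<partial>lebesgue)"
        using \<open>e > 0\<close> by (intro integral_nonneg_AE) auto
      finally show ?thesis .
    qed
    also have "\<dots> = e / 2 * measure lebesgue ?U" using fin by (simp add: fmeasurableD)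
    \<comment> \<open>A null intersection gives the quotient 0 by the convention for division by
      zero.\<close>
    finally have "?I / measure lebesgue ?U \<le> e / 2"
      using \<open>e > 0\<close> by (cases "measure lebesgue ?U = 0") (auto simp: divide_le_eq zero_less_measure_iff)
    moreover have "0 \<le> ?I / measure lebesgue ?U" using n by simp
    ultimately show ?thesis using \<open>e > 0\<close> unfolding dist_real_def by linarith
  qed
  then show "\<forall>\<^sub>F r in at_right 0. dist ((LINT y:(S \<inter> ball x r)|lebesgue. norm (m y - a)) / measure lebesgue (S \<inter> ball x r)) 0 < e"
    using d(1) by (auto simp: eventually_at_right_field intro!: exI[of _ d])
qed

lemma approx_limit_isCont:
  assumes "isCont m x" "S \<in> sets lebesgue"
  shows "approx_limit_along S m x (m x)"
proof (rule approx_limitI[OF assms(2)])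
  fix e :: real assume "e > 0"
  then obtain d where d: "d > 0" "\<And>y. dist y x < d \<Longrightarrow> dist (m y) (m x) < e"
    using assms(1) unfolding continuous_at_eps_delta by blast
  then show "\<exists>d>0. \<forall>y\<in>S \<inter> ball x d. norm (m y - m x) \<le> e"
    by (intro exI[of _ d]) (auto simp: dist_norm norm_minus_commute intro: less_imp_le)
qed

text \<open>Both traces would have to equal \<open>m x\<close>. Jump sets can thus be enclosed by
  proving continuity elsewhere.\<close>

lemma isCont_not_jump:
  assumes m: "set_integrable lebesgue (ball x R) m" and R: "R > 0" and "isCont m x"
  shows "\<not> jump_triple m x a b \<nu>"
proof
  assume j: "jump_triple m x a b \<nu>"
  have "c = m x" if "norm n = 1" "approx_limit_along (half_plane x n) m x c" for n c
    by (rule approx_limit_unique[OF m R half_plane_measurable half_plane_measurable _ that(2)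
        approx_limit_isCont[OF assms(3) half_plane_measurable[of x n]]]) (simp add: fat_at_half_plane[OF that(1)])
  from this[of \<nu> a] this[of "- \<nu>" b] j show False by (simp add: jump_triple_iff)
qed

text \<open>Two half-planes at \<open>x\<close> overlap in a fat set unless their normals are
  opposite. So a second triple has the same traces or, for \<open>\<nu>' = - \<nu>\<close>, the
  exchanged ones, and \<open>THE\<close> picks a well-defined value.\<close>

lemma jump_size_eq:
  assumes m: "set_integrable lebesgue (ball x R) m" and R: "R > 0" and j: "jump_triple m x a b \<nu>"
  shows "jump_size m x = norm (a - b)"
proof -
  have u: "c = c'" if "norm n = 1" "norm n' = 1" "n' \<noteq> - n" "approx_limit_along (half_plane x n) m x c"
    "approx_limit_along (half_plane x n') m x c'" for n n' c c'
    by (rule approx_limit_unique[OF m R half_plane_measurable half_plane_measurable _ that(4,5)])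
      (rule fat_at_half_planes[OF that(1-3)])
  have "norm (a' - b') = norm (a - b)" if j': "jump_triple m x a' b' \<nu>'" for a' b' \<nu>'
  proof (cases "\<nu>' = - \<nu>")
    case True
    then have "a' = b" "b' = a"
      using u[of "- \<nu>" "- \<nu>" b a'] u[of \<nu> \<nu> a b'] j j' unit_neq_minus[of \<nu>] by (auto simp: jump_triple_iff)
    then show ?thesis by (simp add: norm_minus_commute)
  next
    case False
    then have "a' = a" "b' = b"
      using u[of \<nu> \<nu>' a a'] u[of "- \<nu>" "- \<nu>'" b b'] j j' by (auto simp: jump_triple_iff minus_equation_iff)
    then show ?thesis by simp
  qed
  then show ?thesis unfolding jump_size_def using j by (intro the_equality) blast+
qed

text \<open>\<open>norm a - B\<close> is a pointwise lower bound of \<open>norm (m y - a)\<close>,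
  hence of averages that tend to zero.\<close>

lemma approx_limit_norm_le:
  assumes m: "set_integrable lebesgue (ball x R) m" and R: "R > 0" and \<nu>: "norm \<nu> = 1"
    and a: "approx_limit_along (half_plane x \<nu>) m x a" and bd: "\<And>y. norm (m y) \<le> B"
  shows "norm a \<le> B"
proof -
  let ?U = "\<lambda>r. half_plane x \<nu> \<inter> ball x r"
  obtain c where c: "c > 0" "\<And>r. r > 0 \<Longrightarrow> c * measure lebesgue (ball x r) \<le> measure lebesgue (?U r)"
    using fat_at_measure[OF fat_at_half_plane[OF \<nu>]] half_plane_measurable by blast
  have "norm a - B \<le> (LINT y:(?U r)|lebesgue. norm (m y - a)) / measure lebesgue (?U r)" if r: "0 < r" "r < R" for r
  proof -
    have fin: "?U r \<in> lmeasurable"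
      using half_plane_measurable by (subst Int_commute) (intro fmeasurable_Int_fmeasurable, auto)
    have "0 < measure lebesgue (ball x r)" using r by (simp add: content_ball unit_ball_vol_pos)
    then have pos: "0 < measure lebesgue (?U r)" using c(2)[OF r(1)] mult_pos_pos[OF c(1)] by fastforce
    have "(norm a - B) * measure lebesgue (?U r) = (\<integral>y. (norm a - B) * indicat_real (?U r) y \<partial>lebesgue)"
      using fin by (simp add: fmeasurableD)
    also have "\<dots> \<le> (LINT y:(?U r)|lebesgue. norm (m y - a))"
      unfolding set_lebesgue_integral_def
    proof (rule integral_mono)
      show "integrable lebesgue (\<lambda>y. (norm a - B) * indicat_real (?U r) y)"
        using fin by (intro integrable_mult_right integrable_real_indicator) (auto simp: fmeasurable_def)
      show "integrable lebesgue (\<lambda>y. indicat_real (?U r) y *\<^sub>R norm (m y - a))"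
        using integrable_norm_diff_const[OF m half_plane_measurable[of x \<nu>], of r a] r by (simp add: set_integrable_def)
      show "(norm a - B) * indicat_real (?U r) y \<le> indicat_real (?U r) y *\<^sub>R norm (m y - a)" for y
        using norm_triangle_ineq2[of a "m y"] bd[of y] by (auto simp: indicator_def norm_minus_commute)
    qed
    finally show ?thesis using pos by (simp add: pos_le_divide_eq)
  qed
  then have "\<forall>\<^sub>F r in at_right 0. norm a - B \<le> (LINT y:(?U r)|lebesgue. norm (m y - a)) / measure lebesgue (?U r)"
    using R by (auto simp: eventually_at_right_field intro!: exI[of _ R])
  then have "norm a - B \<le> 0"
    by (rule tendsto_lowerbound[OF a[unfolded approx_limit_along_def]]) simp
  then show ?thesis by simp
qed

section \<open>Circumscribed domains\<close>

lemma perp_inner_self [simp]: "perp v \<bullet> v = 0"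
  by (simp add: inner_vec_def sum_2)

lemma unit_inner_eq_1: "norm p = 1 \<Longrightarrow> norm q = 1 \<Longrightarrow> p \<bullet> q = 1 \<Longrightarrow> p = (q :: 'a::real_inner)"
proof -
  assume a: "norm p = 1" "norm q = 1" "p \<bullet> q = 1"
  have "(norm (p - q))\<^sup>2 = 0"
    using a by (simp add: power2_norm_eq_inner inner_diff_left inner_diff_right inner_commute norm_eq_1)
  then show ?thesis by simp
qed

text \<open>The remainder \<open>y\<close> is orthogonal to \<open>p\<close> and \<open>q\<close>,
  and these are independent, since \<open>0 < x \<bullet> p\<close> together with the tie excludes
  \<open>p = - q\<close>. So a tie lies on the bisector ray.\<close>

lemma tie_direction:
  fixes p q x :: "real^2"
  assumes p: "norm p = 1" and q: "norm q = 1" and pq: "p \<noteq> q" and eq: "x \<bullet> p = x \<bullet> q" and pos: "0 < x \<bullet> p"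
  shows "0 < 1 + p \<bullet> q" "x = (x \<bullet> p / (1 + p \<bullet> q)) *\<^sub>R (p + q)"
proof -
  have n1: "p \<bullet> q \<noteq> 1" using unit_inner_eq_1[OF p q] pq by blast
  have n2: "p \<bullet> q \<noteq> -1"
  proof
    assume "p \<bullet> q = -1"
    then have "p = - q" using unit_inner_eq_1[of p "- q"] p q by simp
    then show False using eq pos by simp
  qed
  have "\<bar>p \<bullet> q\<bar> \<le> 1" using Cauchy_Schwarz_ineq2[of p q] p q by simp
  then show s: "0 < 1 + p \<bullet> q" using n2 by linarith
  define y where "y = x - (x \<bullet> p / (1 + p \<bullet> q)) *\<^sub>R (p + q)"
  have y: "y \<bullet> p = 0" "y \<bullet> q = 0"
  proof -
    have k: "(x \<bullet> p / (1 + p \<bullet> q)) * (1 + p \<bullet> q) = x \<bullet> p" using s by simp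
    have 1: "p \<bullet> p = 1" "q \<bullet> q = 1" using p q by (simp_all add: norm_eq_1)
    have "y \<bullet> p = x \<bullet> p - (x \<bullet> p / (1 + p \<bullet> q)) * (1 + p \<bullet> q)"
      "y \<bullet> q = x \<bullet> q - (x \<bullet> p / (1 + p \<bullet> q)) * (1 + p \<bullet> q)"
      by (simp_all only: y_def inner_diff_left inner_add_left inner_scaleR_left inner_commute[of q p] 1 add.commute[of _ "1::real"])
    then show "y \<bullet> p = 0" "y \<bullet> q = 0" using k eq by simp_all
  qed
  \<comment> \<open>The determinant of \<open>p\<close> and \<open>q\<close>. Lagrange's identity
    gives its square as \<open>1 - (p \<bullet> q)\<^sup>2\<close>, and elimination as in Cramer's
    rule then yields \<open>y = 0\<close>.\<close>
  define d where "d = p $ 1 * q $ 2 - p $ 2 * q $ 1"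
  have pp: "(p $ 1)\<^sup>2 + (p $ 2)\<^sup>2 = 1" "(q $ 1)\<^sup>2 + (q $ 2)\<^sup>2 = 1"
    using p q by (simp_all add: norm_eq_1 inner_vec_def sum_2 power2_eq_square)
  have "d\<^sup>2 + (p \<bullet> q)\<^sup>2 = ((p $ 1)\<^sup>2 + (p $ 2)\<^sup>2) * ((q $ 1)\<^sup>2 + (q $ 2)\<^sup>2)"
    by (simp add: d_def inner_vec_def sum_2 power2_eq_square algebra_simps)
  then have "d\<^sup>2 = 1 - (p \<bullet> q)\<^sup>2" using pp by simp
  moreover have "(p \<bullet> q)\<^sup>2 \<noteq> 1" using n1 n2 by (simp add: power2_eq_1_iff)
  ultimately have d: "d \<noteq> 0" by auto
  have y': "y $ 1 * p $ 1 + y $ 2 * p $ 2 = 0" "y $ 1 * q $ 1 + y $ 2 * q $ 2 = 0"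
    using y by (simp_all add: inner_vec_def sum_2)
  have "y $ 1 * d = q $ 2 * (y $ 1 * p $ 1 + y $ 2 * p $ 2) - p $ 2 * (y $ 1 * q $ 1 + y $ 2 * q $ 2)"
    "y $ 2 * d = p $ 1 * (y $ 1 * q $ 1 + y $ 2 * q $ 2) - q $ 1 * (y $ 1 * p $ 1 + y $ 2 * p $ 2)"
    by (simp_all add: d_def algebra_simps)
  then have "y $ 1 * d = 0" "y $ 2 * d = 0" unfolding y' by simp_all
  then have "y = 0" using d by (simp add: vec_eq_iff forall_2)
  then show "x = (x \<bullet> p / (1 + p \<bullet> q)) *\<^sub>R (p + q)" by (simp add: y_def)
qed

definition unit_at :: "real \<Rightarrow> real^2" where
  "unit_at \<theta> = vector [cos \<theta>, sin \<theta>]"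

lemma unit_at_nth [simp]: "unit_at \<theta> $ 1 = cos \<theta>" "unit_at \<theta> $ 2 = sin \<theta>"
  by (simp_all add: unit_at_def)

lemma norm_unit_at [simp]: "norm (unit_at \<theta>) = 1"
  by (simp add: norm_vec_def L2_set_def sum_2)

lemma unit_at_inner: "unit_at \<theta> \<bullet> unit_at \<phi> = cos (\<theta> - \<phi>)"
  by (simp add: inner_vec_def sum_2 cos_diff)

lemma unit_at_dist: "norm (unit_at \<theta> - unit_at \<phi>) = 2 * \<bar>sin ((\<theta> - \<phi>) / 2)\<bar>"
proof -
  have "(norm (unit_at \<theta> - unit_at \<phi>))\<^sup>2 = 2 - 2 * cos (\<theta> - \<phi>)"
    by (simp add: power2_norm_eq_inner inner_diff_left inner_diff_right unit_at_inner cos_diff mult.commute)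
  also have "cos (\<theta> - \<phi>) = cos (2 * ((\<theta> - \<phi>) / 2))" by (rule arg_cong) simp
  also have "2 - 2 * \<dots> = (2 * \<bar>sin ((\<theta> - \<phi>) / 2)\<bar>)\<^sup>2"
    unfolding cos_double_sin by (simp add: power_mult_distrib)
  finally show ?thesis by (rule power2_eq_imp_eq) auto
qed

lemma unit_at_lipschitz: "norm (unit_at \<theta> - unit_at \<phi>) \<le> \<bar>\<theta> - \<phi>\<bar>"
  unfolding unit_at_dist using abs_sin_x_le_abs_x[of "(\<theta> - \<phi>) / 2"] by simp

lemma polar_real2: "\<exists>\<theta>. 0 \<le> \<theta> \<and> \<theta> \<le> 2 * pi \<and> x = norm x *\<^sub>R unit_at \<theta>"
proof (cases "x = 0")
  case False
  have n: "(norm x)\<^sup>2 = (x $ 1)\<^sup>2 + (x $ 2)\<^sup>2"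
    unfolding power2_norm_eq_inner by (simp add: inner_vec_def sum_2 power2_eq_square)
  have "(x $ 1 / norm x)\<^sup>2 + (x $ 2 / norm x)\<^sup>2 = 1"
    using False by (simp add: power_divide n[symmetric] add_divide_distrib[symmetric])
  then obtain t where t: "0 \<le> t" "t < 2 * pi" "x $ 1 / norm x = cos t" "x $ 2 / norm x = sin t"
    using sincos_total_2pi by metis
  have "x = norm x *\<^sub>R unit_at t"
    using False by (simp add: vec_eq_iff forall_2 t(3,4)[symmetric])
  then show ?thesis using t(1,2) less_imp_le by blast
qed (auto intro!: exI[of _ 0])

text \<open>At the origin the convention \<open>sgn 0 = 0\<close> supplies one of the many
  subgradients.\<close>

lemma subgradient_norm: "subgradient_field norm (sgn :: 'a::euclidean_space \<Rightarrow> 'a)"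
  unfolding subgradient_field_def
proof safe
  fix x y :: 'a
  have "sgn x \<bullet> x = norm x" by (cases "x = 0") (simp_all add: sgn_div_norm dot_square_norm power2_eq_square)
  moreover have "sgn x \<bullet> y \<le> norm y"
    using Cauchy_Schwarz_ineq2[of "sgn x" y] by (cases "x = 0") (auto simp: norm_sgn)
  ultimately show "norm x + sgn x \<bullet> (y - x) \<le> norm y" by (simp add: inner_diff_right)
qed

section \<open>The function \<open>h\<close> and the geometry of its sublevel domain\<close>

text \<open>Compactness makes the maximum attained even for infinitely many normals, and coercivity
  bounds the domain. Indexing by naturals gives a measurable choice by least index and only
  countably many corners.\<close>

locale circumscribed =
  fixes \<nu> :: "nat \<Rightarrow> real^2" and c :: real
  assumes unit: "norm (\<nu> i) = 1"
    and compact_normals: "compact (range \<nu>)"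
    and c_pos: "c > 0" and coercive: "\<exists>i. c * norm x \<le> x \<bullet> \<nu> i"
begin

definition h :: "real^2 \<Rightarrow> real" where
  "h x = (SUP i. x \<bullet> \<nu> i)"

definition sel :: "real^2 \<Rightarrow> real^2" where
  "sel x = \<nu> (LEAST i. x \<bullet> \<nu> i = h x)"

text \<open>Normals rather than indices are compared, so that a repetition in the enumeration does
  not count as a tie.\<close>

definition no_tie :: "real^2 \<Rightarrow> bool" where
  "no_tie x \<longleftrightarrow> (\<forall>i j. x \<bullet> \<nu> i = h x \<longrightarrow> x \<bullet> \<nu> j = h x \<longrightarrow> \<nu> i = \<nu> j)"

definition domain :: "(real^2) set" where
  "domain = {x. h x < 1}"

lemma h_ge: "x \<bullet> \<nu> i \<le> h x"
proof -
  have "x \<bullet> \<nu> i \<le> norm x" for i using Cauchy_Schwarz_ineq2[of x "\<nu> i"] unit[of i] by simp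
  then show ?thesis unfolding h_def by (intro cSUP_upper bdd_aboveI) auto
qed

lemma h_attained: "\<exists>i. x \<bullet> \<nu> i = h x"
proof -
  obtain n where n: "n \<in> range \<nu>" "\<forall>m\<in>range \<nu>. x \<bullet> m \<le> x \<bullet> n"
    using continuous_attains_sup[OF compact_normals _ continuous_on_inner[OF continuous_on_const continuous_on_id], of x] by auto
  then obtain i where "n = \<nu> i" by blast
  then have "h x \<le> x \<bullet> \<nu> i" unfolding h_def using n by (intro cSUP_least) auto
  then show ?thesis using h_ge[of x i] by (intro exI[of _ i]) simp
qed

lemma h_less_iff: "h x < t \<longleftrightarrow> (\<forall>i. x \<bullet> \<nu> i < t)"
  using h_attained[of x] h_ge[of x] by (metis order_le_less_trans)

lemma sel_inner: "x \<bullet> sel x = h x"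
  unfolding sel_def using LeastI_ex[OF h_attained[of x]] .

lemma norm_sel [simp]: "norm (sel x) = 1"
  by (simp add: sel_def unit)

lemma sel_range: "sel x \<in> range \<nu>"
  by (simp add: sel_def)

lemma h_ge_range: "n \<in> range \<nu> \<Longrightarrow> x \<bullet> n \<le> h x"
  using h_ge by auto

lemma no_tie_sel: "no_tie x \<Longrightarrow> n \<in> range \<nu> \<Longrightarrow> x \<bullet> n = h x \<Longrightarrow> n = sel x"
  unfolding no_tie_def using sel_inner[of x] sel_range[of x] by (metis imageE)

lemma subgradient_h: "subgradient_field h sel"
  unfolding subgradient_field_def
proof (intro allI)
  fix x y
  show "h x + sel x \<bullet> (y - x) \<le> h y"
    using h_ge_range[OF sel_range[of x], of y] sel_inner[of x]
    by (simp only: inner_diff_right inner_commute[of "sel x"])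
qed

lemma h_lipschitz: "\<bar>h x - h y\<bar> \<le> norm (x - y)"
  using subgradient_lipschitz[OF subgradient_h, of 1] by simp

lemma continuous_h: "continuous_on S h"
proof (rule lipschitz_on_continuous_on)
  show "1-lipschitz_on S h" using h_lipschitz by (auto intro!: lipschitz_onI simp: dist_norm)
qed

lemma sel_measurable [measurable]: "sel \<in> borel_measurable borel"
proof -
  have [measurable]: "h \<in> borel_measurable borel" by (rule borel_measurable_continuous_onI[OF continuous_h])
  have "(\<lambda>x. LEAST i. x \<bullet> \<nu> i = h x) \<in> measurable borel (count_space UNIV)" by measurable
  then show ?thesis unfolding sel_def[abs_def] by measurable
qed

lemma h_coercive: "c * norm x \<le> h x"
  using coercive[of x] h_ge order_trans by blast

lemma h_pos: "x \<noteq> 0 \<Longrightarrow> 0 < h x"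
proof -
  assume "x \<noteq> 0"
  then have "0 < c * norm x" using c_pos by simp
  then show ?thesis using h_coercive[of x] by linarith
qed

lemma h_le_norm: "h x \<le> norm x"
  using Cauchy_Schwarz_ineq2[of x "sel x"] by (simp add: sel_inner)

lemma h_scale: "0 \<le> t \<Longrightarrow> h (t *\<^sub>R x) = t * h x"
proof -
  assume t: "0 \<le> t"
  have "h (t *\<^sub>R x) \<le> t * h x"
    using mult_left_mono[OF h_ge_range[OF sel_range[of "t *\<^sub>R x"], of x] t] sel_inner[of "t *\<^sub>R x"] by simp
  moreover have "t * h x \<le> h (t *\<^sub>R x)"
    using h_ge_range[OF sel_range[of x], of "t *\<^sub>R x"] sel_inner[of x] by simp
  ultimately show ?thesis by simp
qed

lemma h_add: "h (x + y) \<le> h x + h y"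
  using sel_inner[of "x + y"] h_ge_range[OF sel_range[of "x + y"], of x] h_ge_range[OF sel_range[of "x + y"], of y]
  by (simp add: inner_add_left)

lemma convex_domain: "convex domain"
proof (rule convexI)
  fix x y :: "real^2" and s t :: real
  assume a: "x \<in> domain" "y \<in> domain" "0 \<le> s" "0 \<le> t" "s + t = 1"
  have "h (s *\<^sub>R x + t *\<^sub>R y) \<le> s * h x + t * h y"
    using h_add[of "s *\<^sub>R x" "t *\<^sub>R y"] a by (simp add: h_scale)
  also have "\<dots> < 1" using convex_bound_lt[of "h x" 1 "h y" s t] a by (simp add: domain_def)
  finally show "s *\<^sub>R x + t *\<^sub>R y \<in> domain" by (simp add: domain_def)
qed

lemma open_domain: "open domain"
  unfolding domain_def by (intro open_Collect_less continuous_h continuous_on_const)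

lemma norm_le_of_h: "norm x \<le> h x / c"
  using h_coercive[of x] c_pos by (simp add: field_simps)

lemma bounded_domain: "bounded domain"
proof (rule boundedI)
  fix x assume "x \<in> domain"
  then have "h x / c \<le> 1 / c" using c_pos by (intro divide_right_mono) (auto simp: domain_def)
  then show "norm x \<le> 1 / c" using norm_le_of_h[of x] by linarith
qed

lemma zero_in_domain: "0 \<in> domain"
  by (simp add: domain_def h_def)

lemma frontier_domain: "frontier domain = {x. h x = 1}"
proof -
  have "closure domain = {x. h x \<le> 1}"
  proof
    show "closure domain \<subseteq> {x. h x \<le> 1}"
      by (rule closure_minimal) (auto simp: domain_def intro!: closed_Collect_le continuous_h)
    show "{x. h x \<le> 1} \<subseteq> closure domain"
    proof safe
      fix x assume x: "h x \<le> 1"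
      have "(\<lambda>n. (1 - inverse (real (Suc n))) *\<^sub>R x) \<longlonglongrightarrow> (1 - 0) *\<^sub>R x"
        by (intro tendsto_intros LIMSEQ_inverse_real_of_nat)
      moreover have "(1 - inverse (real (Suc n))) *\<^sub>R x \<in> domain" for n
      proof -
        have t: "0 \<le> 1 - inverse (real (Suc n))" "1 - inverse (real (Suc n)) < 1" by (auto simp: inverse_le_1_iff)
        have "s * h x < 1" if "0 \<le> s" "s < 1" for s
          using mult_left_mono[OF x that(1)] that(2) by simp
        then show ?thesis unfolding domain_def mem_Collect_eq h_scale[OF t(1)] using t by blast
      qed
      ultimately show "x \<in> closure domain" unfolding closure_sequential
        by (intro exI[of _ "\<lambda>n. (1 - inverse (real (Suc n))) *\<^sub>R x"]) (simp del: of_nat_Suc)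
    qed
  qed
  then show ?thesis
    unfolding frontier_def interior_open[OF open_domain] by (auto simp: domain_def)
qed

text \<open>Near \<open>p\<close> only normals with a definite component along
  \<open>e = p /\<^sub>R norm p\<close> can be active. Each of their half-planes is the region below
  a line of slope at most \<open>1 / k\<close> in the frame \<open>(perp e, e)\<close>, and the
  infimum \<open>g\<close> of these lines is Lipschitz.\<close>

lemma lipschitz_domain_domain: "lipschitz_domain domain"
  unfolding lipschitz_domain_def
proof (intro conjI ballI)
  show "connected domain" by (rule convex_connected[OF convex_domain])
  show "domain \<noteq> {}" using zero_in_domain by blast
  fix p assume "p \<in> frontier domain"
  then have p1: "h p = 1" by (simp add: frontier_domain)
  then have p0: "norm p \<ge> 1" using h_le_norm[of p] by simp
  have pn: "p \<noteq> 0" using p0 by (metis norm_zero not_one_le_zero)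
  define e where "e = p /\<^sub>R norm p"
  \<comment> \<open>Normals below this threshold satisfy
    \<open>p \<bullet> \<nu> i \<le> 1/2\<close>, so their constraint holds throughout the ball of
    radius 1/2.\<close>
  define k where "k = 1 / (2 * norm p)"
  have k: "k > 0" using pn by (simp add: k_def)
  have e: "norm e = 1" using pn by (simp add: e_def)
  define I where "I = {i. k \<le> \<nu> i \<bullet> e}"
  define g where "g s = (INF i\<in>I. (1 - s * (\<nu> i \<bullet> perp e)) / (\<nu> i \<bullet> e))" for s
  have comp: "y \<bullet> n = (y \<bullet> e) * (n \<bullet> e) + (y \<bullet> perp e) * (n \<bullet> perp e)" for y n
  proof -
    have e2: "(e $ 1)\<^sup>2 + (e $ 2)\<^sup>2 = 1"
      using e by (simp add: norm_eq_1 inner_vec_def sum_2 power2_eq_square)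
    have "(y \<bullet> e) * (n \<bullet> e) + (y \<bullet> perp e) * (n \<bullet> perp e) = (y \<bullet> n) * ((e $ 1)\<^sup>2 + (e $ 2)\<^sup>2)"
      by (simp add: inner_vec_def sum_2 power2_eq_square algebra_simps)
    then show ?thesis using e2 by simp
  qed
  have ip: "\<bar>\<nu> i \<bullet> v\<bar> \<le> norm v" for i v using Cauchy_Schwarz_ineq2[of "\<nu> i" v] unit[of i] by simp
  have Iq: "\<nu> i \<bullet> e > 0" if "i \<in> I" for i using that k by (auto simp: I_def)
  have "I \<noteq> {}"
  proof -
    obtain i where i: "p \<bullet> \<nu> i = h p" using h_attained by blast
    have "\<nu> i \<bullet> e = 1 / norm p" using i p1 by (simp add: e_def inner_commute field_simps)
    then have "i \<in> I" using pn by (simp add: I_def k_def field_simps)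
    then show ?thesis by blast
  qed
  define q where "q i s = (1 - s * (\<nu> i \<bullet> perp e)) / (\<nu> i \<bullet> e)" for i s
  have qlip: "q i s - q i t \<le> (1 / k) * \<bar>s - t\<bar>" if "i \<in> I" for i s t
  proof -
    have ik: "k \<le> \<nu> i \<bullet> e" using that by (simp add: I_def)
    have "q i s - q i t = ((t - s) * (\<nu> i \<bullet> perp e)) / (\<nu> i \<bullet> e)"
      by (simp add: q_def diff_divide_distrib[symmetric] algebra_simps)
    also have "\<dots> \<le> (\<bar>t - s\<bar> * 1) / (\<nu> i \<bullet> e)"
    proof (rule divide_right_mono)
      have "(t - s) * (\<nu> i \<bullet> perp e) \<le> \<bar>t - s\<bar> * \<bar>\<nu> i \<bullet> perp e\<bar>" by (metis abs_ge_self abs_mult)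
      also have "\<dots> \<le> \<bar>t - s\<bar> * 1" using ip[of i "perp e"] e by (intro mult_left_mono) auto
      finally show "(t - s) * (\<nu> i \<bullet> perp e) \<le> \<bar>t - s\<bar> * 1" .
    qed (use Iq[OF that] in simp)
    also have "\<dots> \<le> (\<bar>t - s\<bar> * 1) / k"
      using k ik by (intro divide_left_mono) auto
    finally show ?thesis by (simp add: abs_minus_commute)
  qed
  have qbd: "bdd_below ((\<lambda>i. q i s) ` I)" for s
  proof (rule bdd_belowI)
    fix r assume "r \<in> (\<lambda>i. q i s) ` I"
    then obtain i where i: "i \<in> I" "r = q i s" by blast
    have "q i 0 - q i s \<le> (1 / k) * \<bar>0 - s\<bar>" by (rule qlip[OF i(1)])
    moreover have "0 \<le> q i 0" using Iq[OF i(1)] by (simp add: q_def)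
    ultimately show "- ((1 / k) * \<bar>s\<bar>) \<le> r" using i by simp
  qed
  have g: "g s = (INF i\<in>I. q i s)" for s by (simp add: g_def q_def)
  have glip: "g s - g t \<le> (1 / k) * \<bar>s - t\<bar>" for s t
  proof -
    have "g s - (1 / k) * \<bar>s - t\<bar> \<le> g t"
      unfolding g[of t]
    proof (rule cINF_greatest[OF \<open>I \<noteq> {}\<close>])
      fix i assume i: "i \<in> I"
      have "g s \<le> q i s" unfolding g using qbd i by (intro cINF_lower) auto
      then show "g s - (1 / k) * \<bar>s - t\<bar> \<le> q i t" using qlip[OF i, of s t] by linarith
    qed
    then show ?thesis by simp
  qed
  have L: "(1 / k)-lipschitz_on UNIV g"
  proof (rule lipschitz_onI)
    show "dist (g s) (g t) \<le> 1 / k * dist s t" for s t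
      using glip[of s t] glip[of t s] by (simp add: dist_real_def abs_le_iff abs_minus_commute)
  qed (use k in simp)
  have q_iff: "y \<bullet> \<nu> i < 1 \<longleftrightarrow> y \<bullet> e < q i (y \<bullet> perp e)" if "i \<in> I" for i y
    using Iq[OF that] by (auto simp: q_def pos_less_divide_eq comp[of y "\<nu> i"])
  have "y \<in> domain \<longleftrightarrow> y \<bullet> e < g (y \<bullet> perp e)" if y: "y \<in> ball p (1/2)" for y
  proof
    assume d: "y \<in> domain"
    \<comment> \<open>The strict inequality survives the infimum because it is attained: the
      relevant normals form a compact set.\<close>
    have ci: "compact (\<nu> ` I)"
    proof -
      have "\<nu> ` I = range \<nu> \<inter> {n. k \<le> n \<bullet> e}" by (auto simp: I_def)
      moreover have "closed {n::real^2. k \<le> n \<bullet> e}" by (intro closed_Collect_le continuous_intros)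
      ultimately show ?thesis using compact_normals by (simp add: compact_Int_closed)
    qed
    let ?f = "\<lambda>n. (1 - (y \<bullet> perp e) * (n \<bullet> perp e)) / (n \<bullet> e)"
    have "continuous_on (\<nu> ` I) ?f" using Iq by (intro continuous_intros) (auto simp: less_imp_neq[symmetric])
    then obtain n where "n \<in> \<nu> ` I" "\<forall>n'\<in>\<nu> ` I. ?f n \<le> ?f n'"
      using continuous_attains_inf[OF ci] \<open>I \<noteq> {}\<close> by blast
    then obtain i where i: "i \<in> I" "\<And>j. j \<in> I \<Longrightarrow> q i (y \<bullet> perp e) \<le> q j (y \<bullet> perp e)"
      by (auto simp: q_def)
    have "y \<bullet> e < q i (y \<bullet> perp e)" using q_iff[OF i(1), of y] d unfolding domain_def h_less_iff by blast
    also have "\<dots> \<le> g (y \<bullet> perp e)" unfolding g using i \<open>I \<noteq> {}\<close> by (intro cINF_greatest) auto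
    finally show "y \<bullet> e < g (y \<bullet> perp e)" .
  next
    assume lt: "y \<bullet> e < g (y \<bullet> perp e)"
    have "y \<bullet> \<nu> i < 1" for i
    proof (cases "i \<in> I")
      case True
      have "g (y \<bullet> perp e) \<le> q i (y \<bullet> perp e)" unfolding g using qbd True by (intro cINF_lower) auto
      then show ?thesis using lt q_iff[OF True, of y] by linarith
    next
      case False
      have "p = norm p *\<^sub>R e" using pn by (auto simp: e_def)
      then have "p \<bullet> \<nu> i = norm p * (\<nu> i \<bullet> e)" by (metis inner_commute inner_scaleR_left)
      also have "\<dots> \<le> norm p * k" using False p0 by (intro mult_left_mono) (auto simp: I_def)
      also have "\<dots> = 1/2" using pn by (auto simp: k_def)
      finally have "p \<bullet> \<nu> i \<le> 1/2" .
      moreover have "(y - p) \<bullet> \<nu> i \<le> norm (y - p)" using ip[of i "y - p"] by (simp add: inner_commute)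
      moreover have "norm (y - p) < 1/2" using y by (simp add: dist_norm norm_minus_commute)
      ultimately show ?thesis by (simp add: inner_diff_left)
    qed
    then show "y \<in> domain" by (simp add: domain_def h_less_iff)
  qed
  then have "domain \<inter> ball p (1/2) = {y \<in> ball p (1/2). y \<bullet> e < g (y \<bullet> perp e)}" by blast
  then show "\<exists>e r L. \<exists>g :: real \<Rightarrow> real. norm e = 1 \<and> r > 0 \<and> L-lipschitz_on UNIV g \<and>
      domain \<inter> ball p r = {y \<in> ball p r. y \<bullet> e < g (y \<bullet> perp e)}"
    using e L by (intro exI[of _ e] exI[of _ "1/2"] exI[of _ "1/k"] exI[of _ g]) auto
qed (use open_domain bounded_domain in auto)

text \<open>Moving from \<open>x\<close> by \<open>1 - h x\<close> along \<open>sel x\<close>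
  reaches the boundary, and \<open>h\<close> being 1-Lipschitz forbids a shorter way.\<close>

lemma infdist_frontier:
  assumes "x \<in> domain"
  shows "infdist x (frontier domain) = 1 - h x"
proof (rule antisym)
  let ?y = "x + (1 - h x) *\<^sub>R sel x"
  have x: "h x < 1" using assms by (simp add: domain_def)
  have "?y \<bullet> sel x = 1" by (simp add: inner_add_left sel_inner dot_square_norm)
  then have "1 \<le> h ?y" using h_ge_range[OF sel_range[of x], of ?y] by simp
  moreover have "h ?y \<le> h x + (1 - h x) * 1"
    using h_add[of x "(1 - h x) *\<^sub>R sel x"] h_le_norm[of "(1 - h x) *\<^sub>R sel x"] x by simp
  ultimately have y: "?y \<in> frontier domain" by (simp add: frontier_domain)
  then show "infdist x (frontier domain) \<le> 1 - h x"
    using infdist_le[OF y, of x] x by (simp add: dist_norm)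
  show "1 - h x \<le> infdist x (frontier domain)"
    unfolding infdist_def
  proof (simp add: y, intro conjI impI)
    show "1 - h x \<le> (INF a\<in>frontier domain. dist x a)"
    proof (rule cINF_greatest)
      fix a assume "a \<in> frontier domain"
      then have "h a = 1" by (simp add: frontier_domain)
      then show "1 - h x \<le> dist x a" using h_lipschitz[of a x] by (simp add: dist_norm norm_minus_commute)
    qed (use y in blast)
  qed (use y in blast)
qed

text \<open>The normals away from \<open>sel x\<close> form a compact set, on which the inner
  product with \<open>x\<close> stays below \<open>h x\<close> by some \<open>d > 0\<close>. A
  displacement shorter than \<open>d / 2\<close> cannot make up for this, so none of them becomes
  active.\<close>

lemma isCont_sel:
  assumes "no_tie x"
  shows "isCont sel x"
  unfolding continuous_at_eps_delta
proof (intro allI impI)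
  fix e :: real assume e: "e > 0"
  define K where "K = range \<nu> - ball (sel x) e"
  show "\<exists>d>0. \<forall>y. dist y x < d \<longrightarrow> dist (sel y) (sel x) < e"
  proof (cases "K = {}")
    case True
    then have "dist (sel y) (sel x) < e" for y using sel_range[of y] by (auto simp: K_def dist_commute)
    then show ?thesis using zero_less_one by blast
  next
    case False
    have "compact K" unfolding K_def using compact_normals by (rule compact_diff) simp
    then obtain n where n: "n \<in> K" "\<forall>m\<in>K. x \<bullet> m \<le> x \<bullet> n"
      using continuous_attains_sup[OF \<open>compact K\<close> False continuous_on_inner[OF continuous_on_const continuous_on_id], of x] by auto
    define d where "d = h x - x \<bullet> n"
    have "n \<noteq> sel x" "n \<in> range \<nu>" using n(1) e by (auto simp: K_def)
    then have "x \<bullet> n \<noteq> h x" using no_tie_sel[OF assms] by blast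
    then have d: "d > 0" using h_ge_range[OF \<open>n \<in> range \<nu>\<close>, of x] by (simp add: d_def)
    have "dist (sel y) (sel x) < e" if y: "dist y x < d / 2" for y
    proof (rule ccontr)
      assume "\<not> ?thesis"
      then have "sel y \<in> K" using sel_range[of y] by (auto simp: K_def dist_commute)
      then have "x \<bullet> sel y \<le> h x - d" using n by (simp add: d_def)
      moreover have "(y - x) \<bullet> sel y \<le> norm (y - x)" using Cauchy_Schwarz_ineq2[of "y - x" "sel y"] by simp
      ultimately have "h y \<le> h x - d + norm (y - x)" using sel_inner[of y] by (simp add: inner_diff_left)
      then show False using y h_lipschitz[of y x] by (simp add: dist_norm)
    qed
    then show ?thesis using d by (intro exI[of _ "d / 2"]) auto
  qed
qed

text \<open>By \<open>tie_direction\<close> a corner is determined by a pair of normals active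
  there.\<close>

lemma tie_frontier_countable: "countable {x. h x = 1 \<and> \<not> no_tie x}"
proof (rule countable_subset)
  show "{x. h x = 1 \<and> \<not> no_tie x} \<subseteq> (\<lambda>(i, j). (1 / (1 + \<nu> i \<bullet> \<nu> j)) *\<^sub>R (\<nu> i + \<nu> j)) ` UNIV"
  proof safe
    fix x assume "h x = 1" "\<not> no_tie x"
    then obtain i j where "x \<bullet> \<nu> i = 1" "x \<bullet> \<nu> j = 1" "\<nu> i \<noteq> \<nu> j" by (auto simp: no_tie_def)
    then have "x = (1 / (1 + \<nu> i \<bullet> \<nu> j)) *\<^sub>R (\<nu> i + \<nu> j)"
      using tie_direction(2)[of "\<nu> i" "\<nu> j" x] unit by simp
    then show "x \<in> (\<lambda>(i, j). (1 / (1 + \<nu> i \<bullet> \<nu> j)) *\<^sub>R (\<nu> i + \<nu> j)) ` UNIV" by (intro image_eqI[of _ _ "(i, j)"]) auto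
  qed
qed auto

text \<open>The outer half holds because the line through \<open>x\<close> normal to
  \<open>sel x\<close> supports the domain. For the inner half, the normal active at
  \<open>y\<close> is close to \<open>sel x\<close>, so that \<open>y\<close> satisfies even this
  tightest constraint strictly.\<close>

lemma exterior_unit_normal_sel:
  assumes x: "h x = 1" and "no_tie x"
  shows "exterior_unit_normal domain x (sel x)"
  unfolding exterior_unit_normal_def
proof (intro conjI allI impI)
  show "x \<in> frontier domain" using x by (simp add: frontier_domain)
  show "norm (sel x) = 1" by simp
  fix \<epsilon> :: real assume \<epsilon>: "\<epsilon> > 0"
  obtain r where r: "r > 0" "\<And>y. dist y x < r \<Longrightarrow> dist (sel y) (sel x) < \<epsilon>"
    using isCont_sel[OF assms(2)] \<epsilon> unfolding continuous_at_eps_delta by blast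
  have "((y - x) \<bullet> sel x < - \<epsilon> * norm (y - x) \<longrightarrow> y \<in> domain) \<and> ((y - x) \<bullet> sel x > \<epsilon> * norm (y - x) \<longrightarrow> y \<notin> domain)"
    if y: "y \<in> ball x r" for y
  proof (intro conjI impI)
    assume a: "(y - x) \<bullet> sel x < - \<epsilon> * norm (y - x)"
    have "(y - x) \<bullet> (sel y - sel x) \<le> norm (y - x) * norm (sel y - sel x)"
      using Cauchy_Schwarz_ineq2[of "y - x" "sel y - sel x"] by simp
    also have "\<dots> \<le> norm (y - x) * \<epsilon>"
      using r(2)[of y] y by (intro mult_left_mono) (auto simp: dist_norm norm_minus_commute)
    finally have "(y - x) \<bullet> sel y < 0" using a by (simp add: inner_diff_right mult.commute)
    then have "h y < x \<bullet> sel y" using sel_inner[of y] by (simp add: inner_diff_left)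
    then show "y \<in> domain" using h_ge_range[OF sel_range[of y], of x] x by (simp add: domain_def)
  next
    assume a: "(y - x) \<bullet> sel x > \<epsilon> * norm (y - x)"
    moreover have "0 \<le> \<epsilon> * norm (y - x)" using \<epsilon> by simp
    ultimately have "(y - x) \<bullet> sel x > 0" by linarith
    then have "y \<bullet> sel x > 1" using sel_inner[of x] x by (simp add: inner_diff_left)
    then show "y \<notin> domain" using h_ge_range[OF sel_range[of x], of y] by (simp add: domain_def)
  qed
  then show "\<exists>r>0. \<forall>y\<in>ball x r. ((y - x) \<bullet> sel x < - \<epsilon> * norm (y - x) \<longrightarrow> y \<in> domain) \<and>
      ((y - x) \<bullet> sel x > \<epsilon> * norm (y - x) \<longrightarrow> y \<notin> domain)" using r(1) by blast
qed

end

lemma sgn_measurable [measurable]: "(sgn :: 'a::euclidean_space \<Rightarrow> 'a) \<in> borel_measurable borel"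
  unfolding sgn_div_norm by measurable

text \<open>Every subset of a negligible set is Lebesgue measurable. This serves for the viscosity
  solution, whose values on a line of ties are unspecified.\<close>

lemma lebesgue_measurable_off_negligible:
  fixes f g :: "'a::euclidean_space \<Rightarrow> 'b::topological_space"
  assumes g: "g \<in> borel_measurable lebesgue" and N: "negligible N" and eq: "\<And>x. x \<notin> N \<Longrightarrow> f x = g x"
  shows "f \<in> borel_measurable lebesgue"
proof (rule measurableI)
  fix A :: "'b set" assume A: "A \<in> sets borel"
  have split: "f -` A = (g -` A - N) \<union> (f -` A \<inter> N)"
    using eq by fastforce
  have m1: "f -` A \<inter> N \<in> sets lebesgue"
    by (rule negligible_imp_sets[OF negligible_subset[OF N]]) simp
  have m2: "g -` A \<in> sets lebesgue"
    using measurable_sets[OF g A] by simp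
  have "(g -` A - N) \<union> (f -` A \<inter> N) \<in> sets lebesgue"
    by (intro sets.Un sets.Diff m1 m2 negligible_imp_sets[OF N])
  then show "f -` A \<inter> space lebesgue \<in> sets lebesgue"
    by (simp only: split[symmetric] space_completion space_lborel space_borel Int_UNIV_right)
qed simp

section \<open>The competitor: admissibility and finite line energy\<close>

context circumscribed
begin

text \<open>With \<open>\<psi> = min (1 - h) (norm - 1)\<close> this is the rotated gradient of \<open>\<psi>\<close>, written as a difference of
  two gradients of convex functions, namely of the norm and of \<open>max 0 (norm + h - 2)\<close>.\<close>

definition field :: "real^2 \<Rightarrow> real^2" where
  "field x = perp (sgn x - (if norm x + h x < 2 then 0 else sgn x + sel x))"

lemma subgradient_ridge:
  "subgradient_field (\<lambda>x. max 0 (norm x + h x - 2)) (\<lambda>x. if norm x + h x < 2 then 0 else sgn x + sel x)"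
  unfolding subgradient_field_def
proof (intro allI)
  fix x y :: "real^2"
  show "max 0 (norm x + h x - 2) + (if norm x + h x < 2 then 0 else sgn x + sel x) \<bullet> (y - x)
      \<le> max 0 (norm y + h y - 2)"
    using subgradient_fieldD[OF subgradient_norm, of x y] subgradient_fieldD[OF subgradient_h, of x y]
    by (auto simp: inner_add_left)
qed

lemma h_measurable [measurable]: "h \<in> borel_measurable borel"
  by (rule borel_measurable_continuous_onI[OF continuous_h])

lemma ridge_gradient_measurable [measurable]:
  "(\<lambda>x. if norm x + h x < 2 then 0 else sgn x + sel x) \<in> borel_measurable borel"
  by measurable

lemma field_measurable [measurable]: "field \<in> borel_measurable borel"
  unfolding field_def[abs_def] by measurable

lemma field_inside: "norm x + h x < 2 \<Longrightarrow> field x = perp (sgn x)"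
  by (simp add: field_def)

lemma field_outside: "\<not> norm x + h x < 2 \<Longrightarrow> field x = perp (- sel x)"
  by (simp add: field_def)

lemma norm_field: "x \<noteq> 0 \<Longrightarrow> norm (field x) = 1"
  by (cases "norm x + h x < 2") (simp_all add: field_inside field_outside norm_sgn)

lemma norm_field_le: "norm (field x) \<le> 1"
  by (cases "norm x + h x < 2") (simp_all add: field_inside field_outside norm_sgn)

lemma field_set_integrable: "set_integrable lebesgue (ball x R) field"
  by (rule bounded_borel_set_integrable[OF _ norm_field_le]) auto

lemma field_admissible: "field \<in> admissible domain"
proof -
  have b: "norm (sgn x :: real^2) \<le> 2" for x by (simp add: norm_sgn)
  have b': "norm (if norm x + h x < 2 then 0 else sgn x + sel x) \<le> 2" for x
    using norm_triangle_ineq[of "sgn x" "sel x"] by (auto simp: norm_sgn split: if_splits)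
  have "AE x in lebesgue. x \<noteq> (0::real^2)"
    by (intro AE_completion AE_lborel_singleton)
  then have "AE x in lebesgue. x \<in> domain \<longrightarrow> norm (field x) = 1"
    by (rule eventually_mono) (simp add: norm_field)
  then show ?thesis
    using perp_gradient_difference[OF subgradient_norm subgradient_ridge sgn_measurable ridge_gradient_measurable
        b b' open_domain bounded_domain]
    unfolding admissible_def field_def[abs_def] by simp
qed

lemma isCont_perp: "isCont f x \<Longrightarrow> isCont (\<lambda>x. perp (f x)) x"
  by (rule bounded_linear.isCont[OF linear_conv_bounded_linear[THEN iffD1, OF linear_perp]])

lemma isCont_field_inside:
  assumes "x \<noteq> 0" "norm x + h x < 2"
  shows "isCont field x"
proof -
  have o: "open {y. norm y + h y < 2}" by (intro open_Collect_less continuous_intros continuous_h)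
  have "isCont (\<lambda>x. perp (sgn x)) x" using assms by (intro isCont_perp isCont_sgn continuous_ident) auto
  moreover have "\<forall>\<^sub>F y in nhds x. field y = perp (sgn y)"
    using eventually_nhds_in_open[OF o, of x] assms by (auto elim!: eventually_mono simp: field_inside)
  ultimately show ?thesis by (subst isCont_cong)
qed

lemma isCont_field_outside:
  assumes "no_tie x" "2 < norm x + h x"
  shows "isCont field x"
proof -
  have o: "open {y. 2 < norm y + h y}" by (intro open_Collect_less continuous_intros continuous_h)
  have "isCont (\<lambda>x. perp (- sel x)) x" using assms by (intro isCont_perp continuous_intros isCont_sel)
  moreover have "\<forall>\<^sub>F y in nhds x. field y = perp (- sel y)"
    using eventually_nhds_in_open[OF o, of x] assms by (auto elim!: eventually_mono simp: field_outside)
  ultimately show ?thesis by (subst isCont_cong)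
qed

text \<open>At a boundary point \<open>norm x = 1\<close> would force \<open>x = sel x\<close>, a
  point of tangency. Elsewhere \<open>norm x + h x > 2\<close>, so near \<open>x\<close> the field
  is the rotated \<open>- sel\<close> and its trace is tangential. Corners and points of tangency
  are countable, hence null.\<close>

lemma field_admissible0: "field \<in> admissible0 domain"
proof -
  define E where "E = {x. h x = 1 \<and> \<not> no_tie x} \<union> range \<nu>"
  have cE: "countable E" unfolding E_def using tie_frontier_countable by auto
  have Es: "E \<in> sets borel" by (rule sets.countable[OF _ cE]) simp
  have E0: "E \<in> null_sets hausdorff1"
    using Es by (auto simp: null_sets_def emeasure_hausdorff1 hausdorff1_outer_countable[OF cE])
  have "\<exists>\<nu> a. exterior_unit_normal domain x \<nu> \<and> approx_limit_along domain field x a \<and> a \<bullet> \<nu> = 0"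
    if x: "x \<in> frontier domain" "x \<notin> E" for x
  proof -
    have hx: "h x = 1" and nt: "no_tie x" using x by (auto simp: frontier_domain E_def)
    have "norm x \<noteq> 1"
    proof
      assume "norm x = 1"
      then have "x = sel x" using unit_inner_eq_1[of x "sel x"] sel_inner[of x] hx by simp
      then show False using x(2) sel_range[of x] by (simp add: E_def)
    qed
    then have "2 < norm x + h x" using h_le_norm[of x] hx by simp
    then have c: "isCont field x" and f: "field x = perp (- sel x)"
      using isCont_field_outside[OF nt] field_outside[of x] by auto
    have "approx_limit_along domain field x (field x)"
      using open_domain by (intro approx_limit_isCont c) auto
    moreover have "field x \<bullet> sel x = 0"
      unfolding f using perp_inner_self[of "- sel x"] by (simp add: inner_minus_right)
    ultimately show ?thesis using exterior_unit_normal_sel[OF hx nt] by blast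
  qed
  then have "AE x in hausdorff1. x \<in> frontier domain \<longrightarrow>
      (\<exists>\<nu> a. exterior_unit_normal domain x \<nu> \<and> approx_limit_along domain field x a \<and> a \<bullet> \<nu> = 0)"
    by (intro AE_I'[OF E0]) blast
  then show ?thesis using field_admissible by (simp add: admissible0_def)
qed

text \<open>The origin is the centre of the vortex, the curve separates the two regimes, and beyond
  it a discontinuity requires a tie. Inside the curve ties leave no trace: this is where the walls
  are cut off.\<close>

lemma jump_set_field:
  "jump_set domain field \<subseteq> insert 0 ({x. norm x + h x = 2} \<union> {x \<in> domain. \<not> no_tie x \<and> 2 < norm x + h x})"
proof
  fix x assume "x \<in> jump_set domain field"
  then obtain a b n where x: "x \<in> domain" and j: "jump_triple field x a b n" by (auto simp: jump_set_def)
  have "\<not> isCont field x" using isCont_not_jump[OF field_set_integrable, of 1] j by auto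
  then show "x \<in> insert 0 ({x. norm x + h x = 2} \<union> {x \<in> domain. \<not> no_tie x \<and> 2 < norm x + h x})"
    using isCont_field_inside[of x] isCont_field_outside[of x] x
    by (cases rule: linorder_cases[of "norm x + h x" 2]) blast+
qed

lemma jump_size_field_le:
  assumes "x \<in> jump_set domain field"
  shows "0 \<le> jump_size field x" "jump_size field x \<le> 2"
proof -
  obtain a b n where j: "jump_triple field x a b n" using assms by (auto simp: jump_set_def)
  have s: "jump_size field x = norm (a - b)" by (rule jump_size_eq[OF field_set_integrable zero_less_one j])
  have "norm a \<le> 1" "norm b \<le> 1"
    using approx_limit_norm_le[OF field_set_integrable zero_less_one _ _ norm_field_le, of n x a]
      approx_limit_norm_le[OF field_set_integrable zero_less_one _ _ norm_field_le, of "- n" x b] j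
    by (simp_all add: jump_triple_iff)
  then show "0 \<le> jump_size field x" "jump_size field x \<le> 2"
    using norm_triangle_ineq4[of a b] by (auto simp: s)
qed

text \<open>By homogeneity of \<open>h\<close> the curve is the polar graph of
  \<open>r t = 2 / (1 + H t)\<close>. This \<open>r\<close> is 2-Lipschitz and at most 2, so the
  parametrisation is 4-Lipschitz on an interval of length \<open>2 * pi\<close>.\<close>

lemma hausdorff1_outer_curve: "hausdorff1_outer {x. norm x + h x = 2} \<le> ennreal (8 * pi)"
proof -
  define H where "H t = h (unit_at t)" for t
  define r where "r t = 2 / (1 + H t)" for t
  have u0: "unit_at t \<noteq> 0" for t using norm_unit_at[of t] by (metis norm_zero zero_neq_one)
  have H: "0 < H t" for t unfolding H_def by (rule h_pos[OF u0])
  have Hl: "\<bar>H s - H t\<bar> \<le> \<bar>s - t\<bar>" for s t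
    unfolding H_def using h_lipschitz[of "unit_at s" "unit_at t"] unit_at_lipschitz[of s t] by linarith
  have r: "\<bar>r s - r t\<bar> \<le> 2 * \<bar>s - t\<bar>" "0 \<le> r t" "r t \<le> 2" for s t
  proof -
    have "r s - r t = 2 * (H t - H s) / ((1 + H s) * (1 + H t))"
      using H[of s] H[of t] by (simp add: r_def field_simps)
    moreover have "\<bar>(1 + H s) * (1 + H t)\<bar> = (1 + H s) * (1 + H t)"
      using H[of s] H[of t] by (intro abs_of_pos mult_pos_pos) auto
    ultimately have "\<bar>r s - r t\<bar> = 2 * \<bar>H t - H s\<bar> / ((1 + H s) * (1 + H t))"
      by (simp only: abs_divide abs_mult[of 2] abs_numeral)
    also have "\<dots> \<le> 2 * \<bar>H t - H s\<bar> / 1"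
    proof (rule divide_left_mono)
      have "1 * 1 \<le> (1 + H s) * (1 + H t)" using H[of s] H[of t] by (intro mult_mono) auto
      then show "1 \<le> (1 + H s) * (1 + H t)" by simp
    qed (use H[of s] H[of t] in auto)
    finally show "\<bar>r s - r t\<bar> \<le> 2 * \<bar>s - t\<bar>" using Hl[of t s] by (simp add: abs_minus_commute)
    show "0 \<le> r t" "r t \<le> 2" using H[of t] by (auto simp: r_def divide_le_eq)
  qed
  have "{x. norm x + h x = 2} \<subseteq> (\<lambda>t. r t *\<^sub>R unit_at t) ` {0..2*pi}"
  proof safe
    fix x :: "real^2" assume x: "norm x + h x = 2"
    obtain t where t: "0 \<le> t" "t \<le> 2 * pi" "x = norm x *\<^sub>R unit_at t" using polar_real2 by blast
    have "h x = norm x * H t" unfolding H_def using h_scale[of "norm x" "unit_at t"] t(3) by simp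
    then have "norm x * (1 + H t) = 2" using x by (simp add: algebra_simps)
    then have "norm x = r t" using H[of t] by (simp add: r_def field_simps)
    then have "x = r t *\<^sub>R unit_at t" using t(3) by simp
    then show "x \<in> (\<lambda>t. r t *\<^sub>R unit_at t) ` {0..2*pi}" using t(1,2) by auto
  qed
  then have "hausdorff1_outer {x. norm x + h x = 2} \<le> hausdorff1_outer ((\<lambda>t. r t *\<^sub>R unit_at t) ` {0..2*pi})"
    by (rule hausdorff1_outer_mono)
  also have "\<dots> \<le> ennreal (4 * (2 * pi - 0))"
  proof (rule hausdorff1_outer_lipschitz_image_le)
    fix s t :: real
    have "r s *\<^sub>R unit_at s - r t *\<^sub>R unit_at t = (r s - r t) *\<^sub>R unit_at s + r t *\<^sub>R (unit_at s - unit_at t)"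
      by (simp add: algebra_simps)
    then have "dist (r s *\<^sub>R unit_at s) (r t *\<^sub>R unit_at t) \<le> norm ((r s - r t) *\<^sub>R unit_at s) + norm (r t *\<^sub>R (unit_at s - unit_at t))"
      unfolding dist_norm by (metis norm_triangle_ineq)
    also have "\<dots> = \<bar>r s - r t\<bar> + r t * norm (unit_at s - unit_at t)" using r(2)[of t] by simp
    also have "\<dots> \<le> 2 * \<bar>s - t\<bar> + 2 * \<bar>s - t\<bar>"
      using r by (intro add_mono mult_mono unit_at_lipschitz) auto
    finally show "dist (r s *\<^sub>R unit_at s) (r t *\<^sub>R unit_at t) \<le> 4 * \<bar>s - t\<bar>" by simp
  qed auto
  finally show ?thesis by simp
qed

text \<open>The jump set enters only through the Borel set \<open>U\<close> that encloses it: the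
  integrand is bounded by a constant on \<open>U\<close> before anything is evaluated.\<close>

lemma line_energy_field_finite:
  assumes p: "0 \<le> p" and C: "C \<in> sets borel" "hausdorff1_outer C < \<infinity>"
    and ties: "{x \<in> domain. \<not> no_tie x \<and> 2 < norm x + h x} \<subseteq> C"
  shows "line_energy (\<lambda>t. ennreal (t powr p)) domain field < \<infinity>"
proof -
  define D where "D = {x. norm x + h x = 2}"
  define U where "U = {0} \<union> (D \<union> C)"
  have Ds: "D \<in> sets borel" unfolding D_def by (intro borel_closed closed_Collect_eq continuous_intros continuous_h)
  then have Us: "U \<in> sets hausdorff1" using C by (simp add: U_def)
  have "emeasure hausdorff1 U \<le> emeasure hausdorff1 {0} + emeasure hausdorff1 (D \<union> C)"
    unfolding U_def by (rule emeasure_subadditive) (use Ds C in auto)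
  also have "\<dots> \<le> emeasure hausdorff1 {0} + (emeasure hausdorff1 D + emeasure hausdorff1 C)"
    by (intro add_mono order_refl emeasure_subadditive) (use Ds C in auto)
  also have "\<dots> < \<infinity>"
  proof -
    have "emeasure hausdorff1 {0} = 0" using hausdorff1_outer_countable[of "{0}"] by (simp add: emeasure_hausdorff1)
    moreover have "emeasure hausdorff1 D < \<infinity>"
      using hausdorff1_outer_curve Ds by (auto simp: emeasure_hausdorff1 D_def intro: order_le_less_trans)
    ultimately show ?thesis using C by (simp add: emeasure_hausdorff1)
  qed
  finally have fin: "emeasure hausdorff1 U < \<infinity>" .
  have "line_energy (\<lambda>t. ennreal (t powr p)) domain field \<le> (\<integral>\<^sup>+x. ennreal (2 powr p) * indicator U x \<partial>hausdorff1)"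
    unfolding line_energy_def
  proof (rule nn_integral_mono)
    fix x
    show "ennreal (jump_size field x powr p) * indicator (jump_set domain field) x \<le> ennreal (2 powr p) * indicator U x"
    proof (cases "x \<in> jump_set domain field")
      case True
      then have "x \<in> U" using jump_set_field ties by (auto simp: U_def D_def)
      moreover have "jump_size field x powr p \<le> 2 powr p"
        using jump_size_field_le[OF True] p by (intro powr_mono2) auto
      ultimately show ?thesis using True by (simp add: ennreal_leI)
    qed simp
  qed
  also have "\<dots> = ennreal (2 powr p) * emeasure hausdorff1 U"
    using Us by (simp add: nn_integral_cmult_indicator)
  also have "\<dots> < \<infinity>" using fin by (simp add: ennreal_mult_less_top)
  finally show ?thesis .
qed

section \<open>Jumps of the viscosity solution across a tie of two normals\<close>

lemma viscosity_solution_locally_linear: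
  assumes y: "y \<in> domain" and d: "d > 0" and lin: "\<And>z. z \<in> ball y d \<Longrightarrow> h z = z \<bullet> n"
  shows "viscosity_solution domain y = perp (- n)"
proof -
  have "((\<lambda>z. infdist z (frontier domain)) has_derivative (\<lambda>v. - (v \<bullet> n))) (at y)"
  proof (rule has_derivative_transform_within_open)
    show "((\<lambda>z. 1 - z \<bullet> n) has_derivative (\<lambda>v. - (v \<bullet> n))) (at y)"
      by (auto intro!: derivative_eq_intros)
    show "open (domain \<inter> ball y d)" using open_domain by auto
    show "y \<in> domain \<inter> ball y d" using y d by simp
    show "1 - z \<bullet> n = infdist z (frontier domain)" if "z \<in> domain \<inter> ball y d" for z
      using that lin[of z] by (simp add: infdist_frontier)
  qed
  then have "frechet_derivative (\<lambda>z. infdist z (frontier domain)) (at y) = (\<lambda>v. - (v \<bullet> n))"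
    by (rule frechet_derivative_at[symmetric])
  then show ?thesis
    by (simp add: viscosity_solution_def gradient_def partial_deriv_def inner_axis' vec_eq_iff forall_2)
qed

text \<open>The margin \<open>\<delta>\<close> leaves only \<open>p\<close> and \<open>q\<close> in
  competition near \<open>x\<close>. The sign of \<open>(y - x) \<bullet> (p - q)\<close> decides
  which of them is active, so the field is constant on each side of the line of ties.\<close>

lemma viscosity_solution_jump:
  assumes x: "x \<in> domain" and pq: "p \<in> range \<nu>" "q \<in> range \<nu>" "p \<noteq> q" "x \<bullet> p = h x" "x \<bullet> q = h x"
    and \<delta>: "\<delta> > 0" and rest: "\<And>i. \<nu> i = p \<or> \<nu> i = q \<or> x \<bullet> \<nu> i \<le> h x - \<delta>"
  shows "x \<in> jump_set domain (viscosity_solution domain)"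
    and "jump_size (viscosity_solution domain) x = norm (p - q)"
proof -
  let ?m = "viscosity_solution domain"
  obtain d0 where d0: "d0 > 0" "ball x d0 \<subseteq> domain" using open_domain x open_contains_ball by blast
  \<comment> \<open>Within \<open>\<delta> / 2\<close> of \<open>x\<close>, both \<open>h\<close>
    and each inner product change by less than half the margin.\<close>
  define d where "d = min d0 (\<delta> / 2)"
  have d: "d > 0" "d \<le> d0" "2 * d \<le> \<delta>" using d0 \<delta> by (auto simp: d_def)
  have act: "sel y = p \<or> sel y = q" if y: "y \<in> ball x d" for y
  proof (rule ccontr)
    assume "\<not> ?thesis"
    moreover obtain i where "sel y = \<nu> i" using sel_range[of y] by blast
    ultimately have "x \<bullet> sel y \<le> h x - \<delta>" using rest[of i] by auto
    moreover have "(y - x) \<bullet> sel y \<le> norm (y - x)" using Cauchy_Schwarz_ineq2[of "y - x" "sel y"] by simp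
    ultimately have "h y \<le> h x - \<delta> + norm (y - x)" using sel_inner[of y] by (simp add: inner_diff_left)
    then show False using y h_lipschitz[of y x] d by (simp add: dist_norm norm_minus_commute)
  qed
  have one: "?m y = perp (- n)"
    if y: "y \<in> ball x d" and n: "n \<in> {p, q}" and n': "n' \<in> {p, q}" "n \<noteq> n'" "y \<bullet> n' < y \<bullet> n" for y n n'
  proof -
    have "open (ball x d \<inter> {z. z \<bullet> n' < z \<bullet> n})"
      by (intro open_Int open_ball open_Collect_less continuous_intros)
    then obtain e where e: "e > 0" "ball y e \<subseteq> ball x d \<inter> {z. z \<bullet> n' < z \<bullet> n}"
      using y n' open_contains_ball by (metis (mono_tags, lifting) IntI mem_Collect_eq)
    have "h z = z \<bullet> n" if z: "z \<in> ball y e" for z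
    proof -
      have z: "z \<in> ball x d" "z \<bullet> n' < z \<bullet> n" using e z by auto
      have "n \<in> range \<nu>" using n pq by auto
      then have "sel z \<noteq> n'" using z(2) h_ge_range[of n z] sel_inner[of z] by auto
      then have "sel z = n" using act[OF z(1)] n n' by auto
      then show ?thesis using sel_inner[of z] by simp
    qed
    moreover have "y \<in> domain" using y d0 d by auto
    ultimately show ?thesis using viscosity_solution_locally_linear[OF _ e(1)] by blast
  qed
  define w where "w = norm (p - q)"
  have w: "w > 0" using pq by (simp add: w_def)
  define n where "n = (p - q) /\<^sub>R w"
  have norm_n: "norm n = 1" using w by (simp add: n_def w_def)
  have side: "(y - x) \<bullet> n > 0 \<longleftrightarrow> y \<bullet> q < y \<bullet> p" "(y - x) \<bullet> (- n) > 0 \<longleftrightarrow> y \<bullet> p < y \<bullet> q" for y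
    using w pq by (simp_all add: n_def inner_diff_left inner_diff_right zero_less_divide_iff divide_simps)
  have val: "?m y = perp (- p)" if "y \<in> half_plane x n \<inter> ball x d" for y
    using one[of y p q] that pq side(1)[of y] by (auto simp: half_plane_def)
  have val': "?m y = perp (- q)" if "y \<in> half_plane x (- n) \<inter> ball x d" for y
    using one[of y q p] that pq side(2)[of y] by (auto simp: half_plane_def)
  have ne: "perp (- p) \<noteq> perp (- q)"
    using pq(3) by (auto simp: vec_eq_iff forall_2)
  have j: "jump_triple ?m x (perp (- p)) (perp (- q)) n"
    unfolding jump_triple_iff
  proof (intro conjI norm_n ne approx_limitI half_plane_measurable)
    show "\<exists>d>0. \<forall>y\<in>half_plane x n \<inter> ball x d. norm (?m y - perp (- p)) \<le> e" if "e > 0" for e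
      using that val d(1) by (intro exI[of _ d]) auto
    show "\<exists>d>0. \<forall>y\<in>half_plane x (- n) \<inter> ball x d. norm (?m y - perp (- q)) \<le> e" if "e > 0" for e
      using that val' d(1) by (intro exI[of _ d]) auto
  qed
  then show "x \<in> jump_set domain ?m" using x by (auto simp: jump_set_def)
  \<comment> \<open>A Borel field that agrees with the viscosity solution near \<open>x\<close> off
    the line of ties; it supplies the integrability that \<open>jump_size_eq\<close> asks
    for.\<close>
  define m1 where "m1 y = (if y \<bullet> q < y \<bullet> p then perp (- p) else perp (- q))" for y
  have [measurable]: "m1 \<in> borel_measurable borel" unfolding m1_def[abs_def] by measurable
  have i1: "set_integrable lebesgue (ball x d) m1"
    using pq unit by (intro bounded_borel_set_integrable[of _ 1]) (auto simp: m1_def)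
  define N where "N = {y. (p - q) \<bullet> y = 0}"
  have negl: "negligible N" unfolding N_def using pq by (intro negligible_hyperplane) auto
  have eq: "?m y = m1 y" if y: "y \<in> ball x d" "y \<notin> N" for y
  proof -
    have "y \<bullet> p \<noteq> y \<bullet> q" using y(2) by (simp add: N_def inner_diff_left inner_commute[of y])
    then show ?thesis using one[of y p q] one[of y q p] y pq by (auto simp: m1_def)
  qed
  have "set_integrable lebesgue (ball x d) ?m"
    unfolding set_integrable_def
  proof (rule integrable_cong_AE_imp)
    show "integrable lebesgue (\<lambda>y. indicat_real (ball x d) y *\<^sub>R m1 y)" using i1 by (simp add: set_integrable_def)
    have ae: "\<forall>y. y \<notin> N \<longrightarrow> indicat_real (ball x d) y *\<^sub>R m1 y = indicat_real (ball x d) y *\<^sub>R ?m y"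
    proof (intro allI impI)
      fix y assume "y \<notin> N"
      then show "indicat_real (ball x d) y *\<^sub>R m1 y = indicat_real (ball x d) y *\<^sub>R ?m y"
        using eq[of y] by (cases "y \<in> ball x d") (simp_all only: indicator_simps scaleR_zero_left simp_thms)
    qed
    show "AE y in lebesgue. indicat_real (ball x d) y *\<^sub>R m1 y = indicat_real (ball x d) y *\<^sub>R ?m y"
      using negl ae by (intro AE_I'[of N]) (auto simp: negligible_iff_null_sets)
    show "(\<lambda>y. indicat_real (ball x d) y *\<^sub>R ?m y) \<in> borel_measurable lebesgue"
    proof (rule lebesgue_measurable_off_negligible[OF _ negl])
      show "(\<lambda>y. indicat_real (ball x d) y *\<^sub>R m1 y) \<in> borel_measurable lebesgue"
        using i1 unfolding set_integrable_def by (rule borel_measurable_integrable)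
      show "indicat_real (ball x d) y *\<^sub>R ?m y = indicat_real (ball x d) y *\<^sub>R m1 y" if "y \<notin> N" for y
        by (rule ae[rule_format, OF that, symmetric])
    qed
  qed
  then have "jump_size ?m x = norm (perp (- p) - perp (- q))" using d(1) j by (rule jump_size_eq)
  also have "perp (- p) - perp (- q) = perp (- (p - q))" by (simp add: vec_eq_iff forall_2)
  finally show "jump_size ?m x = norm (p - q)" by (simp only: norm_perp norm_minus_cancel)
qed

end

section \<open>A polygon with infinitely many corners\<close>

text \<open>The angles descend from \<open>pi / 2\<close> at \<open>k = 0\<close> towards 0; the
  shift by 2 keeps the logarithm positive.\<close>

definition theta :: "nat \<Rightarrow> real" where
  "theta k = pi / 2 * (ln 2 / ln (real k + 2))"

text \<open>Angle 0 is the limit of \<open>theta\<close> and closes the set of normals;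
  \<open>pi\<close> and \<open>- (pi / 2)\<close> are the left and downward directions. As
  \<open>theta 0\<close> points upwards, all four axis directions occur and the domain lies in a
  square.\<close>

definition normal_angle :: "nat \<Rightarrow> real" where
  "normal_angle i = (if i = 0 then 0 else if i = 1 then pi else if i = 2 then - (pi / 2) else theta (i - 3))"

definition normal_vec :: "nat \<Rightarrow> real^2" where
  "normal_vec i = unit_at (normal_angle i)"

definition angle_gap :: "nat \<Rightarrow> real" where
  "angle_gap k = theta k - theta (Suc k)"

definition mid_angle :: "nat \<Rightarrow> real" where
  "mid_angle k = (theta k + theta (Suc k)) / 2"

lemma theta_0: "theta 0 = pi / 2"
  by (simp add: theta_def)

lemma theta_pos: "0 < theta k"
  by (simp add: theta_def)

lemma theta_less: "k < l \<Longrightarrow> theta l < theta k"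
proof -
  assume "k < l"
  then have "ln (real k + 2) < ln (real l + 2)" "0 < ln (real k + 2)" by auto
  then have "ln 2 / ln (real l + 2) < ln 2 / ln (real k + 2)"
    by (intro divide_strict_left_mono mult_pos_pos) auto
  then show ?thesis unfolding theta_def by (intro mult_strict_left_mono) auto
qed

lemma theta_le: "k \<le> l \<Longrightarrow> theta l \<le> theta k"
  using theta_less[of k l] by (cases "k = l") auto

lemma theta_le_pi_half: "theta k \<le> pi / 2"
  using theta_le[of 0 k] by (simp add: theta_0)

lemma theta_tendsto: "theta \<longlonglongrightarrow> 0"
  unfolding theta_def[abs_def] by real_asymp

lemma angle_gap_bounds: "0 < angle_gap k" "angle_gap k \<le> pi / 2"
  using theta_less[of k "Suc k"] theta_pos[of "Suc k"] theta_le_pi_half[of k] by (auto simp: angle_gap_def)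

lemma mid_angle_eq: "mid_angle k = theta k - angle_gap k / 2" "mid_angle k = theta (Suc k) + angle_gap k / 2"
  by (simp_all add: mid_angle_def angle_gap_def field_simps)

lemma mid_angle_bounds: "0 < mid_angle k" "mid_angle k \<le> pi / 2"
  using mid_angle_eq[of k] theta_pos[of "Suc k"] angle_gap_bounds[of k] theta_le_pi_half[of k] by linarith+

lemma mid_angle_less: "k < l \<Longrightarrow> mid_angle l < mid_angle k"
  using theta_less[of k l] theta_less[of "Suc k" "Suc l"] by (simp add: mid_angle_def)

lemma unit_at_add: "unit_at a + unit_at b = (2 * cos ((a - b) / 2)) *\<^sub>R unit_at ((a + b) / 2)"
  by (simp add: vec_eq_iff forall_2 cos_plus_cos sin_plus_sin mult_ac)

lemma inner_unit_at: "x \<bullet> unit_at a = x $ 1 * cos a + x $ 2 * sin a"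
  by (simp add: inner_vec_def sum_2)

lemma normal_vec_simps:
  "normal_vec 0 = unit_at 0" "normal_vec 1 = unit_at pi" "normal_vec 2 = unit_at (- (pi / 2))" "normal_vec (k + 3) = unit_at (theta k)"
  by (simp_all add: normal_vec_def normal_angle_def)

lemma nat_cases3:
  fixes i :: nat
  obtains "i = 0" | "i = 1" | "i = 2" | k where "i = k + 3"
proof (cases "i < 3")
  case True
  then have "i = 0 \<or> i = 1 \<or> i = 2" by auto
  then show ?thesis using that(1-3) by blast
next
  case False
  then have "i = (i - 3) + 3" by simp
  then show ?thesis by (rule that(4))
qed

lemma compact_range_normal_vec: "compact (range normal_vec)"
proof -
  have "range normal_vec = insert (unit_at 0) (range (\<lambda>k. unit_at (theta k))) \<union> {unit_at pi, unit_at (- (pi / 2))}" (is "_ = ?R")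
  proof
    show "range normal_vec \<subseteq> ?R"
    proof (rule image_subsetI)
      fix i :: nat
      show "normal_vec i \<in> ?R" by (cases i rule: nat_cases3) (auto simp: normal_vec_simps normal_vec_simps(2)[unfolded One_nat_def])
    qed
    show "?R \<subseteq> range normal_vec"
      using normal_vec_simps rangeI[of normal_vec] by (auto simp flip: normal_vec_simps)
  qed
  moreover have "(\<lambda>k. unit_at (theta k)) \<longlonglongrightarrow> unit_at 0"
  proof (rule Lim_null[THEN iffD2], rule Lim_null_comparison[OF _ theta_tendsto], rule always_eventually, rule allI)
    show "norm (unit_at (theta k) - unit_at 0) \<le> theta k" for k
      using unit_at_lipschitz[of "theta k" 0] theta_pos[of k] by simp
  qed
  ultimately show ?thesis using compact_sequence_with_limit by (metis compact_Un finite.emptyI finite.insertI finite_imp_compact)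
qed

text \<open>The largest of the four axis inner products is at least half of the l1 norm, hence of
  \<open>norm x\<close>; this is the constant 1/2.\<close>

interpretation circ: circumscribed normal_vec "1/2"
proof
  show "norm (normal_vec i) = 1" for i by (simp add: normal_vec_def)
  show "compact (range normal_vec)" by (rule compact_range_normal_vec)
  show "\<exists>i. 1/2 * norm x \<le> x \<bullet> normal_vec i" for x :: "real^2"
  proof -
    have "norm x \<le> \<bar>x $ 1\<bar> + \<bar>x $ 2\<bar>" using norm_le_l1_cart[of x] by (simp add: sum_2)
    then consider "norm x / 2 \<le> x $ 1" | "norm x / 2 \<le> - x $ 1" | "norm x / 2 \<le> x $ 2" | "norm x / 2 \<le> - x $ 2"
      by linarith
    then show ?thesis
    proof cases
      case 1 then show ?thesis by (intro exI[of _ 0]) (simp add: normal_vec_simps inner_unit_at)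
    next
      case 2 then show ?thesis by (intro exI[of _ 1]) (simp add: normal_vec_simps(2)[unfolded One_nat_def] inner_unit_at)
    next
      case 3 then show ?thesis by (intro exI[of _ "0+3"]) (simp only: normal_vec_simps(4) theta_0 inner_unit_at, simp)
    next
      case 4 then show ?thesis by (intro exI[of _ 2]) (simp add: normal_vec_simps inner_unit_at)
    qed
  qed
qed simp

lemma h_ge_coordinates:
  "x $ 1 \<le> circ.h x" "- x $ 1 \<le> circ.h x" "x $ 2 \<le> circ.h x" "- x $ 2 \<le> circ.h x"
  using circ.h_ge[of x 0] circ.h_ge[of x 1] circ.h_ge[of x "0+3"] circ.h_ge[of x 2]
  unfolding normal_vec_simps theta_0 inner_unit_at by simp_all

section \<open>Classification of the ties\<close>

definition upper_angles :: "real set" where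
  "upper_angles = insert 0 (range theta)"

lemma upper_angles_bounds: "a \<in> upper_angles \<Longrightarrow> 0 \<le> a \<and> a \<le> pi / 2"
  using theta_pos theta_le_pi_half by (auto simp: upper_angles_def intro: less_imp_le)

lemma upper_angles_le_h: "a \<in> upper_angles \<Longrightarrow> x \<bullet> unit_at a \<le> circ.h x"
  using circ.h_ge[of x 0] circ.h_ge[of x "_ + 3"] by (auto simp: upper_angles_def normal_vec_simps)

text \<open>A tie lies on the bisector of its two normals, and a normal strictly between them would
  have a larger inner product. So the two angles are neighbours; the limit angle 0 has none, which
  leaves consecutive values of \<open>theta\<close>.\<close>

lemma upper_tie:
  assumes x: "x \<noteq> 0" and ab: "a \<in> upper_angles" "b \<in> upper_angles" "a < b"
    and tie: "x \<bullet> unit_at a = circ.h x" "x \<bullet> unit_at b = circ.h x"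
  shows "\<exists>k s. 0 < s \<and> x = s *\<^sub>R unit_at (mid_angle k) \<and> circ.h x = s * cos (angle_gap k / 2)"
proof -
  note bd = upper_angles_bounds[OF ab(1)] upper_angles_bounds[OF ab(2)]
  define m where "m = (a + b) / 2"
  define d where "d = (b - a) / 2"
  have d: "0 < d" "d < pi / 2" using ab bd pi_gt_zero by (auto simp: d_def)
  have am: "m - a = d" "b - m = d" by (simp_all add: m_def d_def field_simps)
  have hp: "0 < circ.h x" by (rule circ.h_pos[OF x])
  have "cos (b - a) < cos 0" using ab bd by (intro cos_monotone_0_pi) auto
  then have ne: "unit_at a \<noteq> unit_at b" using unit_at_inner[of b a] unit_at_inner[of a a] by auto
  define t where "t = circ.h x / (1 + unit_at a \<bullet> unit_at b)"
  have t: "0 < t" "x = t *\<^sub>R (unit_at a + unit_at b)"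
    using tie_direction[of "unit_at a" "unit_at b" x] ne tie hp by (simp_all add: t_def)
  define s where "s = t * (2 * cos d)"
  have cd: "cos ((a - b) / 2) = cos d" unfolding d_def by (metis cos_minus minus_diff_eq minus_divide_left)
  have s: "0 < s" using t d by (simp add: s_def cos_gt_zero)
  have xs: "x = s *\<^sub>R unit_at m" using t(2) unfolding unit_at_add cd by (simp add: s_def m_def)
  have xg: "x \<bullet> unit_at g = s * cos (m - g)" for g unfolding xs by (simp add: unit_at_inner)
  have hx: "circ.h x = s * cos d" using tie(1) xg[of a] am by simp
  have nogap: "\<not> (a < g \<and> g < b)" if g: "g \<in> upper_angles" for g
  proof
    assume "a < g \<and> g < b"
    then have "\<bar>m - g\<bar> < d" using am by linarith
    then have "cos d < cos \<bar>m - g\<bar>" using d by (intro cos_monotone_0_pi) auto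
    then have "s * cos d < s * cos (m - g)" using s by simp
    then show False using upper_angles_le_h[OF g, of x] xg[of g] hx by simp
  qed
  \<comment> \<open>\<open>a < b\<close> with \<open>a\<close> nonnegative excludes the limit angle
    for \<open>b\<close>.\<close>
  obtain k where k: "b = theta k" using ab bd by (auto simp: upper_angles_def)
  have "theta (Suc k) \<le> a"
    using nogap[of "theta (Suc k)"] theta_less[of k "Suc k"] k by (auto simp: upper_angles_def)
  then obtain l where l: "a = theta l" using ab(1) theta_pos[of "Suc k"] by (auto simp: upper_angles_def)
  have "k < l" using ab(3) k l theta_le[of l k] by (metis linorder_not_less)
  then have "a \<le> theta (Suc k)" using l theta_le[of "Suc k" l] by simp
  then have a: "a = theta (Suc k)" using \<open>theta (Suc k) \<le> a\<close> by simp
  have "m = mid_angle k" "d = angle_gap k / 2" by (simp_all add: m_def d_def mid_angle_def angle_gap_def k a)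
  then show ?thesis using s xs hx by blast
qed

text \<open>The bound on \<open>x $ 2\<close> forces \<open>cos a = 0\<close>: only the upward
  normal can tie with the left one, and that happens on a diagonal.\<close>

lemma tie_left:
  assumes "0 < H" "- x $ 1 = H" "x $ 2 \<le> H" "a \<in> upper_angles" "x \<bullet> unit_at a = H"
  shows "\<bar>x $ 1\<bar> = \<bar>x $ 2\<bar>"
proof -
  have c: "0 \<le> cos a" "0 \<le> sin a" using upper_angles_bounds[OF assms(4)] pi_gt_zero
    by (auto intro!: cos_ge_zero sin_ge_zero)
  have "x $ 1 = - H" using assms(2) by simp
  then have e: "H * (1 + cos a) = x $ 2 * sin a" using assms(5) by (simp add: inner_unit_at algebra_simps)
  also have "\<dots> \<le> H * sin a" using assms c by (intro mult_right_mono) auto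
  also have "\<dots> \<le> H * 1" using assms by (intro mult_left_mono) auto
  finally have "H * cos a \<le> 0" by (simp add: algebra_simps)
  then have "cos a = 0" using assms(1) c by (simp add: mult_le_0_iff)
  then have "sin a = 1" using c sin_cos_squared_add[of a] by (simp add: power2_eq_1_iff)
  then show ?thesis using e \<open>cos a = 0\<close> assms by simp
qed

text \<open>The mirror image of \<open>tie_left\<close>: here only the limit normal, at angle 0, can
  tie.\<close>

lemma tie_below:
  assumes "0 < H" "- x $ 2 = H" "x $ 1 \<le> H" "a \<in> upper_angles" "x \<bullet> unit_at a = H"
  shows "\<bar>x $ 1\<bar> = \<bar>x $ 2\<bar>"
proof -
  have c: "0 \<le> cos a" "0 \<le> sin a" using upper_angles_bounds[OF assms(4)] pi_gt_zero
    by (auto intro!: cos_ge_zero sin_ge_zero)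
  have "x $ 2 = - H" using assms(2) by simp
  then have e: "H * (1 + sin a) = x $ 1 * cos a" using assms(5) by (simp add: inner_unit_at algebra_simps)
  also have "\<dots> \<le> H * cos a" using assms c by (intro mult_right_mono) auto
  also have "\<dots> \<le> H * 1" using assms by (intro mult_left_mono) auto
  finally have "H * sin a \<le> 0" by (simp add: algebra_simps)
  then have "sin a = 0" using assms(1) c by (simp add: mult_le_0_iff)
  then have "cos a = 1" using c sin_cos_squared_add[of a] by (simp add: power2_eq_1_iff)
  then show ?thesis using e \<open>sin a = 0\<close> assms by simp
qed

text \<open>The two diagonals carry every tie that involves the left or the downward normal, so all
  but finitely many walls come from consecutive angles.\<close>

lemma tie_cases:
  assumes x: "x \<noteq> 0" and tie: "\<not> circ.no_tie x"
  shows "\<bar>x $ 1\<bar> = \<bar>x $ 2\<bar> \<or>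
    (\<exists>k s. 0 < s \<and> x = s *\<^sub>R unit_at (mid_angle k) \<and> circ.h x = s * cos (angle_gap k / 2))"
proof -
  have hp: "0 < circ.h x" by (rule circ.h_pos[OF x])
  obtain i j where ij: "x \<bullet> normal_vec i = circ.h x" "x \<bullet> normal_vec j = circ.h x" "normal_vec i \<noteq> normal_vec j"
    using tie by (auto simp: circ.no_tie_def)
  have n: "- x $ 1 = circ.h x \<and> n = normal_vec 1 \<or> - x $ 2 = circ.h x \<and> n = normal_vec 2 \<or>
      (\<exists>a\<in>upper_angles. n = unit_at a \<and> x \<bullet> unit_at a = circ.h x)"
    if "x \<bullet> n = circ.h x" "n = normal_vec i" for n i
  proof (cases i rule: nat_cases3)
    case 1 then show ?thesis using that by (auto simp: normal_vec_simps upper_angles_def)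
  next
    case 2 then show ?thesis using that by (auto simp: normal_vec_simps(2)[unfolded One_nat_def] inner_unit_at)
  next
    case 3 then show ?thesis using that by (auto simp: normal_vec_simps inner_unit_at)
  next
    case (4 k) then show ?thesis using that by (auto simp: normal_vec_simps upper_angles_def)
  qed
  note c = h_ge_coordinates[of x]
  have left: ?thesis if "- x $ 1 = circ.h x" "x \<bullet> unit_at a = circ.h x" "a \<in> upper_angles" for a
    using tie_left[OF hp that(1) c(3) that(3,2)] by blast
  have below: ?thesis if "- x $ 2 = circ.h x" "x \<bullet> unit_at a = circ.h x" "a \<in> upper_angles" for a
    using tie_below[OF hp that(1) c(1) that(3,2)] by blast
  have both: ?thesis if "- x $ 2 = circ.h x" "- x $ 1 = circ.h x"
  proof -
    have "x $ 1 = x $ 2" using that by linarith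
    then show ?thesis by simp
  qed
  have upper: ?thesis if "x \<bullet> unit_at a = circ.h x" "x \<bullet> unit_at b = circ.h x" "a \<in> upper_angles" "b \<in> upper_angles"
      "unit_at a \<noteq> unit_at b" for a b
  proof -
    have "a < b \<or> b < a" using that(5) by (metis linorder_neqE)
    then show ?thesis using upper_tie[OF x that(3,4) _ that(1,2)] upper_tie[OF x that(4,3) _ that(2,1)] by blast
  qed
  from n[OF ij(1) refl] show ?thesis
  proof (elim disjE conjE bexE)
    assume i: "- x $ 1 = circ.h x" "normal_vec i = normal_vec 1"
    from n[OF ij(2) refl] show ?thesis
    proof (elim disjE conjE bexE)
      assume "normal_vec j = normal_vec 1" then show ?thesis using i ij(3) by simp
    next
      assume "- x $ 2 = circ.h x" then show ?thesis using i by (intro both)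
    next
      fix b assume "b \<in> upper_angles" "x \<bullet> unit_at b = circ.h x" then show ?thesis using i by (intro left)
    qed
  next
    assume i: "- x $ 2 = circ.h x" "normal_vec i = normal_vec 2"
    from n[OF ij(2) refl] show ?thesis
    proof (elim disjE conjE bexE)
      assume "- x $ 1 = circ.h x" then show ?thesis using i by (intro both)
    next
      assume "normal_vec j = normal_vec 2" then show ?thesis using i ij(3) by simp
    next
      fix b assume "b \<in> upper_angles" "x \<bullet> unit_at b = circ.h x" then show ?thesis using i by (intro below)
    qed
  next
    fix a assume i: "a \<in> upper_angles" "normal_vec i = unit_at a" "x \<bullet> unit_at a = circ.h x"
    from n[OF ij(2) refl] show ?thesis
    proof (elim disjE conjE bexE)
      assume "- x $ 1 = circ.h x" then show ?thesis using i by (intro left)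
    next
      assume "- x $ 2 = circ.h x" then show ?thesis using i by (intro below)
    next
      fix b assume "b \<in> upper_angles" "normal_vec j = unit_at b" "x \<bullet> unit_at b = circ.h x"
      then show ?thesis using i ij(3) by (intro upper[of a b]) auto
    qed
  qed
qed

section \<open>Finite energy of the competitor\<close>

definition wall :: "nat \<Rightarrow> real \<Rightarrow> real \<Rightarrow> (real^2) set" where
  "wall k a b = (\<lambda>s. s *\<^sub>R unit_at (mid_angle k)) ` {a..b}"

lemma segment_measure_le:
  assumes "a \<le> b"
  shows "hausdorff1_outer ((\<lambda>s. s *\<^sub>R v) ` {a..b}) \<le> ennreal (norm v * (b - a))"
proof (rule hausdorff1_outer_lipschitz_image_le[OF assms norm_ge_zero])
  show "dist (s *\<^sub>R v) (t *\<^sub>R v) \<le> norm v * \<bar>s - t\<bar>" for s t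
    by (simp add: dist_norm scaleR_diff_left[symmetric] mult.commute)
qed

lemma segment_borel: "(\<lambda>s. s *\<^sub>R (v::real^2)) ` {a..b} \<in> sets borel"
  by (intro borel_closed compact_imp_closed compact_continuous_image continuous_intros) auto

text \<open>With \<open>c = cos (g / 2)\<close>, a tie at distance \<open>s\<close> from the origin
  has \<open>h = s * c\<close>; it lies in the domain for \<open>s < 1 / c\<close> and beyond the
  curve for \<open>s > 2 / (1 + c)\<close>. The length in between is quadratic in \<open>g\<close>,
  but a linear bound suffices for a telescoping sum.\<close>

lemma wall_length:
  assumes "0 < g" "g \<le> pi / 2"
  shows "0 < cos (g / 2)" "2 / (1 + cos (g / 2)) \<le> 1 / cos (g / 2)" "1 / cos (g / 2) - 2 / (1 + cos (g / 2)) \<le> g"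
proof -
  define c where "c = cos (g / 2)"
  have "cos (pi / 3) \<le> cos (g / 2)" using assms pi_gt_zero by (intro cos_monotone_0_pi_le) auto
  then have c: "1/2 \<le> c" "c \<le> 1" by (simp_all add: c_def cos_60)
  have eq: "1 / c - 2 / (1 + c) = (1 - c) / (c * (1 + c))" using c by (simp add: field_simps)
  have "0 \<le> (1 - c) / (c * (1 + c))" using c by simp
  then have "2 / (1 + c) \<le> 1 / c" using eq by linarith
  then show "2 / (1 + cos (g / 2)) \<le> 1 / cos (g / 2)" by (simp only: c_def)
  show "0 < cos (g / 2)" using c by (simp add: c_def)
  have "1/2 * 1 \<le> c * (1 + c)" using c by (intro mult_mono) auto
  then have "(1 - c) / (c * (1 + c)) \<le> (1 - c) / (1/2)" using c by (intro divide_left_mono) auto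
  also have "\<dots> = 4 * (sin (g / 4))\<^sup>2"
    using cos_double_sin[of "g / 4"] by (simp add: c_def)
  also have "\<dots> \<le> 4 * (g / 4)\<^sup>2"
    using abs_sin_x_le_abs_x[of "g / 4"] by (intro mult_left_mono) (auto simp: abs_le_square_iff[symmetric])
  also have "\<dots> = g * (g / 4)" by (simp add: power2_eq_square)
  also have "\<dots> \<le> g * 1" using assms pi_less_4 by (intro mult_left_mono) auto
  finally show "1 / cos (g / 2) - 2 / (1 + cos (g / 2)) \<le> g" using eq by (simp add: c_def)
qed

text \<open>The gaps telescope to \<open>theta 0\<close>, so the remaining wall pieces have finite
  total length; the two diagonals are confined to a square.\<close>

lemma competitor_energy_finite:
  assumes "0 \<le> p"
  shows "line_energy (\<lambda>t. ennreal (t powr p)) circ.domain circ.field < \<infinity>"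
proof -
  define W where "W k = wall k (2 / (1 + cos (angle_gap k / 2))) (1 / cos (angle_gap k / 2))" for k
  define D :: "bool \<Rightarrow> (real^2) set" where "D e = (\<lambda>s. s *\<^sub>R vector [1, if e then 1 else - 1]) ` {-1..1}" for e
  define C where "C = (D True \<union> D False) \<union> (\<Union>k. W k)"
  have Wb: "W k \<in> sets hausdorff1" for k unfolding W_def wall_def using segment_borel by simp
  have Db: "D e \<in> sets hausdorff1" for e unfolding D_def using segment_borel by simp
  have Cb: "C \<in> sets borel" using Wb Db by (auto simp: C_def)
  have W1: "emeasure hausdorff1 (W k) \<le> ennreal (angle_gap k)" for k
  proof -
    note w = wall_length[OF angle_gap_bounds[of k]]
    have "emeasure hausdorff1 (W k) = hausdorff1_outer (W k)" using Wb by (simp add: emeasure_hausdorff1)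
    also have "\<dots> \<le> ennreal (norm (unit_at (mid_angle k)) * (1 / cos (angle_gap k / 2) - 2 / (1 + cos (angle_gap k / 2))))"
      unfolding W_def wall_def by (rule segment_measure_le[OF w(2)])
    also have "\<dots> \<le> ennreal (angle_gap k)" using w(3) by (intro ennreal_leI) simp
    finally show ?thesis .
  qed
  have D1: "emeasure hausdorff1 (D e) < \<infinity>" for e
  proof -
    have "emeasure hausdorff1 (D e) = hausdorff1_outer (D e)" using Db by (simp add: emeasure_hausdorff1)
    also have "\<dots> \<le> ennreal (norm (vector [1, if e then 1 else - 1] :: real^2) * (1 - (- 1)))"
      unfolding D_def by (rule segment_measure_le) simp
    also have "\<dots> < \<infinity>" by simp
    finally show ?thesis .
  qed
  have "emeasure hausdorff1 (\<Union>k. W k) \<le> (\<Sum>k. emeasure hausdorff1 (W k))"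
    by (rule emeasure_subadditive_countably) (use Wb in auto)
  also have "\<dots> \<le> (\<Sum>k. ennreal (angle_gap k))" by (intro suminf_le W1) auto
  also have "\<dots> = ennreal (\<Sum>k. angle_gap k)"
    using telescope_sums'[OF theta_tendsto] angle_gap_bounds(1)
    by (intro suminf_ennreal2) (auto simp: angle_gap_def[abs_def] sums_iff intro: less_imp_le)
  also have "\<dots> < \<infinity>" by simp
  finally have W2: "emeasure hausdorff1 (\<Union>k. W k) < \<infinity>" .
  have "hausdorff1_outer C = emeasure hausdorff1 C" using Cb by (simp add: emeasure_hausdorff1)
  also have "\<dots> \<le> emeasure hausdorff1 (D True \<union> D False) + emeasure hausdorff1 (\<Union>k. W k)"
    unfolding C_def by (rule emeasure_subadditive) (use Wb Db in auto)
  also have "\<dots> \<le> (emeasure hausdorff1 (D True) + emeasure hausdorff1 (D False)) + emeasure hausdorff1 (\<Union>k. W k)"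
    by (intro add_mono order_refl emeasure_subadditive Db)
  also have "\<dots> < \<infinity>" using D1[of True] D1[of False] W2 by simp
  finally have Cf: "hausdorff1_outer C < \<infinity>" .
  have "{x \<in> circ.domain. \<not> circ.no_tie x \<and> 2 < norm x + circ.h x} \<subseteq> C"
  proof safe
    fix x assume x: "x \<in> circ.domain" "\<not> circ.no_tie x" "2 < norm x + circ.h x"
    have h1: "circ.h x < 1" using x(1) by (simp add: circ.domain_def)
    then have "x \<noteq> 0" using x(3) by auto
    from tie_cases[OF this x(2)] show "x \<in> C"
    proof (elim disjE exE conjE)
      assume eq: "\<bar>x $ 1\<bar> = \<bar>x $ 2\<bar>"
      have "x $ 1 \<in> {-1..1}" using h_ge_coordinates[of x] h1 by auto
      moreover have "x = x $ 1 *\<^sub>R vector [1, if x $ 1 = x $ 2 then 1 else - 1]"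
        using eq by (auto simp: vec_eq_iff forall_2)
      ultimately have "x \<in> D (x $ 1 = x $ 2)" unfolding D_def by (rule image_eqI[rotated])
      then show ?thesis unfolding C_def by (cases "x $ 1 = x $ 2") auto
    next
      fix k s assume s: "0 < s" "x = s *\<^sub>R unit_at (mid_angle k)" "circ.h x = s * cos (angle_gap k / 2)"
      note w = wall_length(1)[OF angle_gap_bounds[of k]]
      have "norm x = s" using s by simp
      then have "2 < s * (1 + cos (angle_gap k / 2))" using x(3) s(3) by (simp add: algebra_simps)
      then have "2 / (1 + cos (angle_gap k / 2)) \<le> s" using w by (simp add: divide_le_eq)
      moreover have "s \<le> 1 / cos (angle_gap k / 2)" using w h1 s(3) by (simp add: le_divide_eq)
      ultimately have "x \<in> W k" unfolding W_def wall_def using s(2) by auto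
      then show ?thesis by (auto simp: C_def)
    qed
  qed
  then show ?thesis by (rule circ.line_energy_field_finite[OF assms Cb Cf])
qed

section \<open>Infinite energy of the viscosity solution\<close>

text \<open>One margin must serve against infinitely many normals. By monotonicity of the cosine the
  closest rivals are \<open>theta (Suc (Suc k))\<close> below and \<open>theta (k - 1)\<close>
  above; the left and downward normals have inner product at most 0 with the bisector.\<close>

lemma other_normals:
  "\<exists>\<delta>>0. \<forall>i. normal_vec i = unit_at (theta k) \<or> normal_vec i = unit_at (theta (Suc k)) \<or>
     cos (mid_angle k - normal_angle i) \<le> cos (angle_gap k / 2) - \<delta>"
proof -
  define c where "c = cos (angle_gap k / 2)"
  define A where "A = cos (mid_angle k - theta (Suc (Suc k)))"
  \<comment> \<open>For \<open>k = 0\<close> no larger angle of the sequence exists; 0 is a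
    placeholder below \<open>c\<close>.\<close>
  define B where "B = (if k = 0 then 0 else cos (theta (k - 1) - mid_angle k))"
  have c0: "0 < c" unfolding c_def by (rule wall_length(1)[OF angle_gap_bounds])
  have A: "A < c" unfolding A_def c_def
    using mid_angle_eq[of k] theta_less[of "Suc k" "Suc (Suc k)"] angle_gap_bounds[of k] mid_angle_bounds[of k] theta_pos[of "Suc (Suc k)"]
    by (intro cos_monotone_0_pi) auto
  have B: "B < c"
  proof (cases "k = 0")
    case False
    then have "theta k < theta (k - 1)" by (intro theta_less) auto
    then have "cos (theta (k - 1) - mid_angle k) < c" unfolding c_def
      using mid_angle_eq[of k] angle_gap_bounds[of k] mid_angle_bounds[of k] theta_le_pi_half[of "k - 1"]
      by (intro cos_monotone_0_pi) auto
    then show ?thesis using False by (simp add: B_def)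
  qed (use c0 in \<open>simp add: B_def\<close>)
  define \<delta> where "\<delta> = min c (min (c - A) (c - B))"
  have \<delta>: "0 < \<delta>" "0 \<le> c - \<delta>" "A \<le> c - \<delta>" "B \<le> c - \<delta>" using c0 A B by (auto simp: \<delta>_def)
  have low: "cos (mid_angle k - g) \<le> A" if "0 \<le> g" "g \<le> theta (Suc (Suc k))" for g
    unfolding A_def using that mid_angle_eq[of k] theta_less[of "Suc k" "Suc (Suc k)"] angle_gap_bounds[of k] mid_angle_bounds[of k]
    by (intro cos_monotone_0_pi_le) auto
  have "normal_vec i = unit_at (theta k) \<or> normal_vec i = unit_at (theta (Suc k)) \<or> cos (mid_angle k - normal_angle i) \<le> c - \<delta>" for i
  proof (cases i rule: nat_cases3)
    case 1
    then show ?thesis using low[of 0] theta_pos[of "Suc (Suc k)"] \<delta> by (simp add: normal_angle_def)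
  next
    case 2
    have "0 \<le> cos (mid_angle k)" using mid_angle_bounds[of k] by (intro cos_ge_zero) auto
    then show ?thesis using 2 \<delta> by (simp add: normal_angle_def cos_diff)
  next
    case 3
    have "0 \<le> sin (mid_angle k)" using mid_angle_bounds[of k] pi_gt_zero by (intro sin_ge_zero) auto
    then show ?thesis using 3 \<delta> by (simp add: normal_angle_def cos_add)
  next
    case (4 l)
    have a: "normal_angle i = theta l" "normal_vec i = unit_at (theta l)" using 4 by (simp_all add: normal_angle_def normal_vec_simps)
    consider "l = k" | "l = Suc k" | "Suc (Suc k) \<le> l" | "l < k" by linarith
    then show ?thesis
    proof cases
      case 3
      then show ?thesis using low[of "theta l"] theta_le[of "Suc (Suc k)" l] theta_pos[of l] \<delta> a by simp
    next
      case 4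
      have "theta (k - 1) \<le> theta l" using 4 by (intro theta_le) auto
      moreover have "theta k < theta (k - 1)" using 4 by (intro theta_less) auto
      ultimately have "cos (theta l - mid_angle k) \<le> cos (theta (k - 1) - mid_angle k)"
        using mid_angle_eq[of k] angle_gap_bounds[of k] mid_angle_bounds[of k] theta_le_pi_half[of l]
        by (intro cos_monotone_0_pi_le) auto
      moreover have "cos (mid_angle k - theta l) = cos (theta l - mid_angle k)" by (metis cos_minus minus_diff_eq)
      ultimately show ?thesis using \<delta> 4 a by (simp add: B_def)
    qed (use a in auto)
  qed
  then show ?thesis using \<delta>(1) unfolding c_def by blast
qed

text \<open>Distances between 1/4 and 1/2 stay clear of the origin, where the margin
  \<open>s * \<delta>\<close> degenerates, and inside the domain for every \<open>k\<close>. The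
  jump is the chord between two unit vectors.\<close>

lemma viscosity_solution_wall:
  assumes x: "x \<in> wall k (1/4) (1/2)"
  shows "x \<in> jump_set circ.domain (viscosity_solution circ.domain)"
    and "jump_size (viscosity_solution circ.domain) x = 2 * sin (angle_gap k / 2)"
proof -
  obtain s where s: "1/4 \<le> s" "s \<le> 1/2" "x = s *\<^sub>R unit_at (mid_angle k)" using x by (auto simp: wall_def)
  obtain \<delta> where \<delta>: "\<delta> > 0" "\<And>i. normal_vec i = unit_at (theta k) \<or> normal_vec i = unit_at (theta (Suc k)) \<or>
     cos (mid_angle k - normal_angle i) \<le> cos (angle_gap k / 2) - \<delta>" using other_normals[of k] by blast
  have xi: "x \<bullet> normal_vec i = s * cos (mid_angle k - normal_angle i)" for i by (simp add: s(3) normal_vec_def unit_at_inner)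
  have xp: "x \<bullet> unit_at (theta k) = s * cos (angle_gap k / 2)" "x \<bullet> unit_at (theta (Suc k)) = s * cos (angle_gap k / 2)"
  proof -
    have m: "mid_angle k - theta k = - (angle_gap k / 2)" "mid_angle k - theta (Suc k) = angle_gap k / 2" using mid_angle_eq[of k] by linarith+
    show "x \<bullet> unit_at (theta k) = s * cos (angle_gap k / 2)" "x \<bullet> unit_at (theta (Suc k)) = s * cos (angle_gap k / 2)"
      by (simp_all only: s(3) inner_scaleR_left unit_at_inner m cos_minus)
  qed
  have rest: "normal_vec i = unit_at (theta k) \<or> normal_vec i = unit_at (theta (Suc k)) \<or> x \<bullet> normal_vec i \<le> s * cos (angle_gap k / 2) - s * \<delta>" for i
    using \<delta>(2)[of i] mult_left_mono[of "cos (mid_angle k - normal_angle i)" "cos (angle_gap k / 2) - \<delta>" s] s(1)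
    unfolding xi by (auto simp: right_diff_distrib)
  have hx: "circ.h x = s * cos (angle_gap k / 2)"
  proof (rule antisym)
    obtain i where i: "x \<bullet> normal_vec i = circ.h x" using circ.h_attained by blast
    have "0 < s * \<delta>" using s(1) \<delta>(1) by simp
    then show "circ.h x \<le> s * cos (angle_gap k / 2)" using rest[of i] xp i by (auto simp: normal_vec_simps)
    show "s * cos (angle_gap k / 2) \<le> circ.h x" using circ.h_ge[of x "k + 3"] xp(1) by (simp add: normal_vec_simps)
  qed
  have ne: "unit_at (theta k) \<noteq> unit_at (theta (Suc k))" and size: "norm (unit_at (theta k) - unit_at (theta (Suc k))) = 2 * sin (angle_gap k / 2)"
  proof -
    have "0 < sin (angle_gap k / 2)" using angle_gap_bounds[of k] pi_gt_zero by (intro sin_gt_zero) auto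
    then show "norm (unit_at (theta k) - unit_at (theta (Suc k))) = 2 * sin (angle_gap k / 2)"
      unfolding unit_at_dist by (simp add: angle_gap_def)
    then show "unit_at (theta k) \<noteq> unit_at (theta (Suc k))" using \<open>0 < sin (angle_gap k / 2)\<close> by auto
  qed
  have "s * cos (angle_gap k / 2) \<le> 1/2 * 1" using s wall_length(1)[OF angle_gap_bounds[of k]] by (intro mult_mono) auto
  then have dom: "x \<in> circ.domain" by (simp add: circ.domain_def hx)
  have r: "unit_at (theta k) \<in> range normal_vec" for k by (metis normal_vec_simps(4) rangeI)
  have \<delta>': "0 < s * \<delta>" using s \<delta> by simp
  note * = circ.viscosity_solution_jump[OF dom r r ne, unfolded hx, OF xp \<delta>' rest]
  show "x \<in> jump_set circ.domain (viscosity_solution circ.domain)" by (rule *(1))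
  show "jump_size (viscosity_solution circ.domain) x = 2 * sin (angle_gap k / 2)" using *(2) size by simp
qed

text \<open>The norm recovers \<open>s\<close>, and the angles \<open>mid_angle k\<close> are
  distinct in a range where the cosine is injective.\<close>

lemma wall_disjoint: "disjoint_family (\<lambda>k. wall k (1/4) (1/2))"
proof -
  have "k = l" if w: "x \<in> wall k (1/4) (1/2)" "x \<in> wall l (1/4) (1/2)" for x k l
  proof -
    obtain s where s: "1/4 \<le> s" "x = s *\<^sub>R unit_at (mid_angle k)" using w(1) by (auto simp: wall_def)
    obtain t where t: "1/4 \<le> t" "x = t *\<^sub>R unit_at (mid_angle l)" using w(2) by (auto simp: wall_def)
    note st = s t
    have "norm (s *\<^sub>R unit_at (mid_angle k)) = norm (t *\<^sub>R unit_at (mid_angle l))" using st by simp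
    then have "s = t" using st(1,3) by simp
    then have "unit_at (mid_angle k) = unit_at (mid_angle l)" using st by auto
    then have "cos (mid_angle k) = cos (mid_angle l)" by (metis unit_at_nth(1))
    moreover have "mid_angle j \<in> {0..pi}" for j using mid_angle_bounds[of j] pi_gt_zero by simp
    ultimately have "mid_angle k = mid_angle l" using cos_inj_pi[of "mid_angle k" "mid_angle l"] by auto
    then show "k = l" using mid_angle_less[of k l] mid_angle_less[of l k] by (metis linorder_neqE_nat less_irrefl)
  qed
  then show ?thesis by (auto simp: disjoint_family_on_def)
qed

lemma sin_half_ge:
  assumes "0 < x" "x \<le> pi / 4"
  shows "x / 2 \<le> sin x"
proof -
  obtain z where z: "0 < z" "z < x" "sin x - sin 0 = (x - 0) * cos z"
    using MVT2[of 0 x sin cos] assms by (auto intro: DERIV_sin)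
  have "cos (pi / 3) \<le> cos z" using z assms pi_gt_zero by (intro cos_monotone_0_pi_le) auto
  then have "x * (1/2) \<le> x * cos z" using assms by (intro mult_left_mono) (auto simp: cos_60)
  then show ?thesis using z(3) by simp
qed

text \<open>The gaps decay like \<open>1 / (k (ln k)\<^sup>2)\<close>: they are summable, but no power below one of them is.\<close>

lemma jump_powr_not_summable:
  assumes p: "0 \<le> p" "p < 1"
  shows "\<not> summable (\<lambda>k. (2 * sin (angle_gap k / 2)) powr p)"
proof
  assume S: "summable (\<lambda>k. (2 * sin (angle_gap k / 2)) powr p)"
  \<comment> \<open>\<open>q > 1\<close> leaves room for the squared logarithm, so half the gap
    eventually exceeds \<open>(k + 3) powr (- q)\<close>;
    \<open>q * p = 2 * p / (1 + p) \<le> 1\<close> keeps the \<open>p\<close>-th power above the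
    harmonic series.\<close>
  define q where "q = 2 / (1 + p)"
  have q: "1 < q" "q * p \<le> 1" using p by (simp_all add: q_def field_simps)
  have "\<forall>\<^sub>F k in sequentially. (real k + 3) powr (- q) \<le> (pi/2) * ln 2 * (1 / ln (real k + 2) - 1 / ln (real k + 3)) / 2"
    using q(1) by real_asymp
  then have "\<forall>\<^sub>F k in sequentially. norm (inverse (real (k + 3))) \<le> (2 * sin (angle_gap k / 2)) powr p"
  proof eventually_elim
    case (elim k)
    have "angle_gap k = (pi/2) * ln 2 * (1 / ln (real k + 2) - 1 / ln (real k + 3))"
      by (simp add: angle_gap_def theta_def algebra_simps)
    then have "(real k + 3) powr (- q) \<le> angle_gap k / 2" using elim by simp
    also have "\<dots> \<le> 2 * sin (angle_gap k / 2)"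
      using sin_half_ge[of "angle_gap k / 2"] angle_gap_bounds[of k] by simp
    finally have "((real k + 3) powr (- q)) powr p \<le> (2 * sin (angle_gap k / 2)) powr p"
      using p by (intro powr_mono2) auto
    moreover have "inverse (real k + 3) \<le> ((real k + 3) powr (- q)) powr p"
    proof -
      have "inverse (real k + 3) = (real k + 3) powr (- 1)" by (simp add: powr_minus)
      also have "\<dots> \<le> (real k + 3) powr (- q * p)" using q(2) by (intro powr_mono) auto
      also have "\<dots> = ((real k + 3) powr (- q)) powr p" by (simp add: powr_powr)
      finally show ?thesis .
    qed
    ultimately show ?case by simp
  qed
  then have "summable (\<lambda>k. inverse (real (k + 3)))" by (rule summable_comparison_test_ev[OF _ S])
  then have "summable (\<lambda>k. inverse (real k))" by (rule summable_iff_shift[THEN iffD1])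
  then show False using not_summable_harmonic[where 'a = real] by simp
qed

text \<open>All wall pieces share one lower bound on their length, so the energy dominates a
  multiple of the divergent series in \<open>jump_powr_not_summable\<close>.\<close>

lemma viscosity_energy_infinite:
  assumes p: "0 \<le> p" "p < 1"
  shows "line_energy (\<lambda>t. ennreal (t powr p)) circ.domain (viscosity_solution circ.domain) = \<infinity>"
proof -
  let ?m = "viscosity_solution circ.domain"
  define W where "W k = wall k (1/4) (1/2)" for k
  define J where "J k = (2 * sin (angle_gap k / 2)) powr p" for k
  have Wb [measurable]: "W k \<in> sets hausdorff1" for k unfolding W_def wall_def using segment_borel by simp
  \<comment> \<open>The norm is 1-Lipschitz and maps the piece onto an interval of length 1/4;
    \<open>hausdorff1_outer_ge_interval\<close> loses a factor 2.\<close>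
  have W8: "ennreal (1/8) \<le> emeasure hausdorff1 (W k)" for k
  proof -
    have "ennreal ((1/2 - 1/4) / 2) \<le> hausdorff1_outer (W k)"
    proof (rule hausdorff1_outer_ge_interval[where p = norm])
      show "\<bar>norm x - norm y\<bar> \<le> dist x y" for x y :: "real^2" by (simp add: dist_norm norm_triangle_ineq3)
      show "{1/4..1/2} \<subseteq> norm ` W k"
      proof
        fix s :: real assume s: "s \<in> {1/4..1/2}"
        then have "s = norm (s *\<^sub>R unit_at (mid_angle k))" by simp
        moreover have "s *\<^sub>R unit_at (mid_angle k) \<in> W k" using s by (auto simp: W_def wall_def)
        ultimately show "s \<in> norm ` W k" by blast
      qed
    qed simp
    then show ?thesis using Wb[of k] by (simp add: emeasure_hausdorff1)
  qed
  have J: "0 \<le> J k" for k by (simp add: J_def)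
  have "\<not> summable J" unfolding J_def[abs_def] by (rule jump_powr_not_summable[OF p])
  then have "(\<Sum>k. ennreal (J k)) = top" using summable_suminf_not_top[of J, OF J] by blast
  then have "\<infinity> = (\<Sum>k. ennreal (J k) * ennreal (1/8))"
    unfolding ennreal_suminf_multc by (simp add: ennreal_top_mult)
  also have "\<dots> \<le> (\<Sum>k. ennreal (J k) * emeasure hausdorff1 (W k))"
    by (intro suminf_le mult_left_mono W8) auto
  also have "\<dots> = (\<Sum>k. \<integral>\<^sup>+x. ennreal (J k) * indicator (W k) x \<partial>hausdorff1)"
    using Wb by (simp add: nn_integral_cmult_indicator)
  also have "\<dots> = (\<integral>\<^sup>+x. (\<Sum>k. ennreal (J k) * indicator (W k) x) \<partial>hausdorff1)"
    by (rule nn_integral_suminf[symmetric]) measurable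
  also have "\<dots> \<le> line_energy (\<lambda>t. ennreal (t powr p)) circ.domain ?m"
    unfolding line_energy_def
  proof (rule nn_integral_mono)
    fix x
    show "(\<Sum>k. ennreal (J k) * indicator (W k) x)
        \<le> ennreal (jump_size ?m x powr p) * indicator (jump_set circ.domain ?m) x"
    proof (cases "\<exists>k. x \<in> W k")
      case True
      then obtain k where k: "x \<in> W k" by blast
      \<comment> \<open>Disjointness of the walls leaves one term of the series at each
        point.\<close>
      have "(\<Sum>k. ennreal (J k) * indicator (W k) x) = ennreal (J k)"
        using wall_disjoint k unfolding W_def by (rule suminf_cmult_indicator)
      then show ?thesis using viscosity_solution_wall[OF k[unfolded W_def]] by (simp add: J_def)
    next
      case False
      then show ?thesis by simp
    qed
  qed
  finally show ?thesis by (simp add: top_unique)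
qed

theorem corollary1:
  "\<exists>\<Omega> :: (real^2) set. lipschitz_domain \<Omega> \<and> convex \<Omega> \<and>
     (\<forall>p :: real. 0 \<le> p \<and> p < 1 \<longrightarrow>
        \<not> (\<forall>m\<in>admissible0 \<Omega>.
             line_energy (\<lambda>t. ennreal (t powr p)) \<Omega> (viscosity_solution \<Omega>)
               \<le> line_energy (\<lambda>t. ennreal (t powr p)) \<Omega> m))"
proof (intro exI conjI allI impI)
  show "lipschitz_domain circ.domain" by (rule circ.lipschitz_domain_domain)
  show "convex circ.domain" by (rule circ.convex_domain)
  fix p :: real assume "0 \<le> p \<and> p < 1"
  then have "line_energy (\<lambda>t. ennreal (t powr p)) circ.domain circ.field
      < line_energy (\<lambda>t. ennreal (t powr p)) circ.domain (viscosity_solution circ.domain)"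
    using competitor_energy_finite[of p] viscosity_energy_infinite[of p] by simp
  then show "\<not> (\<forall>m\<in>admissible0 circ.domain.
      line_energy (\<lambda>t. ennreal (t powr p)) circ.domain (viscosity_solution circ.domain)
        \<le> line_energy (\<lambda>t. ennreal (t powr p)) circ.domain m)"
    using circ.field_admissible0 by (auto simp: not_le)
qed

end
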